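(* Let $l$ and $N$ be positive integers, and let $\mathbf{r}=(r_1,r_2,\dots)$, $\mathbf{r}'=(r_1',r_2',\dots)$ be sequences of integers such that, for every positive integer $n$, $r_n\neq0$ or $r_n'\neq0$ implies $n\mid N$, and such that $\sum_{n\mid N}r_n=\sum_{n\mid N}r_n'$. Let $\chi$ and $\chi'$ be Dirichlet characters modulo $N$. Put $k=\frac12\sum_{n\mid N}r_n$ and $\delta=l^{2|k|}\prod_{n\mid N,\ 2\nmid r_n-r_n'}n$. Then the characters $\chi\cdot v_{\mathbf r}$ and $\chi'\cdot v_{\mathbf r'}$ of $\widetilde{\Gamma_0(N)}$ are $\widetilde{\begin{pmatrix}1&0\\0&l\end{pmatrix}}$-compatible if and only if the following four conditions hold: (1) $l\sum_{n\mid N}\frac{N}{n}r_n\equiv\sum_{n\mid N}\frac{N}{n}r_n'\pmod{24}$; (2) $\sum_{n\mid N}nr_n\equiv l\sum_{n\mid N}nr_n'\pmod{24}$; (3) if $2\nmid Nl$, then $\delta\equiv1\pmod 4$; (4) $\chi(d)\chi'(d)^{-1}=\left(\frac{\delta}{d}\right)$ for every nonzero integer $d$ with $\gcd(Nl,d)=1$. In particular, $v_{\mathbf r}$ and $v_{\mathbf r'}$ are $\widetilde{\begin{pmatrix}1&0\\0&l\end{pmatrix}}$-compatible if and only if (1) and (2) hold and $\delta$ is a perfect square.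
   Context: Metaplectic group: $\widetilde{\mathrm{GL}_2^+(\mathbb R)}$ is the set of pairs $(A,\varepsilon)$ with $A\in\mathrm{GL}_2^+(\mathbb R)$ and $\varepsilon\in\{\pm1\}$, with multiplication $(A_1,\varepsilon_1)(A_2,\varepsilon_2)=(A_1A_2,\varepsilon_1\varepsilon_2\sigma(A_1,A_2))$, where for $A_i=\begin{pmatrix}a_i&b_i\\c_i&d_i\end{pmatrix}$ one sets $\sigma(A_1,A_2)=\sqrt{c_1\frac{a_2\tau+b_2}{c_2\tau+d_2}+d_1}\,\sqrt{c_2\tau+d_2}\,/\sqrt{c_1(a_2\tau+b_2)+d_1(c_2\tau+d_2)}\in\{\pm1\}$ (independent of $\tau$ in the upper half-plane $\mathbb H$; principal branch $-\pi/2<\arg\sqrt z\le\pi/2$). For a subgroup $G\subseteq\mathrm{GL}_2^+(\mathbb R)$, $\widetilde G$ denotes its preimage under $(A,\varepsilon)\mapsto A$, and $\widetilde A=(A,1)$. $\Gamma_0(N)$ is the group of matrices in $\mathrm{SL}_2(\mathbb Z)$ with lower-left entry divisible by $N$. For a group $H$, subgroup $G$, $\alpha\in H$ and a homomorphism $v:G\to\mathbb C^\times$, write $G^\alpha=\alpha^{-1}G\alpha$ and $v^\alpha(\alpha^{-1}g\alpha)=v(g)$. Two characters $v_1,v_2$ of $G$ are called $\alpha$-compatible if $v_1^\alpha=v_2$ on $G\cap G^\alpha$. The Dedekind eta function is $\eta(\tau)=e^{2\pi i\tau/24}\prod_{n\ge1}(1-e^{2\pi i n\tau})$, and $v_\eta$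 is the character of $\widetilde{\mathrm{SL}_2(\mathbb Z)}$ with $\eta|_{1/2}\gamma=v_\eta(\gamma)\eta$, where for $k\in\frac12\mathbb Z$, $(f|_k(A,\varepsilon))(\tau)=\varepsilon^{-2k}(\det A)^{k/2}(c\tau+d)^{-k}f\big(\frac{a\tau+b}{c\tau+d}\big)$ for $A=\begin{pmatrix}a&b\\c&d\end{pmatrix}$ (powers of $c\tau+d$ via the principal square root). For $\mathbf r$ supported on divisors of $N$, $v_{\mathbf r}$ is the character of $\widetilde{\Gamma_0(N)}$ given by $v_{\mathbf r}\left(\begin{pmatrix}a&b\\c&d\end{pmatrix},\varepsilon\right)=\prod_{n\mid N}v_\eta\left(\begin{pmatrix}a&bn\\c/n&d\end{pmatrix},\varepsilon\right)^{r_n}$ (the character of the eta-quotient $\prod_{n\mid N}\eta(n\tau)^{r_n}$). A Dirichlet character $\chi$ mod $N$ is viewed as the character $\chi\left(\begin{pmatrix}a&b\\c&d\end{pmatrix},\varepsilon\right)=\chi(d)$ of $\widetilde{\Gamma_0(N)}$. $\left(\frac{m}{n}\right)$ is the Kronecker–Jacobi symbol: Legendre symbol for odd primes $n$; $\left(\frac m2\right)=0$ if $m$ even and $(-1)^{(m^2-1)/8}$ if $m$ odd; $\left(\frac m{-1}\right)=1$ if $m\ge0$ and $-1$ otherwise; $\left(\frac m1\right)=1$; completely multiplicative in $n\ne0$; $\left(\frac m0\right)=0$ unless $m=\pm1$, where it is $1$. *)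

theory Defs
  imports
    "HOL-Analysis.Analysis"
    "HOL-Algebra.Coset"
    "HOL-Number_Theory.Number_Theory"
begin

section \<open>The metaplectic cover of \<open>GL\<^sub>2\<^sup>+(\<real>)\<close>\<close>

definition mat2 :: "real \<Rightarrow> real \<Rightarrow> real \<Rightarrow> real \<Rightarrow> real^2^2" where
  "mat2 a b c d = vector [vector [a, b], vector [c, d]]"

definition moebius :: "real^2^2 \<Rightarrow> complex \<Rightarrow> complex" where
  "moebius A \<tau> = (of_real (A$1$1) * \<tau> + of_real (A$1$2)) / (of_real (A$2$1) * \<tau> + of_real (A$2$2))"

definition autfac :: "real^2^2 \<Rightarrow> complex \<Rightarrow> complex" where
  "autfac A \<tau> = of_real (A$2$1) * \<tau> + of_real (A$2$2)"

text \<open>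
  The value at \<open>\<tau>\<close> of the quotient of square roots that defines the cocycle. The library function
  \<^const>\<open>csqrt\<close> is the branch with argument in \<open>(-\<pi>/2, \<pi>/2]\<close>.
\<close>
definition sigma_at :: "complex \<Rightarrow> real^2^2 \<Rightarrow> real^2^2 \<Rightarrow> complex" where
  "sigma_at \<tau> A B =
     csqrt (of_real (A$2$1) * moebius B \<tau> + of_real (A$2$2)) * csqrt (of_real (B$2$1) * \<tau> + of_real (B$2$2))
     / csqrt (of_real (A$2$1) * (of_real (B$1$1) * \<tau> + of_real (B$1$2))
              + of_real (A$2$2) * (of_real (B$2$1) * \<tau> + of_real (B$2$2)))"

text \<open>
  The quotient does not depend on the point of the upper half-plane and takes values in
  \<open>{1, -1}\<close>; see \<open>sigma_at_eq\<close> and \<open>sigma_sign\<close> below.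
\<close>
definition sigma :: "real^2^2 \<Rightarrow> real^2^2 \<Rightarrow> complex" where
  "sigma A B = sigma_at \<i> A B"

text \<open>The signs \<open>\<epsilon>\<close> are represented as the complex numbers \<open>1\<close> and \<open>-1\<close>.\<close>
definition Mp :: "((real^2^2) \<times> complex) monoid" where
  "Mp = \<lparr>carrier = {A. det A > 0} \<times> {1, -1},
         mult = (\<lambda>x y. (fst x ** fst y, snd x * snd y * sigma (fst x) (fst y))),
         one = (mat 1, 1)\<rparr>"

definition mp_preimage :: "(real^2^2) set \<Rightarrow> ((real^2^2) \<times> complex) set" where
  "mp_preimage G = {x \<in> carrier Mp. fst x \<in> G}"

definition Gamma0 :: "nat \<Rightarrow> (real^2^2) set" where
  "Gamma0 N = {mat2 (of_int a) (of_int b) (of_int c) (of_int d) | a b c d :: int.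
                 a * d - b * c = 1 \<and> int N dvd c}"

section \<open>Conjugation of characters and compatibility\<close>

definition conj_set :: "('a, 'b) monoid_scheme \<Rightarrow> 'a \<Rightarrow> 'a set \<Rightarrow> 'a set" where
  "conj_set H \<alpha> G = (\<lambda>g. inv\<^bsub>H\<^esub> \<alpha> \<otimes>\<^bsub>H\<^esub> g \<otimes>\<^bsub>H\<^esub> \<alpha>) ` G"

text \<open>
  For \<open>x = \<alpha>\<inverse> g \<alpha>\<close> the value is \<open>v g\<close>; see \<open>conj_char_conj\<close> below.
\<close>
definition conj_char :: "('a, 'b) monoid_scheme \<Rightarrow> 'a \<Rightarrow> ('a \<Rightarrow> complex) \<Rightarrow> 'a \<Rightarrow> complex" where
  "conj_char H \<alpha> v x = v (\<alpha> \<otimes>\<^bsub>H\<^esub> x \<otimes>\<^bsub>H\<^esub> inv\<^bsub>H\<^esub> \<alpha>)"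

definition compatible ::
  "('a, 'b) monoid_scheme \<Rightarrow> 'a set \<Rightarrow> 'a \<Rightarrow> ('a \<Rightarrow> complex) \<Rightarrow> ('a \<Rightarrow> complex) \<Rightarrow> bool" where
  "compatible H G \<alpha> v1 v2 \<longleftrightarrow> (\<forall>x \<in> G \<inter> conj_set H \<alpha> G. conj_char H \<alpha> v1 x = v2 x)"

section \<open>The eta function and its character\<close>

text \<open>
  The slash operator of weight \<open>w/2\<close>, parametrised by the integer \<open>w\<close> (twice the weight).
\<close>
definition slash :: "int \<Rightarrow> (complex \<Rightarrow> complex) \<Rightarrow> (real^2^2) \<times> complex \<Rightarrow> complex \<Rightarrow> complex" where
  "slash w f = (\<lambda>(A, \<epsilon>) \<tau>. \<epsilon> powi (-w) * of_real (det A powr (of_int w / 4))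
                   * csqrt (autfac A \<tau>) powi (-w) * f (moebius A \<tau>))"

definition dedekind_eta :: "complex \<Rightarrow> complex" where
  "dedekind_eta \<tau> = exp (2 * of_real pi * \<i> * \<tau> / 24)
                     * prodinf (\<lambda>n. 1 - exp (2 * of_real pi * \<i> * of_nat (Suc n) * \<tau>))"

definition v_eta :: "(real^2^2) \<times> complex \<Rightarrow> complex" where
  "v_eta \<gamma> = (THE v. \<forall>\<tau>. Im \<tau> > 0 \<longrightarrow> slash 1 dedekind_eta \<gamma> \<tau> = v * dedekind_eta \<tau>)"

definition eta_quotient_char :: "nat \<Rightarrow> (nat \<Rightarrow> int) \<Rightarrow> (real^2^2) \<times> complex \<Rightarrow> complex" where
  "eta_quotient_char N r = (\<lambda>(A, \<epsilon>). \<Prod>n | n dvd N.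
      v_eta (mat2 (A$1$1) (A$1$2 * of_nat n) (A$2$1 / of_nat n) (A$2$2), \<epsilon>) powi r n)"

section \<open>Dirichlet characters and the Kronecker symbol\<close>

definition dirichlet_char :: "nat \<Rightarrow> (int \<Rightarrow> complex) \<Rightarrow> bool" where
  "dirichlet_char N \<psi> \<longleftrightarrow>
     \<psi> 1 = 1 \<and> (\<forall>a b. \<psi> (a * b) = \<psi> a * \<psi> b) \<and> (\<forall>a. \<psi> (a + int N) = \<psi> a) \<and>
     (\<forall>a. \<psi> a = 0 \<longleftrightarrow> \<not> coprime a (int N))"

text \<open>
  On the preimage of \<^term>\<open>Gamma0 N\<close> the lower right entry is an integer; the floor function
  only serves to read it as an element of \<^typ>\<open>int\<close>.
\<close>
definition char_of_dirichlet :: "(int \<Rightarrow> complex) \<Rightarrow> (real^2^2) \<times> complex \<Rightarrow> complex" where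
  "char_of_dirichlet \<psi> = (\<lambda>(A, \<epsilon>). \<psi> \<lfloor>A$2$2\<rfloor>)"

definition kronecker_prime :: "int \<Rightarrow> int \<Rightarrow> int" where
  "kronecker_prime m p =
     (if p = 2 then (if even m then 0 else (-1) ^ nat ((m\<^sup>2 - 1) div 8)) else Legendre m p)"

text \<open>
  For negative \<open>n\<close>, \<^const>\<open>prime_factorization\<close> consists of the positive primes dividing \<open>n\<close>,
  so the unit \<open>-1\<close> is accounted for by the separate sign.
\<close>
definition kronecker :: "int \<Rightarrow> int \<Rightarrow> int" where
  "kronecker m n =
     (if n = 0 then (if \<bar>m\<bar> = 1 then 1 else 0)
      else (if n < 0 \<and> m < 0 then -1 else 1) * (\<Prod>p\<in>#prime_factorization n. kronecker_prime m p))"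

section \<open>Well-definedness of the group structure\<close>

lemma mat2_nth [simp]:
  "mat2 a b c d $ 1 $ 1 = a" "mat2 a b c d $ 1 $ 2 = b"
  "mat2 a b c d $ 2 $ 1 = c" "mat2 a b c d $ 2 $ 2 = d"
  by (simp_all add: mat2_def)

lemma mat2_eta: "mat2 (A$1$1) (A$1$2) (A$2$1) (A$2$2) = A"
  by (simp add: vec_eq_iff forall_2)

lemma det_mat2 [simp]: "det (mat2 a b c d) = a * d - b * c"
  by (simp add: det_2)

lemma matrix_mult_nth_2:
  fixes A B :: "real^2^2"
  shows "(A ** B) $ i $ j = A$i$1 * B$1$j + A$i$2 * B$2$j"
  by (simp add: matrix_matrix_mult_def sum_2)

lemma autfac_nonzero:
  assumes "det A > 0" "Im \<tau> > 0"
  shows "autfac A \<tau> \<noteq> 0"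
proof
  assume "autfac A \<tau> = 0"
  then have "Re (autfac A \<tau>) = 0" "Im (autfac A \<tau>) = 0" by simp_all
  then have "A$2$1 = 0" "A$2$2 = 0" using assms(2) by (auto simp: autfac_def)
  then show False using assms(1) by (simp add: det_2)
qed

lemma Im_moebius:
  assumes "det A > 0" "Im \<tau> > 0"
  shows "Im (moebius A \<tau>) > 0"
proof -
  let ?d = "autfac A \<tau>"
  have "moebius A \<tau> = (of_real (A$1$1) * \<tau> + of_real (A$1$2)) * cnj ?d / of_real ((cmod ?d)\<^sup>2)"
    unfolding moebius_def autfac_def [symmetric]
    by (subst complex_div_cnj) (simp add: autfac_def)
  moreover have "Im ((of_real (A$1$1) * \<tau> + of_real (A$1$2)) * cnj ?d) = det A * Im \<tau>"
    by (simp add: autfac_def det_2 algebra_simps)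
  ultimately have "Im (moebius A \<tau>) = det A * Im \<tau> / (cmod ?d)\<^sup>2"
    by (simp only: Im_divide_of_real)
  then show ?thesis using assms autfac_nonzero [OF assms] by simp
qed

lemma autfac_mult:
  assumes "det B > 0" "Im \<tau> > 0"
  shows "autfac (A ** B) \<tau> = autfac A (moebius B \<tau>) * autfac B \<tau>"
  using autfac_nonzero [OF assms]
  by (simp add: autfac_def moebius_def matrix_mult_nth_2 field_simps)

lemma moebius_mult:
  assumes "det A > 0" "det B > 0" "Im \<tau> > 0"
  shows "moebius (A ** B) \<tau> = moebius A (moebius B \<tau>)"
proof -
  have nz: "autfac B \<tau> \<noteq> 0" using assms autfac_nonzero by blast
  have num: "of_real (A$1$1) * moebius B \<tau> + of_real (A$1$2)
       = (of_real ((A ** B)$1$1) * \<tau> + of_real ((A ** B)$1$2)) / autfac B \<tau>"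
    using nz by (simp add: autfac_def moebius_def matrix_mult_nth_2 field_simps)
  have den: "autfac A (moebius B \<tau>) = autfac (A ** B) \<tau> / autfac B \<tau>"
    using nz autfac_mult [OF assms(2,3)] by simp
  show ?thesis
    using nz unfolding moebius_def [of A "moebius B \<tau>"] autfac_def [symmetric] num den
    by (simp add: moebius_def autfac_def)
qed

lemma sigma_at_autfac:
  "sigma_at \<tau> A B = csqrt (autfac A (moebius B \<tau>)) * csqrt (autfac B \<tau>) / csqrt (autfac (A ** B) \<tau>)"
  by (simp add: sigma_at_def autfac_def matrix_mult_nth_2 algebra_simps)

lemma sigma_at_sign:
  assumes "det A > 0" "det B > 0" "Im \<tau> > 0"
  shows "sigma_at \<tau> A B \<in> {1, -1}"
proof -
  have nz: "autfac (A ** B) \<tau> \<noteq> 0"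
    using assms by (intro autfac_nonzero) (simp_all add: det_mul)
  have "(sigma_at \<tau> A B)\<^sup>2 = 1"
    using nz autfac_mult [OF assms(2,3), of A]
    by (simp add: sigma_at_autfac power_divide power_mult_distrib)
  then show ?thesis by (simp add: power2_eq_1_iff)
qed

lemma continuous_csqrt_autfac:
  assumes "det A > 0" "continuous_on S f" "\<And>\<tau>. \<tau> \<in> S \<Longrightarrow> Im (f \<tau>) > 0"
  shows "continuous_on S (\<lambda>\<tau>. csqrt (autfac A (f \<tau>)))"
proof (cases "A$2$1 = 0")
  case True
  then show ?thesis by (simp add: autfac_def)
next
  case False
  have *: "continuous_on S (\<lambda>\<tau>. autfac A (f \<tau>))"
    unfolding autfac_def by (intro continuous_intros assms(2))
  have "autfac A (f \<tau>) \<notin> \<real>\<^sub>\<le>\<^sub>0" if "\<tau> \<in> S" for \<tau>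
  proof
    assume "autfac A (f \<tau>) \<in> \<real>\<^sub>\<le>\<^sub>0"
    then have "Im (autfac A (f \<tau>)) = 0" by (simp add: complex_nonpos_Reals_iff)
    then show False using False assms(3) [OF that] by (simp add: autfac_def)
  qed
  then have "continuous_on ((\<lambda>\<tau>. autfac A (f \<tau>)) ` S) csqrt"
    by (intro continuous_at_imp_continuous_on) (auto intro: continuous_at_csqrt)
  from continuous_on_compose2 [OF this *] show ?thesis by simp
qed

lemma sigma_at_eq:
  assumes "det A > 0" "det B > 0" "Im \<tau> > 0"
  shows "sigma_at \<tau> A B = sigma A B"
proof -
  let ?H = "{z. Im z > 0}"
  have AB: "det (A ** B) > 0" using assms by (simp add: det_mul)
  have moeb: "continuous_on ?H (moebius B)"
    unfolding moebius_def
    using autfac_nonzero [OF assms(2)]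
    by (intro continuous_intros) (auto simp: autfac_def)
  have cont: "continuous_on ?H (\<lambda>\<tau>. sigma_at \<tau> A B)"
    unfolding sigma_at_autfac
    by (intro continuous_intros continuous_csqrt_autfac assms moeb AB)
       (auto simp: Im_moebius [OF assms(2)] autfac_nonzero [OF AB])
  have conn: "connected ?H"
    by (intro convex_connected convex_halfspace_Im_gt)
  have fin: "finite ((\<lambda>\<tau>. sigma_at \<tau> A B) ` ?H)"
    by (rule finite_subset [of _ "{1, -1}"]) (use sigma_at_sign [OF assms(1,2)] in auto)
  have "(\<lambda>\<tau>. sigma_at \<tau> A B) constant_on ?H"
    using continuous_finite_range_constant [OF conn cont fin] .
  then show ?thesis using assms(3) by (auto simp: constant_on_def sigma_def)
qed

lemma sigma_sign:
  assumes "det A > 0" "det B > 0"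
  shows "sigma A B \<in> {1, -1}"
  using sigma_at_sign [OF assms, of \<i>] by (simp add: sigma_def)

lemma sigma_cocycle:
  assumes "det A > 0" "det B > 0" "det C > 0"
  shows "sigma A B * sigma (A ** B) C = sigma A (B ** C) * sigma B C"
proof -
  let ?t = "moebius C \<i>"
  have t: "Im ?t > 0" using assms by (simp add: Im_moebius)
  have BC: "det (B ** C) > 0" and AB: "det (A ** B) > 0" using assms by (simp_all add: det_mul)
  have nz: "autfac (A ** B) ?t \<noteq> 0" "autfac (B ** C) \<i> \<noteq> 0"
    using autfac_nonzero [OF AB t] autfac_nonzero [OF BC] by simp_all
  have "sigma A B = sigma_at ?t A B" using sigma_at_eq [OF assms(1,2) t] by simp
  then show ?thesis
    using nz by (simp add: sigma_def sigma_at_autfac moebius_mult [OF assms(2,3)] matrix_mul_assoc)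
qed

lemma sigma_one: "det A > 0 \<Longrightarrow> sigma (mat 1) A = 1" "det A > 0 \<Longrightarrow> sigma A (mat 1) = 1"
proof -
  assume "det A > 0"
  then have "autfac A \<i> \<noteq> 0" by (intro autfac_nonzero) simp_all
  moreover have "autfac (mat 1) z = 1" "moebius (mat 1) z = z" for z
    by (simp_all add: autfac_def moebius_def mat_def)
  ultimately show "sigma (mat 1) A = 1" "sigma A (mat 1) = 1"
    by (simp_all add: sigma_def sigma_at_autfac)
qed

lemma group_Mp: "group Mp"
proof (rule groupI)
  fix x y assume "x \<in> carrier Mp" "y \<in> carrier Mp"
  then show "x \<otimes>\<^bsub>Mp\<^esub> y \<in> carrier Mp"
    using sigma_sign [of "fst x" "fst y"] by (auto simp: Mp_def det_mul)
next
  show "\<one>\<^bsub>Mp\<^esub> \<in> carrier Mp" by (simp add: Mp_def)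
next
  fix x y z assume "x \<in> carrier Mp" "y \<in> carrier Mp" "z \<in> carrier Mp"
  then show "x \<otimes>\<^bsub>Mp\<^esub> y \<otimes>\<^bsub>Mp\<^esub> z = x \<otimes>\<^bsub>Mp\<^esub> (y \<otimes>\<^bsub>Mp\<^esub> z)"
    using sigma_cocycle [of "fst x" "fst y" "fst z"]
    by (auto simp: Mp_def matrix_mul_assoc)
next
  fix x assume "x \<in> carrier Mp"
  then show "\<one>\<^bsub>Mp\<^esub> \<otimes>\<^bsub>Mp\<^esub> x = x" by (auto simp: Mp_def sigma_one)
next
  fix x assume x: "x \<in> carrier Mp"
  then have det: "det (fst x) > 0" by (auto simp: Mp_def)
  then obtain B where B: "B ** fst x = mat 1"
    using invertible_det_nz [of "fst x"] by (auto simp: invertible_def)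
  then have "det B * det (fst x) = 1" by (metis det_mul det_I)
  then have detB: "det B > 0" using det by (metis zero_less_mult_pos2 zero_less_one)
  have "(B, snd x * sigma B (fst x)) \<in> carrier Mp"
    "(B, snd x * sigma B (fst x)) \<otimes>\<^bsub>Mp\<^esub> x = \<one>\<^bsub>Mp\<^esub>"
    using x detB B sigma_sign [OF detB det] by (auto simp: Mp_def)
  then show "\<exists>y\<in>carrier Mp. y \<otimes>\<^bsub>Mp\<^esub> x = \<one>\<^bsub>Mp\<^esub>" by blast
qed

lemma (in group) conj_char_conj:
  assumes "\<alpha> \<in> carrier G" "g \<in> carrier G"
  shows "conj_char G \<alpha> v (inv \<alpha> \<otimes> g \<otimes> \<alpha>) = v g"
proof -
  have "\<alpha> \<otimes> (inv \<alpha> \<otimes> g \<otimes> \<alpha>) \<otimes> inv \<alpha> = (\<alpha> \<otimes> inv \<alpha>) \<otimes> g \<otimes> (\<alpha> \<otimes> inv \<alpha>)"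
    using assms by (simp only: m_assoc m_closed inv_closed)
  then show ?thesis using assms by (simp add: conj_char_def)
qed

lemma Gamma0I:
  assumes "A = mat2 (of_int a) (of_int b) (of_int c) (of_int d)" "a * d - b * c = 1" "int N dvd c"
  shows "A \<in> Gamma0 N"
  unfolding Gamma0_def using assms by blast

lemma Gamma0_mult: "A \<in> Gamma0 N \<Longrightarrow> B \<in> Gamma0 N \<Longrightarrow> A ** B \<in> Gamma0 N"
proof -
  assume "A \<in> Gamma0 N" "B \<in> Gamma0 N"
  then obtain a b c d e f g h :: int where
    A: "A = mat2 a b c d" "a * d - b * c = 1" "int N dvd c" and
    B: "B = mat2 e f g h" "e * h - f * g = 1" "int N dvd g"
    by (auto simp: Gamma0_def)
  have "A ** B = mat2 (of_int (a * e + b * g)) (of_int (a * f + b * h))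
                      (of_int (c * e + d * g)) (of_int (c * f + d * h))"
    by (simp add: vec_eq_iff forall_2 matrix_mult_nth_2 A B)
  moreover have "(a * e + b * g) * (c * f + d * h) - (a * f + b * h) * (c * e + d * g)
                 = (a * d - b * c) * (e * h - f * g)"
    by (simp add: algebra_simps)
  then have "(a * e + b * g) * (c * f + d * h) - (a * f + b * h) * (c * e + d * g) = 1"
    by (simp only: A(2) B(2) mult_1)
  moreover have "int N dvd c * e + d * g" using A B by simp
  ultimately show ?thesis by (rule Gamma0I)
qed

lemma Gamma0_inverse: "A \<in> Gamma0 N \<Longrightarrow> \<exists>B \<in> Gamma0 N. B ** A = mat 1"
proof -
  assume "A \<in> Gamma0 N"
  then obtain a b c d :: int where
    A: "A = mat2 a b c d" "a * d - b * c = 1" "int N dvd c"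
    by (auto simp: Gamma0_def)
  have "real_of_int (a * d - b * c) = 1" using A(2) by simp
  then have "mat2 (of_int d) (of_int (-b)) (of_int (-c)) (of_int a) ** A = mat 1"
    by (simp add: vec_eq_iff forall_2 matrix_mult_nth_2 A(1) mat_def algebra_simps)
  moreover have "mat2 (of_int d) (of_int (-b)) (of_int (-c)) (of_int a) \<in> Gamma0 N"
  proof -
    have "d * a - (-b) * (-c) = 1" "int N dvd -c" using A by (simp_all add: algebra_simps)
    then show ?thesis unfolding Gamma0_def by blast
  qed
  ultimately show ?thesis by blast
qed

lemma subgroup_Gamma0: "subgroup (mp_preimage (Gamma0 N)) Mp"
proof -
  interpret group Mp by (rule group_Mp)
  show ?thesis
  proof (rule subgroupI)
    show "mp_preimage (Gamma0 N) \<subseteq> carrier Mp" by (auto simp: mp_preimage_def)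
  next
    have "(mat 1 :: real^2^2) = mat2 (of_int 1) (of_int 0) (of_int 0) (of_int 1)"
      by (simp add: vec_eq_iff forall_2 mat_def)
    then have "mat 1 \<in> Gamma0 N" by (rule Gamma0I) simp_all
    then have "(mat 1, 1) \<in> mp_preimage (Gamma0 N)" by (simp add: mp_preimage_def Mp_def)
    then show "mp_preimage (Gamma0 N) \<noteq> {}" by blast
  next
    fix x assume x: "x \<in> mp_preimage (Gamma0 N)"
    then have xc: "x \<in> carrier Mp" by (simp add: mp_preimage_def)
    from x obtain B where B: "B \<in> Gamma0 N" "B ** fst x = mat 1"
      using Gamma0_inverse by (auto simp: mp_preimage_def)
    have "inv\<^bsub>Mp\<^esub> x \<otimes>\<^bsub>Mp\<^esub> x = \<one>\<^bsub>Mp\<^esub>" using xc by simp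
    then have "fst (inv\<^bsub>Mp\<^esub> x) ** fst x = mat 1" by (simp add: Mp_def)
    with B(2) have "fst (inv\<^bsub>Mp\<^esub> x) = B"
      by (metis matrix_left_right_inverse matrix_mul_assoc matrix_mul_lid matrix_mul_rid)
    then show "inv\<^bsub>Mp\<^esub> x \<in> mp_preimage (Gamma0 N)"
      using xc B(1) by (simp add: mp_preimage_def)
  next
    fix x y assume "x \<in> mp_preimage (Gamma0 N)" "y \<in> mp_preimage (Gamma0 N)"
    then have "x \<otimes>\<^bsub>Mp\<^esub> y \<in> carrier Mp" "fst x ** fst y \<in> Gamma0 N"
      by (auto simp: mp_preimage_def Gamma0_mult)
    then show "x \<otimes>\<^bsub>Mp\<^esub> y \<in> mp_preimage (Gamma0 N)"
      by (simp add: mp_preimage_def Mp_def)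
  qed
qed

end

theory Submission
  imports Defs "HOL-Computational_Algebra.Nth_Powers"
begin

text \<open>
  The transformation behaviour of \<open>\<eta>\<close> under inversion follows from that of its logarithmic derivative, a
  multiple of the Eisenstein series \<open>G\<^sub>2\<close>, whose conditionally convergent double sum is compared with a
  telescoping one. An explicit formula for \<open>v\<^sub>\<eta>\<close> at matrices with odd lower right entry \<open>d\<close>,
  a Kronecker symbol times a 24th root of unity, is propagated by a Euclidean algorithm on the lower row that
  keeps \<open>d\<close> odd. In the quotient of the two characters at \<open>(a, l\<beta>; N\<gamma>, d)\<close> everything cancels
  except \<open>\<chi>(d) \<chi>'(d)\<inverse> (\<delta>/d)\<close> and a 24th root of unity whose exponent is a combination of the
  differences of the two sides of (1) and of (2). Even \<open>d\<close> only occurs for odd \<open>Nl\<close>, and is removed by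
  multiplying with \<open>(1, l; 0, 1)\<close>.
\<close>

section \<open>The Kronecker symbol\<close>

text \<open>The usual pair of formulas for the eta multiplier distinguishes the parity of the lower
  left entry c. Fixing odd d instead leaves one formula and one symbol (c/d). The price is that the
  symbol is needed for both signs of c and d, where the convention at -1 has to agree with the
  principal square root. For the matrices belonging to the divisors n of N, the product of the
  off-diagonal entries does not depend on n. The total exponent therefore sees r only through the
  two weighted sums in (1), (2) and through the weight, and equal weights cancel. The unipotent
  matrices isolate (1) and (2), so these are necessary. What remains is a condition on the odd d
  prime to Nl. For even Nl these are all d prime to Nl. For odd Nl, (3) is exactly what makes the
  condition at odd d equivalent to (4) at all d: it gives \<delta> = 1 mod 4, hence a symbol of
  period \<delta>. For trivial characters the odd d alone detect whether \<delta> is a square, by a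
  prime of odd exponent in \<delta>.\<close>

lemma odd_pos_int_induct [consumes 2, case_names one mult]:
  fixes n :: int
  assumes "n > 0" "odd n"
    and one: "P 1"
    and mult: "\<And>p n. prime p \<Longrightarrow> p > 2 \<Longrightarrow> odd p \<Longrightarrow> n > 0 \<Longrightarrow> odd n \<Longrightarrow> P n \<Longrightarrow> P (p * n)"
  shows "P n"
  using assms(1,2)
proof (induction "nat n" arbitrary: n rule: less_induct)
  case less
  show ?case
  proof (cases "n = 1")
    case False
    then obtain p where p: "prime p" "p dvd n"
      using less.prems prime_divisor_exists[of n] by auto
    then obtain m where m: "n = p * m" by auto
    have "p > 0" using p prime_gt_0_int by blast
    have odd: "odd p" "odd m" using less.prems m by auto
    have "p \<noteq> 2" using odd by auto
    then have "p > 2" using p prime_ge_2_int[of p] by auto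
    moreover have "m > 0" using m less.prems \<open>p > 0\<close> by (simp add: zero_less_mult_iff)
    moreover have "m < n" using m \<open>m > 0\<close> \<open>p > 2\<close> by simp
    ultimately show ?thesis using mult[of p m] less.hyps[of m] m p odd by simp
  qed (use one in simp)
qed

lemma kronecker_1_right [simp]: "kronecker m 1 = 1"
  by (simp add: kronecker_def)

lemma kronecker_minus_1_right [simp]: "kronecker m (-1) = (if m < 0 then -1 else 1)"
  by (simp add: kronecker_def prime_factorization_unit)

lemma kronecker_mult_right:
  assumes "n1 \<noteq> 0" "n2 \<noteq> 0"
  shows "kronecker m (n1 * n2) = kronecker m n1 * kronecker m n2"
proof -
  have "prime_factorization (n1 * n2) = prime_factorization n1 + prime_factorization n2"
    using assms by (rule prime_factorization_mult)
  then show ?thesis using assms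
    by (auto simp: kronecker_def mult_less_0_iff)
qed

lemma kronecker_minus_right:
  assumes "n \<noteq> 0"
  shows "kronecker m (-n) = (if m < 0 then -1 else 1) * kronecker m n"
  using kronecker_mult_right[of "-1" n m] assms by simp

lemma kronecker_prime_right: "prime p \<Longrightarrow> kronecker m p = kronecker_prime m p"
  using prime_gt_0_int[of p] by (simp add: kronecker_def prime_factorization_prime)

lemma kronecker_odd_prime_right: "prime p \<Longrightarrow> odd p \<Longrightarrow> kronecker m p = Legendre m p"
  by (auto simp: kronecker_prime_right kronecker_prime_def)

lemma kronecker_2_right:
  "kronecker m 2 = (if even m then 0 else if m mod 8 = 1 \<or> m mod 8 = 7 then 1 else -1)"
proof (cases "even m")
  case False
  define q r where "q = m div 8" and "r = m mod 8"
  have m: "m = 8 * q + r" by (simp add: q_def r_def)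
  have "odd r" using False m by simp
  have "0 \<le> r" "r < 8" by (auto simp: r_def)
  then have r: "r = 1 \<or> r = 3 \<or> r = 5 \<or> r = 7" using \<open>odd r\<close> by presburger
  \<comment> \<open>The first summand is a multiple of 16, so the parity of the quotient by 8
    depends only on \<open>r\<close>.\<close>
  have m2: "m\<^sup>2 - 1 = 8 * (8 * q\<^sup>2 + 2 * q * r) + (r\<^sup>2 - 1)"
    by (simp add: m power2_eq_square algebra_simps)
  have nn: "(m\<^sup>2 - 1) div 8 \<ge> 0"
  proof -
    have "m \<noteq> 0" using False by auto
    then have "m\<^sup>2 > 0" by simp
    then have "m\<^sup>2 - 1 \<ge> 0" by linarith
    then show ?thesis by (simp add: pos_imp_zdiv_nonneg_iff)
  qed
  have "(m\<^sup>2 - 1) div 8 = 2 * (4 * q\<^sup>2 + q * r) + (r\<^sup>2 - 1) div 8"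
    unfolding m2 using r by auto
  then have "even (nat ((m\<^sup>2 - 1) div 8)) \<longleftrightarrow> even ((r\<^sup>2 - 1) div 8)"
    using nn by (simp add: even_nat_iff)
  also have "\<dots> \<longleftrightarrow> r = 1 \<or> r = 7" using r by auto
  finally show ?thesis using False unfolding r_def
    by (simp add: kronecker_prime_right kronecker_prime_def)
qed (simp add: kronecker_prime_right kronecker_prime_def)

section \<open>Legendre symbols: multiplicativity and reciprocity\<close>

lemma Legendre_values: "Legendre a p \<in> {-1, 0, 1}"
  by (simp add: Legendre_def)

lemma Legendre_cong: "[a = b] (mod p) \<Longrightarrow> Legendre a p = Legendre b p"
  unfolding Legendre_def QuadRes_def cong_def by simp

text \<open>Two numbers among -1, 0, 1 differ by at most 2 < p, so a congruence such as Euler's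
  criterion already determines the symbol.\<close>

lemma Legendre_eqI:
  assumes "p > 2" "[Legendre a p = x] (mod p)" "x \<in> {-1, 0, 1}"
  shows "Legendre a p = x"
proof (rule ccontr)
  assume ne: "Legendre a p \<noteq> x"
  have "p dvd Legendre a p - x" using assms(2) by (simp add: cong_iff_dvd_diff)
  then have "\<bar>p\<bar> \<le> \<bar>Legendre a p - x\<bar>" using ne by (intro dvd_imp_le_int) auto
  then show False using assms(1,3) Legendre_values[of a p] by auto
qed

lemma euler_criterion_int:
  fixes p :: int
  assumes "prime p" "p > 2"
  shows "[Legendre a p = a ^ ((nat p - 1) div 2)] (mod p)"
  using euler_criterion[of "nat p" a] assms by simp

lemma Legendre_mult:
  fixes p :: int
  assumes "prime p" "p > 2"
  shows "Legendre (a * b) p = Legendre a p * Legendre b p"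
proof (rule Legendre_eqI)
  show "[Legendre (a * b) p = Legendre a p * Legendre b p] (mod p)"
    using euler_criterion_int[OF assms, of "a * b"]
      cong_mult[OF euler_criterion_int[OF assms, of a] euler_criterion_int[OF assms, of b]]
    by (metis cong_sym cong_trans power_mult_distrib)
  show "Legendre a p * Legendre b p \<in> {- 1, 0, 1}"
    using Legendre_values[of a p] Legendre_values[of b p] by auto
qed (use assms in simp)

lemma Legendre_minus_1:
  fixes p :: int
  assumes "prime p" "p > 2"
  shows "Legendre (-1) p = (if p mod 4 = 3 then -1 else 1)"
proof (rule Legendre_eqI)
  have "odd p" using assms prime_odd_int by blast
  then obtain k where k: "p = 2 * k + 1" by (auto elim!: oddE)
  have "(nat p - 1) div 2 = nat k" "k > 0" using k assms by linarith+
  then have "even ((nat p - 1) div 2) \<longleftrightarrow> even k" by (simp add: even_nat_iff)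
  also have "\<dots> \<longleftrightarrow> p mod 4 \<noteq> 3" using k by presburger
  finally have "even ((nat p - 1) div 2) \<longleftrightarrow> p mod 4 \<noteq> 3" .
  then have "(-1::int) ^ ((nat p - 1) div 2) = (if p mod 4 = 3 then -1 else 1)" by simp
  then show "[Legendre (-1) p = (if p mod 4 = 3 then -1 else 1)] (mod p)"
    using euler_criterion_int[OF assms, of "-1"] by simp
qed (use assms in auto)

lemma Legendre_reciprocity:
  fixes p q :: int
  assumes "prime p" "p > 2" "prime q" "q > 2"
  shows "Legendre p q = Legendre q p * (if p mod 4 = 3 \<and> q mod 4 = 3 then -1 else 1)"
proof (cases "p = q")
  \<comment> \<open>Both sides vanish for p = q. Covering this case lets the inductions over prime
    factors run without coprimality assumptions.\<close>
  case True
  then show ?thesis by (simp add: Legendre_def cong_def)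
next
  case False
  have odd: "odd p" "odd q" using assms prime_odd_int by blast+
  have "even ((p - 1) div 2 * ((q - 1) div 2)) \<longleftrightarrow> \<not> (p mod 4 = 3 \<and> q mod 4 = 3)"
  proof -
    have "even ((p - 1) div 2) \<longleftrightarrow> p mod 4 \<noteq> 3" "even ((q - 1) div 2) \<longleftrightarrow> q mod 4 \<noteq> 3"
      using odd by presburger+
    then show ?thesis by auto
  qed
  moreover have "(p - 1) div 2 * ((q - 1) div 2) \<ge> 0" using assms by simp
  ultimately have "even (nat ((p - 1) div 2 * ((q - 1) div 2))) \<longleftrightarrow> \<not> (p mod 4 = 3 \<and> q mod 4 = 3)"
    by (simp add: even_nat_iff)
  then have R: "Legendre p q * Legendre q p = (if p mod 4 = 3 \<and> q mod 4 = 3 then -1 else 1)"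
    using Quadratic_Reciprocity_int[of p q] assms False by auto
  then show ?thesis
    using Legendre_values[of p q] Legendre_values[of q p] by (auto split: if_splits)
qed

section \<open>Kronecker symbols with odd lower entry: multiplicativity, period, reciprocity\<close>

lemma kronecker_mult_left:
  assumes "n > 0" "odd n"
  shows "kronecker (m1 * m2) n = kronecker m1 n * kronecker m2 n"
  using assms
proof (induction n rule: odd_pos_int_induct)
  case (mult p n)
  then show ?case by (simp add: kronecker_mult_right kronecker_odd_prime_right Legendre_mult)
qed auto

text \<open>Negative n require nonzero factors: since (0/-1) = 1, the choice m1 = 0, m2 = n = -1
  would violate the equation.\<close>

lemma kronecker_mult_left':
  assumes "odd n" "m1 \<noteq> 0" "m2 \<noteq> 0"
  shows "kronecker (m1 * m2) n = kronecker m1 n * kronecker m2 n"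
proof (cases "n > 0")
  case False
  then have n: "-n > 0" "n \<noteq> 0" "n = - (-n)" using assms by (cases "n = 0"; auto)+
  have "odd (-n)" using assms by simp
  have *: "kronecker m n = (if m < 0 then -1 else 1) * kronecker m (-n)" for m
    using kronecker_minus_right[of "-n" m] n by simp
  show ?thesis
    using kronecker_mult_left[OF n(1) \<open>odd (-n)\<close>, of m1 m2] assms
    unfolding *[of m1] *[of m2] *[of "m1 * m2"] by (auto simp: mult_less_0_iff)
qed (use assms kronecker_mult_left in auto)

lemma kronecker_cong_left:
  assumes "n > 0" "odd n" "[m1 = m2] (mod n)"
  shows "kronecker m1 n = kronecker m2 n"
  using assms
proof (induction n rule: odd_pos_int_induct)
  case (mult p n)
  then have "[m1 = m2] (mod p)" "[m1 = m2] (mod n)"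
    using cong_modulus_mult cong_dvd_modulus dvd_triv_right by blast+
  then show ?case using mult
    by (simp add: kronecker_mult_right kronecker_odd_prime_right Legendre_cong)
qed auto

lemma kronecker_1_left [simp]: "kronecker 1 n = 1"
proof (cases "n = 0")
  case False
  have "kronecker_prime 1 p = 1" if "prime p" for p
  proof -
    have "\<not> [1 = 0] (mod p)" using that by (auto simp: cong_iff_dvd_diff)
    moreover have "QuadRes p 1" unfolding QuadRes_def by (rule exI[of _ 1]) auto
    ultimately show ?thesis by (simp add: kronecker_prime_def Legendre_def)
  qed
  then have "(\<Prod>p\<in>#prime_factorization n. kronecker_prime 1 p) = (\<Prod>p\<in>#prime_factorization n. 1)"
    by (intro arg_cong[where f = prod_mset] image_mset_cong) auto
  then show ?thesis using False by (simp add: kronecker_def)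
qed (simp add: kronecker_def)

lemma kronecker_values:
  assumes "n \<noteq> 0" "coprime m n"
  shows "kronecker m n \<in> {1, -1}"
proof -
  have *: "kronecker_prime m p \<in> {1, -1}" if "p \<in> prime_factors n" for p
  proof -
    have p: "prime p" "p dvd n" using that by auto
    then have "\<not> p dvd m" using assms(2)
      by (metis coprime_common_divisor not_prime_unit)
    then show ?thesis using p
      by (auto simp: kronecker_prime_def Legendre_def cong_0_iff minus_one_power_iff)
  qed
  have "(\<Prod>p\<in>#M. kronecker_prime m p) \<in> {1, -1}" if "\<And>p. p \<in># M \<Longrightarrow> kronecker_prime m p \<in> {1, -1}" for M
    using that
  proof (induction M)
    case (add p M)
    then have "kronecker_prime m p \<in> {1, -1}" "(\<Prod>p\<in>#M. kronecker_prime m p) \<in> {1, -1}" by simp_all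
    then show ?case by auto
  qed auto
  then have "(\<Prod>p\<in>#prime_factorization n. kronecker_prime m p) \<in> {1, -1}" using * by blast
  then show ?thesis using assms(1) by (auto simp: kronecker_def)
qed

lemma odd_mod_8_cases:
  fixes n :: int
  assumes "odd n"
  obtains "n mod 8 = 1" "n mod 4 = 1" | "n mod 8 = 3" "n mod 4 = 3"
    | "n mod 8 = 5" "n mod 4 = 1" | "n mod 8 = 7" "n mod 4 = 3"
proof -
  have "n mod 8 = 1 \<or> n mod 8 = 3 \<or> n mod 8 = 5 \<or> n mod 8 = 7" using assms by presburger
  moreover have "n mod 4 = n mod 8 mod 4" by (simp add: mod_mod_cancel)
  ultimately show ?thesis using that by auto
qed

lemma kronecker_minus_1_left_pos:
  assumes "n > 0" "odd n"
  shows "kronecker (-1) n = (if n mod 4 = 3 then -1 else 1)"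
  using assms
proof (induction n rule: odd_pos_int_induct)
  case (mult p n)
  have "(p * n) mod 4 = ((p mod 4) * (n mod 4)) mod 4" by (simp add: mod_mult_eq)
  moreover have "p mod 4 = 1 \<or> p mod 4 = 3" "n mod 4 = 1 \<or> n mod 4 = 3"
    using mult.hyps(3,5) by presburger+
  ultimately show ?case using mult
    by (auto simp: kronecker_mult_right kronecker_odd_prime_right Legendre_minus_1)
qed auto

text \<open>Passing from n to -n exchanges the classes 1 and 3 mod 4, and the factor (-1/-1) = -1
  compensates, so the formula for positive n persists.\<close>

lemma kronecker_minus_1_left:
  assumes "odd n"
  shows "kronecker (-1) n = (if n mod 4 = 3 then -1 else 1)"
proof (cases "n > 0")
  case False
  then have n: "-n > 0" "odd (-n)" using assms by (cases "n = 0"; auto)+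
  have "kronecker (-1) n = - kronecker (-1) (-n)"
    using kronecker_minus_right[of "-n" "-1"] n by simp
  also have "\<dots> = (if n mod 4 = 3 then -1 else 1)"
  proof -
    have "(-n) mod 4 = 3 \<longleftrightarrow> n mod 4 \<noteq> 3" using assms by presburger
    then show ?thesis unfolding kronecker_minus_1_left_pos[OF n] by simp
  qed
  finally show ?thesis .
qed (use assms kronecker_minus_1_left_pos in auto)

lemma odd_mult_mod_4_eq_3_iff:
  fixes a b :: int
  assumes "odd a" "odd b"
  shows "(a * b) mod 4 = 3 \<longleftrightarrow> (a mod 4 = 3) \<noteq> (b mod 4 = 3)"
proof -
  have "(a * b) mod 4 = ((a mod 4) * (b mod 4)) mod 4" by (simp add: mod_mult_eq)
  moreover have "a mod 4 = 1 \<or> a mod 4 = 3" "b mod 4 = 1 \<or> b mod 4 = 3"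
    using assms by presburger+
  ultimately show ?thesis by auto
qed

lemma kronecker_reciprocity_prime:
  fixes p n :: int
  assumes "n > 0" "odd n" "prime p" "p > 2"
  shows "kronecker p n = kronecker n p * (if p mod 4 = 3 \<and> n mod 4 = 3 then -1 else 1)"
  using assms(1,2)
proof (induction n rule: odd_pos_int_induct)
  case one
  then show ?case by simp
next
  case (mult q n)
  have "odd p" using assms prime_odd_int by blast
  have "kronecker p (q * n) = kronecker p q * kronecker p n"
    using mult by (intro kronecker_mult_right) auto
  moreover have "kronecker (q * n) p = kronecker q p * kronecker n p"
    using assms \<open>odd p\<close> by (intro kronecker_mult_left) auto
  moreover have "kronecker p q = kronecker q p * (if p mod 4 = 3 \<and> q mod 4 = 3 then -1 else 1)"
    using Legendre_reciprocity[of p q] mult assms \<open>odd p\<close> by (simp add: kronecker_odd_prime_right)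
  ultimately show ?case using mult.IH odd_mult_mod_4_eq_3_iff[OF mult.hyps(3,5)] by auto
qed

lemma kronecker_reciprocity_pos:
  fixes m n :: int
  assumes "m > 0" "odd m" "n > 0" "odd n"
  shows "kronecker m n = kronecker n m * (if m mod 4 = 3 \<and> n mod 4 = 3 then -1 else 1)"
  using assms(1,2)
proof (induction m rule: odd_pos_int_induct)
  case one
  then show ?case by simp
next
  case (mult p m)
  have "kronecker n (p * m) = kronecker n p * kronecker n m"
    using mult by (intro kronecker_mult_right) auto
  moreover have "kronecker (p * m) n = kronecker p n * kronecker m n"
    using assms by (intro kronecker_mult_left) auto
  moreover have "kronecker p n = kronecker n p * (if p mod 4 = 3 \<and> n mod 4 = 3 then -1 else 1)"
    using mult assms by (intro kronecker_reciprocity_prime)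
  ultimately show ?case using mult.IH odd_mult_mod_4_eq_3_iff[OF mult.hyps(3,5)] by auto
qed

text \<open>Only one entry may be negative. For n < 0 the factor (-1/m) split off from (n/m)
  accounts for the changed class of n mod 4; with both entries negative a further sign appears, as m
  = n = -1 shows.\<close>

lemma kronecker_reciprocity:
  fixes m n :: int
  assumes "m > 0" "odd m" "odd n"
  shows "kronecker m n = kronecker n m * (if m mod 4 = 3 \<and> n mod 4 = 3 then -1 else 1)"
proof (cases "n > 0")
  case False
  then have n: "-n > 0" "odd (-n)" using assms by (cases "n = 0"; auto)+
  have "kronecker m n = kronecker m (-n)"
    using assms kronecker_minus_right[of "-n" m] n by auto
  also have "\<dots> = kronecker (-n) m * (if m mod 4 = 3 \<and> (-n) mod 4 = 3 then -1 else 1)"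
    using assms n by (intro kronecker_reciprocity_pos)
  also have "kronecker (-n) m = kronecker n m * (if m mod 4 = 3 then -1 else 1)"
    using kronecker_mult_left[of m "-1" n] kronecker_minus_1_left_pos[of m] assms by simp
  also have "(-n) mod 4 = 3 \<longleftrightarrow> n mod 4 \<noteq> 3" using assms by presburger
  finally show ?thesis by auto
next
  case True
  then show ?thesis using assms by (intro kronecker_reciprocity_pos)
qed

text \<open>Since one of \<open>n\<close>, \<open>n - 2\<close> is \<open>1\<close> modulo \<open>4\<close>, reciprocity gives
  \<open>(2/n) = (-1/n) ((n - 2)/n) = (-1/n) (n/(n - 2)) = (-1/n) (2/(n - 2))\<close>.\<close>
lemma kronecker_2_left_pos:
  assumes "n > 0" "odd n"
  shows "kronecker 2 n = (if n mod 8 = 1 \<or> n mod 8 = 7 then 1 else -1)"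
  using assms
proof (induction "nat n" arbitrary: n rule: less_induct)
  case less
  show ?case
  proof (cases "n = 1")
    case False
    then have n: "n - 2 > 0" "odd (n - 2)" using less.prems by (auto elim!: oddE)
    have "kronecker (n - 2) n = kronecker (-2) n"
      using less.prems by (intro kronecker_cong_left) (auto simp: cong_iff_dvd_diff)
    also have "\<dots> = kronecker (-1) n * kronecker 2 n"
      using kronecker_mult_left[of n "-1" 2] less.prems by simp
    finally have A: "kronecker (n - 2) n = kronecker (-1) n * kronecker 2 n" .
    have "\<not> ((n - 2) mod 4 = 3 \<and> n mod 4 = 3)" by presburger
    then have B: "kronecker (n - 2) n = kronecker n (n - 2)"
      using kronecker_reciprocity[OF n less.prems(2)] by auto
    have C: "kronecker n (n - 2) = kronecker 2 (n - 2)"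
      using n by (intro kronecker_cong_left) (auto simp: cong_iff_dvd_diff)
    have "kronecker 2 (n - 2) = (if (n - 2) mod 8 = 1 \<or> (n - 2) mod 8 = 7 then 1 else -1)"
      using less n by auto
    moreover have "kronecker (-1) n = (if n mod 4 = 3 then -1 else 1)"
      using less.prems by (intro kronecker_minus_1_left)
    ultimately have "(if n mod 4 = 3 then -1 else 1) * kronecker 2 n
        = (if (n - 2) mod 8 = 1 \<or> (n - 2) mod 8 = 7 then 1 else -1)"
      using A B C by simp
    then have K: "kronecker 2 n
        = (if n mod 4 = 3 then -1 else 1) * (if (n - 2) mod 8 = 1 \<or> (n - 2) mod 8 = 7 then 1 else -1)"
      by (auto split: if_splits)
    have "(n - 2) mod 8 = (n mod 8 - 2) mod 8" by (simp add: mod_diff_left_eq)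
    then show ?thesis unfolding K by - (rule odd_mod_8_cases[OF less.prems(2)], simp_all)
  qed auto
qed

lemma kronecker_2_left:
  assumes "odd n"
  shows "kronecker 2 n = (if n mod 8 = 1 \<or> n mod 8 = 7 then 1 else -1)"
proof (cases "n > 0")
  case False
  then have n: "-n > 0" "odd (-n)" using assms by (cases "n = 0"; auto)+
  have "kronecker 2 n = kronecker 2 (-n)"
    using kronecker_minus_right[of "-n" 2] n by simp
  moreover have "(-n) mod 8 = (- (n mod 8)) mod 8" by (simp add: mod_minus_eq)
  ultimately show ?thesis unfolding kronecker_2_left_pos[OF n]
    by - (rule odd_mod_8_cases[OF assms], simp_all)
qed (use assms kronecker_2_left_pos in auto)

lemma kronecker_power_left:
  assumes "odd n" "m \<noteq> 0"
  shows "kronecker (m ^ e) n = kronecker m n ^ e"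
  using assms by (induction e) (auto simp: kronecker_mult_left')

section \<open>The symbol under the two moves of the lower row\<close>

lemma kronecker_left_decomp:
  fixes c :: int
  assumes "c \<noteq> 0"
  obtains s e u where "c = s * 2 ^ e * u" "s = 1 \<or> s = -1" "u > 0" "odd u"
proof -
  obtain e v where v: "c = 2 ^ e * v" "odd v"
  proof -
    assume *: "\<And>e v. c = 2 ^ e * v \<Longrightarrow> odd v \<Longrightarrow> thesis"
    show thesis
      by (rule multiplicity_decompose'[of c 2]) (use assms * in auto)
  qed
  have "v \<noteq> 0" using v by auto
  show ?thesis
    by (rule that[of "sgn v" e "\<bar>v\<bar>"]) (use v \<open>v \<noteq> 0\<close> in \<open>auto simp: sgn_if\<close>)
qed

text \<open>The odd part u of c divides 2c, so reciprocity moves its symbol from d to d + 2c up to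
  residues mod 4. The sign and the power of 2 in c contribute factors that depend on the lower entry
  mod 8 only.\<close>

lemma kronecker_shift_right:
  assumes "odd d"
  shows "kronecker c (d + 2 * c) = kronecker c d * (if c mod 4 = 2 \<or> c mod 4 = 3 then -1 else 1)"
proof (cases "c = 0")
  case False
  then obtain s e u where c: "c = s * 2 ^ e * u" "s = 1 \<or> s = -1" "u > 0" "odd u"
    by (rule kronecker_left_decomp)
  define n where "n = d + 2 * c"
  have odd: "odd n" using assms by (simp add: n_def)
  have split: "kronecker c k = kronecker s k * kronecker 2 k ^ e * kronecker u k" if "odd k" for k
  proof -
    have "s \<noteq> 0" "u \<noteq> 0" using c by auto
    then show ?thesis unfolding c(1)
      using that by (simp only: kronecker_mult_left' kronecker_power_left mult_eq_0_iff power_eq_0_iff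
        numeral_neq_zero de_Morgan_disj not_False_eq_True simp_thms)
  qed
  have "kronecker n u = kronecker d u"
    using c by (intro kronecker_cong_left) (auto simp: cong_iff_dvd_diff n_def)
  \<comment> \<open>The common value (d/u) = (n/u) is eliminated, which leaves a relation between
    the two symbols with upper entry u.\<close>
  then have U: "kronecker u n * (if u mod 4 = 3 \<and> n mod 4 = 3 then -1 else 1)
    = kronecker u d * (if u mod 4 = 3 \<and> d mod 4 = 3 then -1 else 1)"
    using kronecker_reciprocity[OF c(3,4) odd] kronecker_reciprocity[OF c(3,4) assms] by auto
  have S: "kronecker s k = (if s = -1 \<and> k mod 4 = 3 then -1 else 1)" if "odd k" for k
    using c(2) that kronecker_minus_1_left[of k] by auto
  \<comment> \<open>In these cases 2c is 2 mod 4, 4 mod 8 and 0 mod 8. Hence n differs from d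
    already mod 4, only mod 8, or not at all mod 8.\<close>
  consider "e = 0" | "e = 1" | "e \<ge> 2" by linarith
  then show ?thesis
  proof cases
    case 1
    have cu: "c = u \<and> s = 1 \<or> c = -u \<and> s = -1" using c(1,2) 1 by auto
    then have "odd c" using c(4) by auto
    then have n: "n mod 4 = 3 \<longleftrightarrow> d mod 4 \<noteq> 3" unfolding n_def using assms by presburger
    have "c mod 4 = 3 \<longleftrightarrow> (s = -1) \<noteq> (u mod 4 = 3)"
    proof (cases "s = 1")
      case False
      then have "c = -u" "s = -1" using cu by auto
      moreover have "(-u) mod 4 = 3 \<longleftrightarrow> u mod 4 \<noteq> 3" using c(4) by presburger
      ultimately show ?thesis by simp
    qed (use cu in auto)
    moreover have "c mod 4 \<noteq> 2" using \<open>odd c\<close> by presburger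
    ultimately show ?thesis using U n
      unfolding n_def[symmetric] split[OF odd] split[OF assms] S[OF odd] S[OF assms] 1
      by (cases "s = -1"; cases "u mod 4 = 3"; cases "d mod 4 = 3") simp_all
  next
    case 2
    have "c = 2 * u \<or> c = -(2 * u)" using c(1,2) 2 by auto
    moreover obtain k where "u = 2 * k + 1" using c(4) by (auto elim!: oddE)
    ultimately have "c = 2 + 4 * k \<or> c = 2 + 4 * (-k - 1)" by auto
    then obtain j where j: "c = 2 + 4 * j" by blast
    have c2: "c mod 4 = 2" unfolding j by simp
    have "n = d + 4 + 8 * j" by (simp add: n_def j)
    then have n: "n mod 8 = (d + 4) mod 8" by simp
    have "n = d + 4 * (1 + 2 * j)" by (simp add: n_def j)
    then have n4: "n mod 4 = d mod 4" by (simp only: mod_mult_self2)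
    have d4: "(d + 4) mod 8 = (d mod 8 + 4) mod 8" by (simp add: mod_add_left_eq)
    have "kronecker 2 n = - kronecker 2 d"
      unfolding kronecker_2_left[OF odd] kronecker_2_left[OF assms] n d4
      by (rule odd_mod_8_cases[OF assms]) simp_all
    with n4 show ?thesis using U c2
      unfolding n_def[symmetric] split[OF odd] split[OF assms] S[OF odd] S[OF assms] 2
      by (cases "s = -1"; cases "u mod 4 = 3"; cases "d mod 4 = 3") simp_all
  next
    case 3
    then obtain k where "e = k + 2" by (metis add.commute le_Suc_ex)
    then have "4 dvd c" using c(1) by (simp add: power_add)
    then obtain j where j: "c = 4 * j" by blast
    have c4: "c mod 4 = 0" unfolding j by simp
    have "n = d + 8 * j" by (simp add: n_def j)
    then have n: "n mod 8 = d mod 8" by simp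
    have "n = d + 4 * (2 * j)" by (simp add: n_def j)
    then have "n mod 4 = d mod 4" by (simp only: mod_mult_self2)
    moreover have "kronecker 2 n = kronecker 2 d"
      unfolding kronecker_2_left[OF odd] kronecker_2_left[OF assms] n ..
    ultimately show ?thesis using U c4
      unfolding n_def[symmetric] split[OF odd] split[OF assms] S[OF odd] S[OF assms]
      by (cases "s = -1"; cases "u mod 4 = 3"; cases "d mod 4 = 3") simp_all
  qed
qed auto

text \<open>Periodicity in the upper entry holds for -d in place of d when d < 0. The sign records
  that the factor (m/-1) sees only whether m is negative.\<close>

lemma kronecker_shift_left:
  assumes "odd d"
  shows "kronecker (c + d) d = kronecker c d * (if d < 0 \<and> (c < 0) \<noteq> (c + d < 0) then -1 else 1)"
proof (cases "d > 0")
  case True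
  then have "kronecker (c + d) d = kronecker c d"
    using assms by (intro kronecker_cong_left) (auto simp: cong_iff_dvd_diff)
  then show ?thesis using True by simp
next
  case False
  then have n: "-d > 0" "odd (-d)" using assms by (cases "d = 0"; auto)+
  have "kronecker (c + d) (-d) = kronecker c (-d)"
    using n by (intro kronecker_cong_left) (auto simp: cong_iff_dvd_diff)
  moreover have *: "kronecker m d = (if m < 0 then -1 else 1) * kronecker m (-d)" for m
    using kronecker_minus_right[of "-d" m] n by simp
  ultimately show ?thesis using n unfolding *[of c] *[of "c + d"] by auto
qed

section \<open>The symbol as a character of its lower entry\<close>

lemma kronecker_power_right:
  assumes "n \<noteq> 0"
  shows "kronecker m (n ^ e) = kronecker m n ^ e"
  using assms by (induction e) (auto simp: kronecker_mult_right)

text \<open>For q = 1 mod 4 the sign in reciprocity disappears, and the factors -1 and 2 of d are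
  symmetric as well: (q/-1) = (-1/q) and (q/2) = (2/q). This is what extends the period q of (q/d)
  to even and negative d.\<close>

lemma kronecker_symmetric:
  fixes q d :: int
  assumes q: "q > 0" "q mod 4 = 1" and d: "d \<noteq> 0"
  shows "kronecker q d = kronecker d q"
proof -
  obtain s e u where d: "d = s * 2 ^ e * u" and s: "s = 1 \<or> s = -1" and u: "u > 0" "odd u"
    using kronecker_left_decomp[OF d] by blast
  have odd: "odd q" using q by presburger
  have "s \<noteq> 0" "u \<noteq> 0" using s u by auto
  then have "kronecker q d = kronecker q s * kronecker q 2 ^ e * kronecker q u"
    "kronecker d q = kronecker s q * kronecker 2 q ^ e * kronecker u q"
    using odd by (simp_all add: d kronecker_mult_right kronecker_power_right kronecker_mult_left' kronecker_power_left)
  moreover have "kronecker q s = 1" using s q by auto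
  moreover have "kronecker s q = 1" using s q kronecker_minus_1_left[OF odd] by auto
  moreover have "kronecker q 2 = kronecker 2 q" using odd by (simp add: kronecker_2_right kronecker_2_left)
  moreover have "kronecker q u = kronecker u q"
    using kronecker_reciprocity[OF u odd] q by auto
  ultimately show ?thesis by simp
qed

text \<open>The factor 8 in the modulus removes the sign of reciprocity and makes 2 a trivial
  factor; modulo the odd part of t, d is just 1.\<close>

lemma kronecker_eq_1_of_cong:
  fixes t d :: int
  assumes t: "t > 0" and d: "d > 0" "[d = 1] (mod 8 * t)"
  shows "kronecker t d = 1"
proof -
  have "8 dvd d - 1" using d(2) by (metis cong_iff_dvd_diff dvd_mult_left)
  then have d8: "d mod 8 = 1" by presburger
  then have d4: "d mod 4 = 1" "odd d" by presburger+
  have *: "kronecker t d = kronecker d t" using kronecker_symmetric[OF d(1) d4(1)] t by simp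
  obtain s e u where se: "t = s * 2 ^ e * u" and s: "s = 1 \<or> s = -1" and u: "u > 0" "odd u"
    using kronecker_left_decomp[of t] t by blast
  have "s = 1" using s se t u by (auto simp: zero_less_mult_iff)
  then have tt: "t = 2 ^ e * u" using se by simp
  have "[d = 1] (mod u)"
    using d(2) by (rule cong_dvd_modulus) (simp add: tt)
  then have "kronecker d u = 1" using kronecker_cong_left[OF u] by simp
  moreover have "kronecker d 2 = 1" using d8 d4 by (simp add: kronecker_2_right)
  ultimately have "kronecker d t = 1" unfolding tt using u
    by (simp add: kronecker_mult_right kronecker_power_right)
  then show ?thesis using * by simp
qed

text \<open>Squaring on the nonzero residues identifies 1 and p - 1, so it is not injective, hence
  on a finite set not surjective.\<close>

lemma ex_nonresidue:
  fixes p :: int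
  assumes p: "prime p" "p > 2"
  obtains g where "Legendre g p = -1"
proof -
  let ?S = "{1..p - 1}"
  define f where "f = (\<lambda>x::int. x\<^sup>2 mod p)"
  have sub: "f ` ?S \<subseteq> ?S"
  proof
    fix y assume "y \<in> f ` ?S"
    then obtain x where x: "x \<in> ?S" "y = x\<^sup>2 mod p" by (auto simp: f_def)
    have "\<not> p dvd x" using x zdvd_not_zless[of x p] by auto
    then have "\<not> p dvd x\<^sup>2" using p prime_dvd_power by blast
    then have "y \<noteq> 0" using x by auto
    moreover have "0 \<le> y" "y < p" using x p by auto
    ultimately show "y \<in> ?S" by auto
  qed
  have "f 1 = f (p - 1)"
  proof -
    have "(p - 1)\<^sup>2 = 1 + p * (p - 2)" by (simp add: power2_eq_square algebra_simps)
    then show ?thesis by (simp add: f_def)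
  qed
  moreover have "1 \<in> ?S" "p - 1 \<in> ?S" "1 \<noteq> p - 1" using p by auto
  ultimately have "\<not> inj_on f ?S" unfolding inj_on_def by blast
  then have "f ` ?S \<noteq> ?S" using finite_surj_inj[of ?S f] eq_card_imp_inj_on[of ?S f] by auto
  then obtain g where g: "g \<in> ?S" "g \<notin> f ` ?S" using sub by blast
  have "\<not> QuadRes p g"
  proof
    assume "QuadRes p g"
    then obtain y where y: "[y\<^sup>2 = g] (mod p)" by (auto simp: QuadRes_def)
    have gm: "g mod p = g" using g by auto
    then have y2: "y\<^sup>2 mod p = g" using y by (simp add: cong_def)
    then have fg: "f (y mod p) = g" by (simp add: f_def power_mod)
    have "y mod p \<noteq> 0"
    proof
      assume "y mod p = 0"
      then have "p dvd y\<^sup>2" by (simp add: power2_eq_square mod_eq_0_iff_dvd)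
      then show False using y2 g by auto
    qed
    moreover have "0 \<le> y mod p" "y mod p < p" using p by simp_all
    ultimately have "y mod p \<in> ?S" by simp
    then show False using g fg by blast
  qed
  moreover have "\<not> [g = 0] (mod p)" using g by (auto simp: cong_0_iff zdvd_not_zless)
  ultimately have "Legendre g p = -1" by (simp add: Legendre_def)
  then show ?thesis by (rule that)
qed

lemma ex_pos_crt:
  fixes m1 m2 a1 a2 :: int
  assumes "coprime m1 m2" "m1 > 0" "m2 > 0"
  obtains d where "d > 0" "[d = a1] (mod m1)" "[d = a2] (mod m2)"
proof -
  obtain x where x: "[x = a1] (mod m1)" "[x = a2] (mod m2)"
    using binary_chinese_remainder_int[OF assms(1)] by blast
  \<comment> \<open>Adding the full modulus to the residue makes the solution strictly
    positive.\<close>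
  define d where "d = x mod (m1 * m2) + m1 * m2"
  have "m1 * m2 > 0" using assms by simp
  then have "d > 0" using pos_mod_sign[of "m1 * m2" x] unfolding d_def by linarith
  moreover have "[d = x] (mod m1 * m2)" by (simp add: d_def cong_def)
  then have "[d = x] (mod m1)" "[d = x] (mod m2)"
    using cong_modulus_mult cong_dvd_modulus dvd_triv_right by blast+
  ultimately show ?thesis using x that cong_trans by blast
qed

text \<open>A non-square q has a prime p of odd exponent k, say q = p^k t with p not dividing t. A d
  with (p/d) = -1 and (t/d) = 1 gives (q/d) = -1. Such a d is built by congruences, and it is made
  prime to M by treating the p-part and the p-free part M' of M separately.\<close>

lemma square_if_kronecker_eq_1:
  fixes q M :: int
  assumes q: "q > 0" and M: "M > 0"
    and K: "\<And>d. odd d \<Longrightarrow> coprime M d \<Longrightarrow> kronecker q d = 1"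
  shows "\<exists>m. q = m\<^sup>2"
proof (rule ccontr)
  assume nsq: "\<not> (\<exists>m. q = m\<^sup>2)"
  have "\<not> is_nth_power 2 (nat q)"
  proof
    assume "is_nth_power 2 (nat q)"
    then obtain m where "nat q = m ^ 2" by (auto elim!: is_nth_powerE)
    then have "q = (int m)\<^sup>2" using q by (metis int_nat_eq less_imp_le of_nat_power)
    then show False using nsq by blast
  qed
  then obtain p' where p': "prime p'" "odd (multiplicity p' (nat q))"
    using q is_nth_power_conv_multiplicity_nat[of 2 "nat q"] by auto
  define p where "p = int p'"
  have p: "prime p" using p' by (simp add: p_def)
  obtain k t' where kt': "nat q = p' ^ k * t'" "\<not> p' dvd t'" "odd k"
    using multiplicity_decompose'[of "nat q" p'] q p' by (metis nat_0_iff not_le not_prime_unit)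
  define t where "t = int t'"
  have qt: "q = p ^ k * t" using kt'(1) q unfolding p_def t_def
    by (metis int_nat_eq less_imp_le of_nat_mult of_nat_power)
  have pt: "\<not> p dvd t" using kt'(2) by (simp add: p_def t_def)
  have "p > 0" using p prime_gt_0_int by blast
  have t: "t > 0" using qt q \<open>p > 0\<close> by (simp add: zero_less_mult_iff)
  obtain i M' where M': "M = p ^ i * M'" "\<not> p dvd M'"
    using multiplicity_decompose'[of M p] M p by (metis less_irrefl not_prime_unit)
  have M'0: "M' > 0" using M' M \<open>p > 0\<close> by (simp add: zero_less_mult_iff)
  have split: "kronecker q d = kronecker p d ^ k * kronecker t d" if "odd d" for d
    using that t \<open>p > 0\<close> by (simp add: qt kronecker_mult_left' kronecker_power_left)
  have "\<exists>d > 0. odd d \<and> coprime p d \<and> [d = 1] (mod M') \<and> kronecker p d = -1 \<and> kronecker t d = 1"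
  proof (cases "p = 2")
    case False
    then have p2: "p > 2" using p prime_ge_2_int[of p] by auto
    have oddp: "odd p" using p p2 prime_odd_int by blast
    obtain g where g: "Legendre g p = -1" using ex_nonresidue[OF p p2] by blast
    have "\<not> p dvd 8 * (t * M')"
    proof
      assume "p dvd 8 * (t * M')"
      then have "p dvd 2 ^ 3 \<or> p dvd t \<or> p dvd M'" using p by (simp add: prime_dvd_mult_iff)
      then have "p dvd 2" using pt M' p prime_dvd_power by blast
      then show False using p2 zdvd_imp_le[of p 2] by auto
    qed
    then have cop: "coprime (8 * (t * M')) p"
      using p by (metis coprime_commute prime_imp_coprime)
    \<comment> \<open>Modulo 8t the number d is trivial for t and for the sign of reciprocity, so
      that (p/d) = (d/p) can be chosen freely.\<close>
    obtain d where d: "d > 0" "[d = 1] (mod 8 * (t * M'))" "[d = g] (mod p)"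
      using ex_pos_crt[OF cop, of 1 g] t M'0 \<open>p > 0\<close> by auto
    have "[d = 1] (mod 8)" using d(2) by (rule cong_dvd_modulus) simp
    then have "d mod 8 = 1" by (simp add: cong_def)
    then have d4: "odd d" "d mod 4 = 1" by presburger+
    have "[d = 1] (mod 8 * t)" using d(2) by (rule cong_dvd_modulus) (simp add: mult_dvd_mono)
    then have kt: "kronecker t d = 1" using kronecker_eq_1_of_cong[OF t d(1)] by blast
    have "kronecker p d = kronecker d p"
      using kronecker_reciprocity[OF \<open>p > 0\<close> oddp d4(1)] d4 by simp
    also have "\<dots> = Legendre g p"
      using kronecker_odd_prime_right[OF p oddp] Legendre_cong[OF d(3)] by simp
    finally have kp: "kronecker p d = -1" using g by simp
    have "\<not> p dvd d"
    proof
      assume "p dvd d"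
      then have "[g = 0] (mod p)" using d(3) by (metis cong_0_iff cong_sym cong_trans)
      then show False using g by (simp add: Legendre_def)
    qed
    then have "coprime p d" using p prime_imp_coprime by blast
    moreover have "[d = 1] (mod M')" using d(2) by (rule cong_dvd_modulus) simp
    ultimately show ?thesis using d d4 kp kt by blast
  next
    case True
    then have oddtM: "odd (t * M')" using pt M' by simp
    then have cop: "coprime 8 (t * M')" using coprime_power_left_iff[of 2 3 "t * M'"] by simp
    \<comment> \<open>The class 5 mod 8 is 1 mod 4, so (t/d) = (d/t), yet 2 has symbol -1
      there.\<close>
    obtain d where d: "d > 0" "[d = 5] (mod 8)" "[d = 1] (mod t * M')"
      using ex_pos_crt[OF cop, of 5 1] t M'0 by auto
    have d8: "d mod 8 = 5" using d(2) by (simp add: cong_def)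
    then have d4: "odd d" "d mod 4 = 1" by presburger+
    have "[d = 1] (mod t)" using d(3) by (rule cong_dvd_modulus) simp
    moreover have "odd t" using oddtM by simp
    ultimately have "kronecker d t = 1" using kronecker_cong_left[OF t, of d 1] by simp
    then have kt: "kronecker t d = 1" using kronecker_symmetric[OF d(1) d4(2)] t by simp
    have kp: "kronecker p d = -1" using True d8 d4 by (simp add: kronecker_2_left)
    have "coprime p d" using True d4 by simp
    moreover have "[d = 1] (mod M')" using d(3) by (rule cong_dvd_modulus) simp
    ultimately show ?thesis using d d4 kp kt by blast
  qed
  then obtain d where d: "d > 0" "odd d" "coprime p d" "[d = 1] (mod M')" "kronecker p d = -1" "kronecker t d = 1"
    by blast
  have "coprime M' d" using d(4) by (metis cong_imp_coprime cong_sym coprime_1_left coprime_commute)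
  then have "coprime M d" using d(3) by (simp add: M'(1))
  then have "kronecker q d = 1" using K d(2) by blast
  moreover have "kronecker q d = -1" using split[OF d(2)] d kt'(3) by simp
  ultimately show False by simp
qed

lemma kronecker_square_left:
  fixes m d :: int
  assumes "odd d" "m \<noteq> 0" "coprime m d"
  shows "kronecker (m\<^sup>2) d = 1"
proof -
  have "d \<noteq> 0" using assms by auto
  then have "kronecker m d \<in> {1, -1}" using assms by (intro kronecker_values)
  then show ?thesis using assms by (auto simp: kronecker_power_left)
qed

text \<open>For odd \<open>M\<close> the values at odd \<open>d\<close> already force \<open>q \<equiv> 1 (mod 4)\<close>, since otherwise reciprocity
  gives \<open>(q/d) = -1\<close> at \<open>d = 1 + 2Mq\<close>; then \<open>d \<mapsto> (q/d)\<close> has period \<open>q\<close> and even \<open>d\<close> reduce to odd ones.\<close>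
lemma kronecker_character_odd_iff:
  fixes \<psi> :: "int \<Rightarrow> complex" and q M N :: int
  assumes q: "q > 0" and M: "M > 0" and N: "N dvd M"
    and q_odd: "odd M \<Longrightarrow> odd q"
    and per: "\<And>a k. \<psi> (a + N * k) = \<psi> a" and one: "\<psi> 1 = 1"
  shows "(\<forall>d. odd d \<longrightarrow> coprime M d \<longrightarrow> \<psi> d = of_int (kronecker q d)) \<longleftrightarrow>
    ((odd M \<longrightarrow> [q = 1] (mod 4)) \<and> (\<forall>d. d \<noteq> 0 \<longrightarrow> coprime M d \<longrightarrow> \<psi> d = of_int (kronecker q d)))"
proof (intro iffI conjI impI allI)
  assume Q: "\<forall>d. odd d \<longrightarrow> coprime M d \<longrightarrow> \<psi> d = of_int (kronecker q d)"
  have q1: "q mod 4 = 1" if oM: "odd M"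
  proof (rule ccontr)
    assume "q mod 4 \<noteq> 1"
    moreover have oq: "odd q" using q_odd oM .
    ultimately have q3: "q mod 4 = 3" by presburger
    define d where "d = 1 + 2 * (M * q)"
    have "odd (M * q)" using oM oq by simp
    then obtain k where "M * q = 2 * k + 1" by (rule oddE)
    then have "d = 3 + 4 * k" by (simp add: d_def)
    then have d3: "d mod 4 = 3" "odd d" by simp_all
    have "coprime M d"
    proof -
      have "[d = 1] (mod M)" by (simp add: d_def cong_iff_dvd_diff)
      then show ?thesis by (metis cong_imp_coprime cong_sym coprime_1_left coprime_commute)
    qed
    then have "\<psi> d = of_int (kronecker q d)" using Q d3 by blast
    moreover have "\<psi> d = 1"
    proof -
      obtain w where "M = N * w" using N by auto
      then have "d = 1 + N * (2 * (w * q))" by (simp add: d_def)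
      then show ?thesis using per[of 1] one by simp
    qed
    moreover have "kronecker q d = -1"
    proof -
      have "kronecker d q = kronecker 1 q"
        by (rule kronecker_cong_left[OF q oq]) (simp add: d_def cong_iff_dvd_diff)
      then show ?thesis using kronecker_reciprocity[OF q oq d3(2)] q3 d3 by simp
    qed
    ultimately show False by simp
  qed
  show "[q = 1] (mod 4)" if "odd M" using q1[OF that] by (simp add: cong_def)
  fix d :: int assume d: "d \<noteq> 0" "coprime M d"
  show "\<psi> d = of_int (kronecker q d)"
  proof (cases "odd d")
    case False
    then have oM: "odd M" using d(2) by (meson coprime_common_divisor not_is_unit_0 odd_one dvd_refl)
    have oq: "odd q" using q_odd oM .
    \<comment> \<open>The odd shift M q keeps \<psi> unchanged because N divides M, and keeps the
      class mod q, which is all that (q/d) sees.\<close>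
    define d' where "d' = d + M * q"
    have od': "odd d'" using False oM oq by (simp add: d'_def)
    have "[d' = d] (mod M)" by (simp add: d'_def cong_iff_dvd_diff)
    then have "coprime M d'" using d(2) by (metis cong_imp_coprime cong_sym coprime_commute)
    then have "\<psi> d' = of_int (kronecker q d')" using Q od' by blast
    moreover have "\<psi> d' = \<psi> d"
    proof -
      obtain w where "M = N * w" using N by auto
      then have "d' = d + N * (w * q)" by (simp add: d'_def)
      then show ?thesis using per by simp
    qed
    moreover have "kronecker q d' = kronecker q d"
    proof -
      have "d' \<noteq> 0" using od' by auto
      then have "kronecker q d' = kronecker d' q" using kronecker_symmetric[OF q q1[OF oM]] by blast
      also have "\<dots> = kronecker d q"
        by (rule kronecker_cong_left[OF q oq]) (simp add: d'_def cong_iff_dvd_diff)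
      also have "\<dots> = kronecker q d" using kronecker_symmetric[OF q q1[OF oM] d(1)] by simp
      finally show ?thesis .
    qed
    ultimately show ?thesis by simp
  qed (use Q d in blast)
next
  fix d :: int assume "odd d" "coprime M d"
    "(odd M \<longrightarrow> [q = 1] (mod 4)) \<and> (\<forall>d. d \<noteq> 0 \<longrightarrow> coprime M d \<longrightarrow> \<psi> d = of_int (kronecker q d))"
  then show "\<psi> d = of_int (kronecker q d)" by (metis dvd_0_right)
qed

section \<open>The inversion formula for the eta function\<close>

text \<open>A majorant of product form makes the family absolutely summable over pairs. The iterated
  series are converted to unordered sums, where the order of summation is immaterial.\<close>

lemma suminf_swap:
  fixes D :: "nat \<Rightarrow> nat \<Rightarrow> complex"
  assumes le: "\<And>m n. norm (D m n) \<le> f m * g n"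
    and f: "summable f" "\<And>m. f m \<ge> 0" and g: "summable g" "\<And>n. g n \<ge> 0"
  shows "summable (\<lambda>m. \<Sum>n. D m n)" "summable (\<lambda>n. \<Sum>m. D m n)"
    "(\<Sum>m. \<Sum>n. D m n) = (\<Sum>n. \<Sum>m. D m n)"
proof -
  have row: "summable (\<lambda>n. norm (D m n))" for m
    by (rule summable_comparison_test'[of "\<lambda>n. f m * g n" 0]) (use le summable_mult g in auto)
  have col: "summable (\<lambda>m. norm (D m n))" for n
    by (rule summable_comparison_test'[of "\<lambda>m. f m * g n" 0]) (use le summable_mult2 f in auto)
  have rown: "norm (\<Sum>n. D m n) \<le> f m * suminf g" for m
  proof -
    have "norm (\<Sum>n. D m n) \<le> (\<Sum>n. norm (D m n))" using row by (rule summable_norm)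
    also have "\<dots> \<le> (\<Sum>n. f m * g n)" using row le summable_mult g by (intro suminf_le) auto
    also have "\<dots> = f m * suminf g" using g by (simp add: suminf_mult)
    finally show ?thesis .
  qed
  have coln: "norm (\<Sum>m. D m n) \<le> suminf f * g n" for n
  proof -
    have "norm (\<Sum>m. D m n) \<le> (\<Sum>m. norm (D m n))" using col by (rule summable_norm)
    also have "\<dots> \<le> (\<Sum>m. f m * g n)" using col le summable_mult2 f by (intro suminf_le) auto
    also have "\<dots> = suminf f * g n" using f by (simp add: suminf_mult2)
    finally show ?thesis .
  qed
  have Srow: "summable (\<lambda>m. norm (\<Sum>n. D m n))"
    by (rule summable_comparison_test'[of "\<lambda>m. f m * suminf g" 0]) (use rown summable_mult2 f in auto)
  have Scol: "summable (\<lambda>n. norm (\<Sum>m. D m n))"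
    by (rule summable_comparison_test'[of "\<lambda>n. suminf f * g n" 0]) (use coln summable_mult g in auto)
  show "summable (\<lambda>m. \<Sum>n. D m n)" "summable (\<lambda>n. \<Sum>m. D m n)"
    by (rule summable_norm_cancel, fact Srow) (rule summable_norm_cancel, fact Scol)
  have conv: "suminf h = infsum h UNIV" if "summable (\<lambda>n. norm (h n))" for h :: "nat \<Rightarrow> complex"
    by (rule infsumI[symmetric], rule norm_summable_imp_has_sum[OF that])
       (use that in \<open>simp add: summable_norm_cancel summable_sums\<close>)
  have fs: "f summable_on UNIV" and gs: "g summable_on UNIV"
    using f g by (auto intro!: norm_summable_imp_summable_on)
  have "(\<lambda>p. norm (f (fst p) * g (snd p))) summable_on (UNIV \<times> UNIV)"
  proof (rule Infinite_Sum.abs_summable_on_Sigma_iff[THEN iffD2], intro conjI ballI)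
    show "(\<lambda>y. norm (f (fst (x, y)) * g (snd (x, y)))) summable_on UNIV" for x
      using f(2) g(2) gs by (simp add: abs_mult summable_on_cmult_right)
    have "(\<Sum>\<^sub>\<infinity>y. norm (f (fst (x, y)) * g (snd (x, y)))) = f x * infsum g UNIV" for x
      using f(2) g(2) by (simp add: abs_mult infsum_cmult_right')
    then show "(\<lambda>x. norm (\<Sum>\<^sub>\<infinity>y. norm (f (fst (x, y)) * g (snd (x, y))))) summable_on UNIV"
      using f(2) g(2) fs by (simp add: abs_mult infsum_nonneg summable_on_cmult_left)
  qed
  then have "(\<lambda>p. norm (D (fst p) (snd p))) summable_on (UNIV \<times> UNIV)"
    by (rule Infinite_Sum.abs_summable_on_comparison_test) (use le f(2) g(2) in \<open>auto simp: abs_mult\<close>)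
  then have "(\<lambda>p. D (fst p) (snd p)) summable_on (UNIV \<times> UNIV)"
    by (rule abs_summable_summable)
  then have "(\<lambda>(x, y). D x y) summable_on (UNIV \<times> UNIV)"
    by (simp only: case_prod_unfold)
  from infsum_swap_banach[OF this]
  show "(\<Sum>m. \<Sum>n. D m n) = (\<Sum>n. \<Sum>m. D m n)"
    using conv[OF Srow] conv[OF Scol] conv[OF row] conv[OF col] by simp
qed

section \<open>Euler's product in the nome and its logarithmic derivative\<close>

definition euler_phi :: "complex \<Rightarrow> complex" where
  "euler_phi q = (\<Prod>n. 1 - q ^ Suc n)"

lemma Re_one_minus_power_pos:
  fixes q :: complex
  assumes "norm q < 1"
  shows "Re (1 - q ^ Suc n) > 0"
proof -
  have "norm (q ^ Suc n) < 1"
    using assms by (simp add: norm_power power_less_one_iff del: power_Suc)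
  then have "Re (q ^ Suc n) < 1" using complex_Re_le_cmod[of "q ^ Suc n"] by linarith
  then show ?thesis by simp
qed

text \<open>All factors have positive real part, so the principal logarithm is holomorphic at each
  of them. On a disc of radius R < 1 the derivatives are dominated by the series of (n + 1) R^n
  divided by 1 - R, which permits termwise differentiation.\<close>

lemma euler_phi_aux:
  assumes "norm q < 1"
  shows "summable (\<lambda>n. Ln (1 - q ^ Suc n))"
    and "((\<lambda>q. \<Sum>n. Ln (1 - q ^ Suc n)) has_field_derivative
          (\<Sum>n. - (of_nat (Suc n) * q ^ n / (1 - q ^ Suc n)))) (at q)"
proof -
  obtain R where R: "norm q < R" "R < 1" using assms dense by blast
  then have "R > 0" using norm_ge_zero[of q] by linarith
  let ?f' = "\<lambda>n (x::complex). - (of_nat (Suc n) * x ^ n / (1 - x ^ Suc n))"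
  have der: "((\<lambda>x. Ln (1 - x ^ Suc n)) has_field_derivative ?f' n x) (at x within ball 0 R)"
    if "x \<in> ball 0 R" for n x
  proof -
    have "Re (1 - x ^ Suc n) > 0" using that R by (intro Re_one_minus_power_pos) auto
    then have "1 - x ^ Suc n \<notin> \<real>\<^sub>\<le>\<^sub>0" by (auto simp: complex_nonpos_Reals_iff)
    then show ?thesis
      by (auto intro!: derivative_eq_intros simp del: power_Suc simp: divide_simps)
  qed
  have "uniformly_convergent_on (ball 0 R) (\<lambda>n x. \<Sum>i<n. ?f' i x)"
  proof (rule Weierstrass_m_test'[where M = "\<lambda>n. (1 / (1 - R)) * (real (Suc n) * R ^ n)"])
    fix n :: nat and x :: complex assume "x \<in> ball 0 R"
    then have x: "norm x < R" by simp
    have "norm x ^ Suc n \<le> R ^ 1"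
    proof -
      have "norm x ^ Suc n \<le> R ^ Suc n" using x by (intro power_mono) auto
      also have "\<dots> \<le> R ^ 1" using R \<open>R > 0\<close> by (intro power_decreasing) auto
      finally show ?thesis .
    qed
    then have "1 - R \<le> 1 - norm (x ^ Suc n)" by (simp add: norm_power del: power_Suc)
    also have "\<dots> \<le> norm (1 - x ^ Suc n)" using norm_triangle_ineq2[of 1 "x ^ Suc n"] by simp
    finally have d: "1 - R \<le> norm (1 - x ^ Suc n)" .
    have "norm (?f' n x) = real (Suc n) * norm x ^ n / norm (1 - x ^ Suc n)"
      by (simp add: norm_mult norm_divide norm_power del: power_Suc of_nat_Suc)
    also have "\<dots> \<le> real (Suc n) * R ^ n / (1 - R)"
      using d x R \<open>R > 0\<close> by (intro frac_le mult_left_mono power_mono) auto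
    finally show "norm (?f' n x) \<le> (1 / (1 - R)) * (real (Suc n) * R ^ n)" by simp
  next
    have "summable (\<lambda>n. real (Suc n) * R ^ n)"
      using geometric_deriv_sums[of R] R \<open>R > 0\<close> by (simp add: sums_iff)
    then show "summable (\<lambda>n. (1 / (1 - R)) * (real (Suc n) * R ^ n))" by (rule summable_mult)
  qed
  note * = has_field_derivative_series'[OF convex_ball der this, of 0 q]
  show "summable (\<lambda>n. Ln (1 - q ^ Suc n))"
    by (rule *(1)) (use R \<open>R > 0\<close> in auto)
  show "((\<lambda>q. \<Sum>n. Ln (1 - q ^ Suc n)) has_field_derivative (\<Sum>n. ?f' n q)) (at q)"
    by (rule *(2)) (use R \<open>R > 0\<close> in auto)
qed

lemma euler_phi_eq_exp:
  assumes "norm q < 1"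
  shows "euler_phi q = exp (\<Sum>n. Ln (1 - q ^ Suc n))"
proof -
  have "exp (Ln (1 - q ^ Suc n)) = 1 - q ^ Suc n" for n
  proof -
    have "1 - q ^ Suc n \<noteq> 0"
      using Re_one_minus_power_pos[OF assms, of n] by (metis less_irrefl zero_complex.simps(1))
    then show ?thesis by (rule exp_Ln)
  qed
  then show ?thesis
    unfolding euler_phi_def using prodinf_exp[OF euler_phi_aux(1)[OF assms]] by simp
qed

lemma euler_phi_nonzero: "norm q < 1 \<Longrightarrow> euler_phi q \<noteq> 0"
  by (simp add: euler_phi_eq_exp)

text \<open>Both series are the double series of n q^(mn) over m, n >= 1. Summing over m first is a
  geometric series, summing over n first is its derivative. The second form has terms that are
  values of the inverse squared sine.\<close>

lemma lambert_swap:
  fixes q :: complex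
  assumes "norm q < 1"
  shows "summable (\<lambda>m. q ^ Suc m / (1 - q ^ Suc m)\<^sup>2)"
    "(\<Sum>n. of_nat (Suc n) * q ^ Suc n / (1 - q ^ Suc n)) = (\<Sum>m. q ^ Suc m / (1 - q ^ Suc m)\<^sup>2)"
proof -
  let ?D = "\<lambda>m n. of_nat (Suc n) * q ^ (Suc m * Suc n)"
  have lt: "norm (q ^ Suc k) < 1" for k
    using assms by (simp add: norm_power power_less_one_iff del: power_Suc)
  have bound: "norm (?D m n) \<le> norm q ^ Suc m * (real (Suc n) * norm q ^ n)" for m n
  proof -
    have "norm q ^ (Suc m * Suc n) \<le> norm q ^ (Suc m + n)"
      using assms by (intro power_decreasing) auto
    then have "real (Suc n) * norm q ^ (Suc m * Suc n) \<le> real (Suc n) * norm q ^ (Suc m + n)"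
      by (intro mult_left_mono) auto
    also have "\<dots> = norm q ^ Suc m * (real (Suc n) * norm q ^ n)"
      by (simp add: power_add del: of_nat_Suc)
    finally show ?thesis by (simp add: norm_mult norm_power del: of_nat_Suc)
  qed
  have s1: "summable (\<lambda>m. norm q ^ Suc m)" using assms by (simp add: summable_geometric summable_mult)
  have s2: "summable (\<lambda>n. real (Suc n) * norm q ^ n)"
    using geometric_deriv_sums[of "norm q"] assms by (simp add: sums_iff)
  have row: "(\<Sum>n. ?D m n) = q ^ Suc m / (1 - q ^ Suc m)\<^sup>2" for m
  proof -
    have "(\<lambda>n. q ^ Suc m * (of_nat (Suc n) * (q ^ Suc m) ^ n)) sums (q ^ Suc m * (1 / (1 - q ^ Suc m)\<^sup>2))"
      by (intro sums_mult geometric_deriv_sums lt)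
    moreover have "q ^ Suc m * (of_nat (Suc n) * (q ^ Suc m) ^ n) = ?D m n" for n
      by (simp only: power_mult power_Suc[of "q ^ Suc m" n]) (simp only: mult_ac)
    ultimately show ?thesis by (simp only: sums_iff times_divide_eq_right mult_1_right)
  qed
  have col: "(\<Sum>m. ?D m n) = of_nat (Suc n) * q ^ Suc n / (1 - q ^ Suc n)" for n
  proof -
    have "(\<lambda>m. (of_nat (Suc n) * q ^ Suc n) * (q ^ Suc n) ^ m) sums ((of_nat (Suc n) * q ^ Suc n) * (1 / (1 - q ^ Suc n)))"
      by (intro sums_mult geometric_sums lt)
    moreover have "(of_nat (Suc n) * q ^ Suc n) * (q ^ Suc n) ^ m = ?D m n" for m
      by (simp only: mult.commute[of "Suc m" "Suc n"] power_mult power_Suc[of "q ^ Suc n" m]) (simp only: mult_ac)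
    ultimately show ?thesis by (simp only: sums_iff times_divide_eq_right mult_1_right)
  qed
  have nn: "\<And>m. norm q ^ Suc m \<ge> 0" "\<And>n. real (Suc n) * norm q ^ n \<ge> 0" by simp_all
  note sw = suminf_swap[of ?D, OF bound s1 nn(1) s2 nn(2)]
  show "summable (\<lambda>m. q ^ Suc m / (1 - q ^ Suc m)\<^sup>2)" using sw(1) by (simp only: row)
  show "(\<Sum>n. of_nat (Suc n) * q ^ Suc n / (1 - q ^ Suc n)) = (\<Sum>m. q ^ Suc m / (1 - q ^ Suc m)\<^sup>2)"
    using sw(3) by (simp only: row col)
qed

lemma has_field_derivative_euler_phi:
  assumes "norm q < 1" "q \<noteq> 0"
  shows "(euler_phi has_field_derivative
           euler_phi q * (- (\<Sum>m. q ^ Suc m / (1 - q ^ Suc m)\<^sup>2) / q)) (at q)"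
proof -
  have "((\<lambda>q. exp (\<Sum>n. Ln (1 - q ^ Suc n))) has_field_derivative
         exp (\<Sum>n. Ln (1 - q ^ Suc n)) * (\<Sum>n. - (of_nat (Suc n) * q ^ n / (1 - q ^ Suc n)))) (at q)"
    by (rule DERIV_chain'[OF euler_phi_aux(2)[OF assms(1)] DERIV_exp])
  moreover have "(\<Sum>n. - (of_nat (Suc n) * q ^ n / (1 - q ^ Suc n)))
      = - (\<Sum>m. q ^ Suc m / (1 - q ^ Suc m)\<^sup>2) / q"
  proof -
    have "- (of_nat (Suc n) * q ^ n / (1 - q ^ Suc n)) = (-1 / q) * (of_nat (Suc n) * q ^ Suc n / (1 - q ^ Suc n))" for n
      using assms(2) by simp
    then have "(\<Sum>n. - (of_nat (Suc n) * q ^ n / (1 - q ^ Suc n)))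
        = (\<Sum>n. (-1 / q) * (of_nat (Suc n) * q ^ Suc n / (1 - q ^ Suc n)))" by (simp only:)
    also have "\<dots> = (-1 / q) * (\<Sum>n. of_nat (Suc n) * q ^ Suc n / (1 - q ^ Suc n))"
    proof (rule suminf_mult)
      have "summable (\<lambda>n. norm (of_nat (Suc n) * q ^ Suc n / (1 - q ^ Suc n)))"
      proof (rule summable_comparison_test'[of "\<lambda>n. (1 / (1 - norm q)) * (real (Suc n) * norm q ^ n)" 0])
        show "summable (\<lambda>n. (1 / (1 - norm q)) * (real (Suc n) * norm q ^ n))"
          using geometric_deriv_sums[of "norm q"] assms by (intro summable_mult) (simp add: sums_iff)
        fix n :: nat
        have "norm q ^ Suc n \<le> norm q" using assms by (simp add: mult_left_le power_le_one)
        then have "1 - norm q \<le> 1 - norm (q ^ Suc n)" by (simp add: norm_power del: power_Suc)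
        also have "\<dots> \<le> norm (1 - q ^ Suc n)" using norm_triangle_ineq2[of 1 "q ^ Suc n"] by simp
        finally have d: "1 - norm q \<le> norm (1 - q ^ Suc n)" .
        have "norm (of_nat (Suc n) * q ^ Suc n / (1 - q ^ Suc n))
            = real (Suc n) * norm q ^ Suc n / norm (1 - q ^ Suc n)"
          by (simp add: norm_mult norm_divide norm_power del: power_Suc of_nat_Suc)
        also have "\<dots> \<le> real (Suc n) * norm q ^ n / (1 - norm q)"
          using d assms by (intro frac_le mult_left_mono power_decreasing) auto
        finally show "norm (norm (of_nat (Suc n) * q ^ Suc n / (1 - q ^ Suc n)))
           \<le> (1 / (1 - norm q)) * (real (Suc n) * norm q ^ n)" by simp
      qed
      then show "summable (\<lambda>n. of_nat (Suc n) * q ^ Suc n / (1 - q ^ Suc n))"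
        by (rule summable_norm_cancel)
    qed
    finally show ?thesis using lambert_swap(2)[OF assms(1)] by simp
  qed
  ultimately have "((\<lambda>q. exp (\<Sum>n. Ln (1 - q ^ Suc n))) has_field_derivative
     euler_phi q * (- (\<Sum>m. q ^ Suc m / (1 - q ^ Suc m)\<^sup>2) / q)) (at q)"
    using assms by (simp add: euler_phi_eq_exp)
  \<comment> \<open>The product equals the exponential only inside the unit disc, so the derivative
    is transferred along an equality near q.\<close>
  then show ?thesis
    by (rule DERIV_cong_ev[THEN iffD1, OF refl _ refl, rotated])
       (use eventually_nhds_in_open[of "ball 0 1" q] assms in
         \<open>auto elim!: eventually_mono simp: euler_phi_eq_exp\<close>)
qed

section \<open>Partial fractions of the cotangent and of the inverse squared sine\<close>

lemma Digamma_reflection_complex: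
  assumes "z \<notin> \<int>"
  shows "Digamma z - Digamma (1 - z) = - of_real pi * cot (of_real pi * z :: complex)"
proof -
  have z: "z \<notin> \<int>\<^sub>\<le>\<^sub>0" "1 - z \<notin> \<int>\<^sub>\<le>\<^sub>0"
    using assms by (auto dest: nonpos_Ints_Int)
  have s: "sin (of_real pi * z) \<noteq> 0"
  proof
    assume "sin (of_real pi * z) = 0"
    then obtain n :: int where "of_real pi * z = of_real (of_int n * pi)" by (auto simp: sin_eq_0)
    then have "z = of_int n" by simp
    then show False using assms by simp
  qed
  \<comment> \<open>The reflection formula of the Gamma function is differentiated on both sides;
    dividing by the common nonzero value leaves logarithmic derivatives.\<close>
  have "((\<lambda>z. Gamma z * Gamma (1 - z)) has_field_derivative
      Gamma z * Gamma (1 - z) * (Digamma z - Digamma (1 - z))) (at z)"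
    using z by (auto intro!: derivative_eq_intros simp: algebra_simps)
  moreover have "((\<lambda>z. of_real pi / sin (of_real pi * z)) has_field_derivative
      of_real pi / sin (of_real pi * z) * (- of_real pi * cot (of_real pi * z))) (at z)"
    using s by (auto intro!: derivative_eq_intros simp: cot_def field_simps)
  ultimately have "of_real pi / sin (of_real pi * z) * (Digamma z - Digamma (1 - z))
      = of_real pi / sin (of_real pi * z) * (- of_real pi * cot (of_real pi * z))"
    unfolding Gamma_reflection_complex by (rule DERIV_unique)
  moreover have "of_real pi / sin (of_real pi * z) \<noteq> 0" using s by simp
  ultimately show ?thesis by (metis mult_left_cancel)
qed

lemma Polygamma_reflection_complex:
  assumes "z \<notin> \<int>"
  shows "Polygamma 1 z + Polygamma 1 (1 - z) = of_real pi ^ 2 / sin (of_real pi * z :: complex) ^ 2"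
proof -
  have z: "z \<notin> \<int>\<^sub>\<le>\<^sub>0" "1 - z \<notin> \<int>\<^sub>\<le>\<^sub>0"
    using assms by (auto dest: nonpos_Ints_Int)
  have s: "sin (of_real pi * z) \<noteq> 0"
  proof
    assume "sin (of_real pi * z) = 0"
    then obtain n :: int where "of_real pi * z = of_real (of_int n * pi)" by (auto simp: sin_eq_0)
    then have "z = of_int n" by simp
    then show False using assms by simp
  qed
  have "((\<lambda>z. Digamma z - Digamma (1 - z)) has_field_derivative
      Polygamma 1 z + Polygamma 1 (1 - z)) (at z)"
    using z by (auto intro!: derivative_eq_intros)
  moreover have "((\<lambda>z. - of_real pi * cot (of_real pi * z)) has_field_derivative
      of_real pi ^ 2 / sin (of_real pi * z) ^ 2) (at z)"
    using s by (auto intro!: derivative_eq_intros DERIV_chain2[OF DERIV_cot] simp: field_simps power2_eq_square)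
  then have "((\<lambda>z. Digamma z - Digamma (1 - z)) has_field_derivative
      of_real pi ^ 2 / sin (of_real pi * z) ^ 2) (at z)"
    by (rule has_field_derivative_transform_within_open[where S = "- \<int>"])
       (use assms Digamma_reflection_complex in \<open>auto simp: open_Compl\<close>)
  ultimately show ?thesis by (rule DERIV_unique)
qed

text \<open>The series of \<open>Polygamma 1\<close> at z and at 1 - z are the two halves of the sum
  of 1/(z + n)^2 over all integers n. The term n = 0 belongs to the first half and is moved to the
  right, so that both halves start at 1.\<close>

lemma sin_squared_partial_fractions:
  assumes "z \<notin> \<int>"
  shows "(\<lambda>n. 1 / (z + of_nat (Suc n))\<^sup>2 + 1 / (z - of_nat (Suc n))\<^sup>2) sums
           (of_real pi ^ 2 / sin (of_real pi * z :: complex) ^ 2 - 1 / z\<^sup>2)"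
proof -
  have nz: "z \<noteq> 0" "1 - z \<noteq> 0" using assms by auto
  have "(\<lambda>k. inverse ((z + of_nat k) ^ Suc 1)) sums Polygamma 1 z"
    using Polygamma_LIMSEQ[of z 1] nz by simp
  then have "(\<lambda>k. 1 / (z + of_nat k)\<^sup>2) sums Polygamma 1 z"
    by (simp add: power2_eq_square inverse_eq_divide)
  then have 1: "(\<lambda>k. 1 / (z + of_nat (Suc k))\<^sup>2) sums (Polygamma 1 z - 1 / z\<^sup>2)"
    by (subst sums_Suc_iff) simp
  have "(\<lambda>k. inverse ((1 - z + of_nat k) ^ Suc 1)) sums Polygamma 1 (1 - z)"
    using Polygamma_LIMSEQ[of "1 - z" 1] nz by simp
  moreover have "(1 - z + of_nat k) ^ Suc 1 = (z - of_nat (Suc k))\<^sup>2" for k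
    by (simp add: power2_eq_square algebra_simps)
  ultimately have 2: "(\<lambda>k. 1 / (z - of_nat (Suc k))\<^sup>2) sums Polygamma 1 (1 - z)"
    by (simp add: inverse_eq_divide)
  show ?thesis
    using sums_add[OF 1 2] Polygamma_reflection_complex[OF assms] by (simp add: algebra_simps)
qed

lemma cot_partial_fractions:
  assumes "z \<notin> \<int>"
  shows "(\<lambda>n. 2 * z / (z\<^sup>2 - (of_nat (Suc n))\<^sup>2)) sums
           (of_real pi * cot (of_real pi * z :: complex) - 1 / z)"
proof -
  have nz: "z \<noteq> 0" "1 - z \<noteq> 0" "1 + z \<noteq> 0"
    using assms by (auto simp: add_eq_0_iff)
  have nz': "z - of_nat (Suc n) \<noteq> 0" "z + of_nat (Suc n) \<noteq> 0" for n
    using assms by (auto simp: add_eq_0_iff simp del: of_nat_Suc) (metis Ints_minus Ints_of_nat minus_minus)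
  \<comment> \<open>These are the approximants of \<open>Digamma\<close>. In the difference of those
    at 1 - z and 1 + z the logarithms cancel, and what remains are the partial sums of the claimed
    series.\<close>
  let ?a = "\<lambda>z m. of_real (ln (real m)) - (\<Sum>n<m. inverse (z + of_nat n :: complex))"
  have "(\<lambda>m. ?a (1 - z) m - ?a (1 + z) m) \<longlonglongrightarrow> Digamma (1 - z) - Digamma (1 + z)"
    using nz by (intro tendsto_diff Digamma_LIMSEQ) auto
  moreover have "?a (1 - z) m - ?a (1 + z) m = (\<Sum>n<m. 2 * z / (z\<^sup>2 - (of_nat (Suc n))\<^sup>2))" for m
  proof -
    have "inverse (1 + z + of_nat n) - inverse (1 - z + of_nat n) = 2 * z / (z\<^sup>2 - (of_nat (Suc n))\<^sup>2)" for n
    proof -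
      define w :: complex where "w = of_nat (Suc n)"
      have w: "1 + z + of_nat n = z + w" "1 - z + of_nat n = - (z - w)" by (simp_all add: w_def)
      have "z - w \<noteq> 0" "z + w \<noteq> 0" unfolding w_def using nz' by blast+
      moreover have "z\<^sup>2 - w\<^sup>2 = (z + w) * (z - w)" by (simp add: power2_eq_square algebra_simps)
      ultimately show ?thesis unfolding w w_def[symmetric] by (simp add: divide_simps) (simp add: algebra_simps)
    qed
    then show ?thesis by (simp add: sum_subtractf[symmetric])
  qed
  moreover have "Digamma (1 - z) - Digamma (1 + z) = of_real pi * cot (of_real pi * z) - 1 / z"
    using Digamma_plus1[OF nz(1)] Digamma_reflection_complex[OF assms] by (simp add: add_ac algebra_simps)
  ultimately show ?thesis by (simp add: sums_def)
qed

lemma cot_limit_lower: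
  assumes "filterlim (\<lambda>n. Im (f n)) at_bot F"
  shows "((\<lambda>n. cot (f n :: complex)) \<longlongrightarrow> \<i>) F"
proof -
  \<comment> \<open>At zeros of the sine both sides are 0, by the convention for division by
    0.\<close>
  have cot: "cot w = \<i> * (exp (2 * \<i> * w) + 1) / (exp (2 * \<i> * w) - 1)" for w :: complex
  proof (cases "exp (2 * \<i> * w) = 1")
    case True
    have "exp (\<i> * w) * exp (\<i> * w) = 1" using True by (simp add: exp_add[symmetric] algebra_simps)
    then have "sin w = 0" by (simp add: sin_exp_eq exp_minus field_simps)
    then show ?thesis using True by (simp add: cot_def)
  next
    case False
    have e: "exp (2 * \<i> * w) = exp (\<i> * w) * exp (\<i> * w)" by (simp add: exp_add[symmetric] algebra_simps)
    show ?thesis using False unfolding e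
      by (simp add: cot_def sin_exp_eq cos_exp_eq exp_minus divide_simps)
  qed
  \<comment> \<open>This form uses exp (-2iw), whose norm exp (2 Im w) tends to 0 as Im w tends to
    minus infinity.\<close>
  have c: "cot w = \<i> * (1 + exp (-2 * \<i> * w)) / (1 - exp (-2 * \<i> * w))" for w :: complex
  proof -
    define X where "X = exp (2 * \<i> * w)"
    have X: "X \<noteq> 0" by (simp add: X_def)
    have "exp (-2 * \<i> * w) = 1 / X" by (simp add: X_def exp_minus inverse_eq_divide)
    moreover have "\<i> * (X + 1) / (X - 1) = \<i> * (1 + 1 / X) / (1 - 1 / X)"
      using X by (cases "X = 1") (simp_all add: divide_simps)
    ultimately show ?thesis unfolding cot X_def[symmetric] by simp
  qed
  have "filterlim (\<lambda>n. norm (exp (-2 * \<i> * f n))) (nhds 0) F"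
  proof -
    have "filterlim (\<lambda>n. 2 * Im (f n)) at_bot F"
      by (rule filterlim_tendsto_pos_mult_at_bot[OF tendsto_const _ assms]) simp
    then have "filterlim (\<lambda>n. exp (2 * Im (f n))) (nhds 0) F"
      by (rule filterlim_compose[OF exp_at_bot])
    then show ?thesis by simp
  qed
  then have e: "((\<lambda>n. exp (-2 * \<i> * f n)) \<longlongrightarrow> 0) F" by (rule tendsto_norm_zero_cancel)
  have "((\<lambda>n. \<i> * (1 + exp (-2 * \<i> * f n)) / (1 - exp (-2 * \<i> * f n))) \<longlongrightarrow> \<i> * (1 + 0) / (1 - 0)) F"
    by (intro tendsto_intros e) simp
  then show ?thesis by (simp add: c)
qed

section \<open>The weight 2 Eisenstein series and its failure to be modular\<close>

lemma upper_half_plane_lattice_bound: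
  assumes "Im \<tau> > 0"
  obtains c where "c > 0" "\<And>m t :: real. m > 0 \<Longrightarrow> m * \<bar>t\<bar> \<le> c * (norm (of_real m * \<tau> + of_real t))\<^sup>2"
proof -
  \<comment> \<open>From m Im \<tau> <= norm w and |t| <= norm w + m norm \<tau> one gets |t| <= K
    norm w. Multiplying the bounds for m and |t| separates the variables, as the product majorant of
    \<open>suminf_swap\<close> demands.\<close>
  define K where "K = 1 + norm \<tau> / Im \<tau>"
  show ?thesis
  proof (rule that[of "K / Im \<tau>"])
    show "K / Im \<tau> > 0" using assms by (simp add: K_def add_pos_nonneg)
    fix m t :: real assume m: "m > 0"
    let ?w = "of_real m * \<tau> + of_real t"
    have 1: "m * Im \<tau> \<le> norm ?w" using abs_Im_le_cmod[of ?w] m assms by simp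
    then have 2: "m \<le> norm ?w / Im \<tau>" using assms by (simp add: field_simps)
    have "\<bar>t\<bar> = norm (?w - of_real m * \<tau>)" by simp
    also have "\<dots> \<le> norm ?w + norm (of_real m * \<tau>)" by (rule norm_triangle_ineq4)
    also have "\<dots> = norm ?w + m * norm \<tau>" using m by (simp add: norm_mult)
    also have "\<dots> \<le> norm ?w + norm ?w / Im \<tau> * norm \<tau>"
      using 2 by (intro add_left_mono mult_right_mono) auto
    also have "\<dots> = K * norm ?w" by (simp add: K_def algebra_simps)
    finally have 3: "\<bar>t\<bar> \<le> K * norm ?w" .
    have "m * \<bar>t\<bar> \<le> (norm ?w / Im \<tau>) * (K * norm ?w)"
      using 2 3 m assms by (intro mult_mono) auto
    then show "m * \<bar>t\<bar> \<le> K / Im \<tau> * (norm ?w)\<^sup>2" by (simp add: power2_eq_square mult_ac)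
  qed
qed

text \<open>The difference is -1/4 divided by w^2 (w^2 - 1/4), and each of the two factors is at
  least a constant times m |t|. The quarter is (1/2)^2: w^2 - 1/4 is the product of the shifts of w
  by 1/2 in both directions.\<close>

lemma telescoping_comparison_bound:
  assumes "Im \<tau> > 0"
  obtains C where "C \<ge> 0" "\<And>m t :: real. m > 0 \<Longrightarrow> \<bar>t\<bar> \<ge> 1 \<Longrightarrow>
    norm (1 / (of_real m * \<tau> + of_real t)\<^sup>2 - 1 / ((of_real m * \<tau> + of_real t)\<^sup>2 - 1 / 4)) \<le> C * (1 / m\<^sup>2) * (1 / t\<^sup>2)"
proof -
  obtain c where c: "c > 0" "\<And>m t :: real. m > 0 \<Longrightarrow> m * \<bar>t\<bar> \<le> c * (norm (of_real m * \<tau> + of_real t))\<^sup>2"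
    using upper_half_plane_lattice_bound[OF assms] by blast
  show ?thesis
  proof (rule that[of "c\<^sup>2 / 2"])
    fix m t :: real assume m: "m > 0" and t: "\<bar>t\<bar> \<ge> 1"
    define w where "w = of_real m * \<tau> + of_real t"
    have nz: "w + of_real s \<noteq> 0" for s
    proof -
      have "Im (w + of_real s) > 0" using m assms by (simp add: w_def)
      then show ?thesis by (metis less_irrefl zero_complex.simps(2))
    qed
    have bnd: "m * \<bar>t + s\<bar> / c \<le> (norm (w + of_real s))\<^sup>2" for s
      using c(2)[OF m, of "t + s"] c(1) by (simp add: w_def field_simps)
    have t2: "t\<^sup>2 \<ge> 1" using t by (metis abs_le_square_iff abs_1 one_power2)
    have fac: "w\<^sup>2 - 1 / 4 = (w + of_real (- 1 / 2)) * (w + of_real (1 / 2))"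
      by (simp add: power2_eq_square algebra_simps)
    \<comment> \<open>For |t| >= 1 one has t^2 - 1/4 >= t^2/4, so the half shifts cost no more than
      the factor 2 in the denominator.\<close>
    have "(m * \<bar>t\<bar> / (2 * c))\<^sup>2 \<le> (m * \<bar>t + (- 1 / 2)\<bar> / c) * (m * \<bar>t + 1 / 2\<bar> / c)"
    proof -
      have "\<bar>t + (- 1 / 2)\<bar> * \<bar>t + 1 / 2\<bar> = \<bar>t\<^sup>2 - 1 / 4\<bar>"
        by (simp add: abs_mult[symmetric] power2_eq_square algebra_simps)
      also have "\<dots> \<ge> t\<^sup>2 / 4" using t2 by simp
      finally have "(m / c)\<^sup>2 * (t\<^sup>2 / 4) \<le> (m / c)\<^sup>2 * (\<bar>t + (- 1 / 2)\<bar> * \<bar>t + 1 / 2\<bar>)"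
        by (rule mult_left_mono) simp
      then show ?thesis by (simp add: power2_eq_square field_simps)
    qed
    also have "\<dots> \<le> (norm (w + of_real (- 1 / 2)))\<^sup>2 * (norm (w + of_real (1 / 2)))\<^sup>2"
      using m c(1) by (intro mult_mono bnd) auto
    also have "\<dots> = (norm (w\<^sup>2 - 1 / 4))\<^sup>2"
      unfolding fac by (simp only: norm_mult power_mult_distrib)
    finally have "m * \<bar>t\<bar> / (2 * c) \<le> norm (w\<^sup>2 - 1 / 4)" by (rule power2_le_imp_le) simp
    moreover have "m * \<bar>t\<bar> / c \<le> norm (w\<^sup>2)" using bnd[of 0] by (simp add: norm_power)
    moreover have pos: "m * \<bar>t\<bar> / (2 * c) > 0" "m * \<bar>t\<bar> / c > 0" using m t c(1) by auto
    ultimately have le: "(m * \<bar>t\<bar> / c) * (m * \<bar>t\<bar> / (2 * c)) \<le> norm (w\<^sup>2) * norm (w\<^sup>2 - 1 / 4)"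
      by (intro mult_mono) auto
    have nz2: "w \<noteq> 0" "w\<^sup>2 - 1 / 4 \<noteq> 0"
      using nz[of 0] nz[of "- 1 / 2"] nz[of "1 / 2"] unfolding fac by auto
    have "1 / w\<^sup>2 - 1 / (w\<^sup>2 - 1 / 4) = (- 1 / 4) / (w\<^sup>2 * (w\<^sup>2 - 1 / 4))"
      using nz2 by (simp add: divide_simps)
    then have "norm (1 / w\<^sup>2 - 1 / (w\<^sup>2 - 1 / 4)) = (1 / 4) / (norm (w\<^sup>2) * norm (w\<^sup>2 - 1 / 4))"
      by (simp add: norm_divide norm_mult)
    also have "\<dots> \<le> (1 / 4) / ((m * \<bar>t\<bar> / c) * (m * \<bar>t\<bar> / (2 * c)))"
    proof (rule divide_left_mono[OF le])
      have "norm (w\<^sup>2) * norm (w\<^sup>2 - 1 / 4) > 0" using nz2 by simp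
      then show "0 < norm (w\<^sup>2) * norm (w\<^sup>2 - 1 / 4) * ((m * \<bar>t\<bar> / c) * (m * \<bar>t\<bar> / (2 * c)))"
        using mult_pos_pos[OF pos(2) pos(1)] by (rule mult_pos_pos)
    qed simp
    also have "\<dots> = c\<^sup>2 / 2 * (1 / m\<^sup>2) * (1 / t\<^sup>2)"
      using m t c(1) by (simp add: field_simps power2_eq_square)
    finally show "norm (1 / (of_real m * \<tau> + of_real t)\<^sup>2 - 1 / ((of_real m * \<tau> + of_real t)\<^sup>2 - 1 / 4))
      \<le> c\<^sup>2 / 2 * (1 / m\<^sup>2) * (1 / t\<^sup>2)" unfolding w_def .
  qed simp
qed

text \<open>The inner sums \<open>\<Sum>\<^sub>n (m\<tau> + n)\<^sup>-\<^sup>2\<close> over the integers are evaluated in closed form; the order of summation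
  matters because the double sum converges only conditionally.\<close>
definition eisenstein_G2 :: "complex \<Rightarrow> complex" where
  "eisenstein_G2 \<tau> = of_real pi ^ 2 / 3
     + 2 * (\<Sum>m. of_real pi ^ 2 / sin (of_real pi * (of_nat (Suc m) * \<tau>)) ^ 2)"

lemma Im_of_real_mult: "Im (of_real r * z) = r * Im z"
  by simp

lemma Im_nonzero_not_Ints: "Im z \<noteq> 0 \<Longrightarrow> z \<notin> \<int>"
  by (auto elim!: Ints_cases)

lemma basel_complex: "(\<lambda>n. 1 / (of_nat (Suc n))\<^sup>2 :: complex) sums (of_real pi ^ 2 / 6)"
proof -
  have "(\<lambda>n. complex_of_real (1 / real (Suc n) ^ 2)) sums of_real (pi\<^sup>2 / 6)"
    using inverse_squares_sums by (subst sums_of_real_iff) (simp add: add_ac)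
  then show ?thesis by simp
qed

text \<open>For m, n >= 1 the rows of \<open>a\<close> lead to the series at \<tau> and its columns
  to the one at -1/\<tau>; the terms with n = 0 or m = 0 are the multiples of pi^2. The totals of
  \<open>b\<close> are -C 0 by rows and lim C - C 0 by columns. As \<open>a - b\<close> may be
  summed in either order, the two results for \<open>a\<close> differ by lim C = -pi i/\<tau>, and
  the factor 2 in \<open>eisenstein_G2\<close> doubles this.\<close>

lemma eisenstein_G2_inversion:
  assumes \<tau>: "Im \<tau> > 0"
  shows "summable (\<lambda>m. of_real pi ^ 2 / sin (of_real pi * (of_nat (Suc m) * \<tau>)) ^ 2)"
    "eisenstein_G2 (- 1 / \<tau>) / \<tau>\<^sup>2 = eisenstein_G2 \<tau> - 2 * of_real pi * \<i> / \<tau>"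
proof -
  have \<tau>0: "\<tau> \<noteq> 0" using \<tau> by auto
  define M :: "nat \<Rightarrow> complex" where "M m = of_nat (Suc m)" for m
  have M0: "M m \<noteq> 0" for m unfolding M_def by (rule of_nat_neq_0)
  \<comment> \<open>The half-integers around \<open>M n\<close>: \<open>h n = M n - 1/2\<close> and
    \<open>h (Suc n) = M n + 1/2\<close>.\<close>
  define h :: "nat \<Rightarrow> complex" where "h n = of_nat n + 1 / 2" for n
  have h_real: "h n = of_real (real n + 1 / 2)" for n by (simp add: h_def)
  define s where "s z = of_real pi ^ 2 / sin (of_real pi * z) ^ 2" for z :: complex
  define a where "a m n = 1 / (M m * \<tau> + M n)\<^sup>2 + 1 / (M m * \<tau> - M n)\<^sup>2" for m n
  define F where "F m n = 1 / (M m * \<tau> - h n) - 1 / (M m * \<tau> + h n)" for m n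
  \<comment> \<open>\<open>b\<close> replaces the derivative \<open>a\<close> of \<open>t \<mapsto> 2t/((m\<tau>)\<^sup>2 - t\<^sup>2)\<close> at \<open>t = n\<close> by a central difference, so \<open>a - b\<close> is
    absolutely summable and the anomaly comes from the explicit sums of \<open>b\<close> alone\<close>
  define b where "b m n = F m (Suc n) - F m n" for m n
  \<comment> \<open>This is the sum of \<open>F m n\<close> over m, evaluated by the partial
    fractions of the cotangent at \<open>h n / \<tau>\<close>, which is not real.\<close>
  define C where "C n = - (1 / \<tau>) * (of_real pi * cot (of_real pi * (h n / \<tau>)) - \<tau> / h n)" for n
  have Im_M: "Im (M m * \<tau>) > 0" for m using \<tau> by (simp add: M_def)
  have Im_inv: "Im (1 / \<tau>) < 0" using \<tau> by (simp add: Im_complex_div_lt_0)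
  have nz: "M m * \<tau> + of_real t \<noteq> 0" "M m * \<tau> - of_real t \<noteq> 0" for m t
  proof -
    have "Im (M m * \<tau> + of_real t) > 0" "Im (M m * \<tau> - of_real t) > 0" using Im_M[of m] by simp_all
    then show "M m * \<tau> + of_real t \<noteq> 0" "M m * \<tau> - of_real t \<noteq> 0"
      by (metis less_irrefl zero_complex.simps(2))+
  qed
  have h0: "h n \<noteq> 0" for n
  proof -
    have "Re (h n) > 0" by (simp add: h_def)
    then show ?thesis by (metis less_irrefl zero_complex.simps(1))
  qed

  have b_eq: "b m n = 1 / ((M m * \<tau> + M n)\<^sup>2 - 1 / 4) + 1 / ((M m * \<tau> - M n)\<^sup>2 - 1 / 4)" for m n
  proof -
    define x where "x = M m * \<tau>"
    define N where "N = M n"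
    have hS: "h (Suc n) = N + 1 / 2" and hn: "h n = N - 1 / 2" by (simp_all add: h_def N_def M_def)
    have nz': "x - (N + 1 / 2) \<noteq> 0" "x + (N + 1 / 2) \<noteq> 0" "x - (N - 1 / 2) \<noteq> 0" "x + (N - 1 / 2) \<noteq> 0"
      using nz[of m "real (Suc n) + 1 / 2"] nz[of m "real (Suc n) - 1 / 2"] by (simp_all add: x_def N_def M_def)
    have e: "(x + N)\<^sup>2 - 1 / 4 = (x + (N - 1 / 2)) * (x + (N + 1 / 2))"
      "(x - N)\<^sup>2 - 1 / 4 = (x - (N + 1 / 2)) * (x - (N - 1 / 2))"
      by (simp_all add: power2_eq_square algebra_simps)
    have p: "1 / (u * (u + 1)) = 1 / u - 1 / (u + 1)" if "u \<noteq> 0" "u + 1 \<noteq> 0" for u :: complex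
      using that by (simp add: field_simps)
    have u: "x + (N - 1 / 2) + 1 = x + (N + 1 / 2)" "x - (N + 1 / 2) + 1 = x - (N - 1 / 2)" by simp_all
    have "1 / ((x + N)\<^sup>2 - 1 / 4) = 1 / (x + (N - 1 / 2)) - 1 / (x + (N + 1 / 2))"
      using p[of "x + (N - 1 / 2)"] nz' unfolding e u by simp
    moreover have "1 / ((x - N)\<^sup>2 - 1 / 4) = 1 / (x - (N + 1 / 2)) - 1 / (x - (N - 1 / 2))"
      using p[of "x - (N + 1 / 2)"] nz' unfolding e u by simp
    ultimately show ?thesis
      unfolding b_def F_def hS hn x_def[symmetric] N_def[symmetric] by simp
  qed

  have a_row: "(\<lambda>n. a m n) sums (s (M m * \<tau>) - 1 / (M m * \<tau>)\<^sup>2)" for m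
  proof -
    have "Im (M m * \<tau>) \<noteq> 0" using Im_M[of m] by linarith
    then show ?thesis
      unfolding a_def s_def M_def by (intro sin_squared_partial_fractions Im_nonzero_not_Ints)
  qed
  have b_row: "(\<lambda>n. b m n) sums (0 - F m 0)" for m
  proof -
    have "filterlim (\<lambda>n. h n) at_infinity sequentially"
      unfolding h_def
      by (rule tendsto_add_filterlim_at_infinity'[OF tendsto_of_nat tendsto_const])
    then have 1: "filterlim (\<lambda>n. M m * \<tau> + h n) at_infinity sequentially"
      by (rule tendsto_add_filterlim_at_infinity[OF tendsto_const])
    have "filterlim (\<lambda>n. - h n) at_infinity sequentially"
      using \<open>filterlim (\<lambda>n. h n) at_infinity sequentially\<close> by (simp add: filterlim_at_infinity_conv_norm_at_top)
    then have 2: "filterlim (\<lambda>n. M m * \<tau> + - h n) at_infinity sequentially"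
      by (rule tendsto_add_filterlim_at_infinity[OF tendsto_const])
    have "(\<lambda>n. 1 / (M m * \<tau> + - h n) - 1 / (M m * \<tau> + h n)) \<longlonglongrightarrow> 0 - 0"
      by (intro tendsto_diff tendsto_divide_0[OF tendsto_const] 1 2)
    then have "(\<lambda>n. F m n) \<longlonglongrightarrow> 0" by (simp add: F_def)
    then show ?thesis unfolding b_def by (rule telescope_sums)
  qed
  have F_col: "(\<lambda>m. F m n) sums C n" for n
  proof -
    have z: "h n / \<tau> \<notin> \<int>"
    proof (rule Im_nonzero_not_Ints)
      have "h n / \<tau> = of_real (real n + 1 / 2) * (1 / \<tau>)" by (simp add: h_real)
      then have "Im (h n / \<tau>) = (real n + 1 / 2) * Im (1 / \<tau>)" by (simp only: Im_of_real_mult)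
      then show "Im (h n / \<tau>) \<noteq> 0" using Im_inv by simp
    qed
    have "F m n = - (1 / \<tau>) * (2 * (h n / \<tau>) / ((h n / \<tau>)\<^sup>2 - (M m)\<^sup>2))" for m
    proof -
      have n1: "M m * \<tau> - h n \<noteq> 0" "M m * \<tau> + h n \<noteq> 0" using nz unfolding h_real by blast+
      have e: "(h n / \<tau>)\<^sup>2 - (M m)\<^sup>2 = - ((M m * \<tau> - h n) * (M m * \<tau> + h n)) / \<tau>\<^sup>2"
        using \<tau>0 by (simp add: field_simps power2_eq_square)
      have f: "F m n = 2 * h n / ((M m * \<tau> - h n) * (M m * \<tau> + h n))"
        unfolding F_def using n1 by (simp add: diff_frac_eq)
      have cancel: "2 * t / X = - (1 / \<tau>) * (2 * (t / \<tau>) / (- X / \<tau>\<^sup>2))" if "X \<noteq> 0" for X t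
        using that \<tau>0 by (simp add: power2_eq_square)
      show ?thesis unfolding e f using n1 by (intro cancel) simp
    qed
    then show ?thesis
      using sums_mult[OF cot_partial_fractions[OF z], of "- (1 / \<tau>)"] by (simp add: C_def M_def)
  qed
  have b_col: "(\<lambda>m. b m n) sums (C (Suc n) - C n)" for n
    unfolding b_def by (intro sums_diff F_col)
  \<comment> \<open>Since Im (1/\<tau>) < 0, the points \<open>h n / \<tau>\<close> go down to minus
    infinity in imaginary part, where the cotangent tends to +i. This fixes the sign of the
    anomaly.\<close>
  have C_lim: "C \<longlonglongrightarrow> - (1 / \<tau>) * (of_real pi * \<i> - 0)"
    unfolding C_def
  proof (intro tendsto_mult tendsto_diff tendsto_const)
    have "Im (of_real pi * (h n / \<tau>)) = (pi * Im (1 / \<tau>)) * (1 / 2 + real n)" for n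
    proof -
      have "of_real pi * (h n / \<tau>) = of_real (pi * (real n + 1 / 2)) * (1 / \<tau>)" by (simp add: h_real)
      then show ?thesis by (simp only: Im_of_real_mult) (simp add: algebra_simps)
    qed
    moreover have "filterlim (\<lambda>n. (pi * Im (1 / \<tau>)) * (1 / 2 + real n)) at_bot sequentially"
    proof (rule filterlim_tendsto_neg_mult_at_bot[OF tendsto_const])
      show "pi * Im (1 / \<tau>) < 0" using Im_inv by (simp add: mult_less_0_iff)
      show "filterlim (\<lambda>n. 1 / 2 + real n) at_top sequentially"
        by (rule filterlim_tendsto_add_at_top[OF tendsto_const filterlim_real_sequentially])
    qed
    ultimately show "(\<lambda>n. cot (of_real pi * (h n / \<tau>))) \<longlonglongrightarrow> \<i>"
      by (intro cot_limit_lower) simp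
    have "filterlim (\<lambda>n. h n) at_infinity sequentially"
      unfolding h_def
      by (rule tendsto_add_filterlim_at_infinity'[OF tendsto_of_nat tendsto_const])
    then show "(\<lambda>n. \<tau> / h n) \<longlonglongrightarrow> 0" by (rule tendsto_divide_0[OF tendsto_const])
  qed
  have b_tot: "(\<lambda>n. C (Suc n) - C n) sums (- (of_real pi * \<i> / \<tau>) - C 0)"
    using telescope_sums[OF C_lim] by simp
  have a_col: "(\<lambda>m. a m n) sums (s (M n * (- 1 / \<tau>)) / \<tau>\<^sup>2 - 1 / (M n)\<^sup>2)" for n
  proof -
    have z: "M n / \<tau> \<notin> \<int>"
    proof (rule Im_nonzero_not_Ints)
      have "M n / \<tau> = of_real (real (Suc n)) * (1 / \<tau>)" by (simp add: M_def)
      then have "Im (M n / \<tau>) = real (Suc n) * Im (1 / \<tau>)" by (simp only: Im_of_real_mult)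
      then show "Im (M n / \<tau>) \<noteq> 0" using Im_inv by simp
    qed
    have "a m n = (1 / \<tau>\<^sup>2) * (1 / (M n / \<tau> + M m)\<^sup>2 + 1 / (M n / \<tau> - M m)\<^sup>2)" for m
    proof -
      have "M n / \<tau> + M m = (M m * \<tau> + M n) / \<tau>" "M n / \<tau> - M m = - (M m * \<tau> - M n) / \<tau>"
        using \<tau>0 by (simp_all add: field_simps)
      then show ?thesis unfolding a_def using \<tau>0
        by (simp add: power_divide distrib_left power2_commute[of "M n"])
    qed
    \<comment> \<open>The column sums are naturally taken at 1/\<tau>, outside the upper half-plane;
      \<open>s\<close> is even.\<close>
    moreover have "s (M n * (- 1 / \<tau>)) = s (M n / \<tau>)" by (simp add: s_def)
    ultimately show ?thesis
      using sums_mult[OF sin_squared_partial_fractions[OF z], of "1 / \<tau>\<^sup>2"] \<tau>0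
      by (simp add: s_def M_def power_divide algebra_simps)
  qed

  obtain K where K: "K \<ge> 0" "\<And>m t :: real. m > 0 \<Longrightarrow> \<bar>t\<bar> \<ge> 1 \<Longrightarrow>
    norm (1 / (of_real m * \<tau> + of_real t)\<^sup>2 - 1 / ((of_real m * \<tau> + of_real t)\<^sup>2 - 1 / 4)) \<le> K * (1 / m\<^sup>2) * (1 / t\<^sup>2)"
    using telescoping_comparison_bound[OF \<tau>] by blast
  define f where "f m = 2 * K * (1 / (real (Suc m))\<^sup>2)" for m
  define g where "g n = 1 / (real (Suc n))\<^sup>2" for n
  have bound: "norm (a m n - b m n) \<le> f m * g n" for m n
  proof -
    let ?d = "\<lambda>w :: complex. 1 / w\<^sup>2 - 1 / (w\<^sup>2 - 1 / 4)"
    have "a m n - b m n = ?d (M m * \<tau> + M n) + ?d (M m * \<tau> - M n)"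
      by (simp add: a_def b_eq)
    also have "norm \<dots> \<le> norm (?d (M m * \<tau> + M n)) + norm (?d (M m * \<tau> - M n))"
      by (rule norm_triangle_ineq)
    also have "\<dots> \<le> K * (1 / (real (Suc m))\<^sup>2) * (1 / (real (Suc n))\<^sup>2) + K * (1 / (real (Suc m))\<^sup>2) * (1 / (real (Suc n))\<^sup>2)"
      using K(2)[of "real (Suc m)" "real (Suc n)"] K(2)[of "real (Suc m)" "- real (Suc n)"]
      by (intro add_mono) (simp_all add: M_def del: of_nat_Suc)
    finally show ?thesis by (simp add: f_def g_def)
  qed
  have basel: "summable (\<lambda>n. 1 / (real (Suc n))\<^sup>2)"
    using inverse_squares_sums by (simp add: sums_iff)
  have fg: "summable f" "summable g"
    unfolding f_def g_def by (rule summable_mult[OF basel], rule basel)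
  have fg0: "f m \<ge> 0" "g m \<ge> 0" for m using K(1) by (simp_all add: f_def g_def)
  note swap = suminf_swap[of "\<lambda>m n. a m n - b m n", OF bound fg(1) fg0(1) fg(2) fg0(2)]
  define L where "L = (\<Sum>m. \<Sum>n. a m n - b m n)"
  have row: "(\<Sum>n. a m n - b m n) = s (M m * \<tau>) - 1 / (M m * \<tau>)\<^sup>2 + F m 0" for m
    using sums_unique[OF sums_diff[OF a_row[of m] b_row[of m]]] by simp
  have col: "(\<Sum>m. a m n - b m n) = s (M n * (- 1 / \<tau>)) / \<tau>\<^sup>2 - 1 / (M n)\<^sup>2 - (C (Suc n) - C n)" for n
    using sums_unique[OF sums_diff[OF a_col[of n] b_col[of n]]] by simp
  have L1: "(\<lambda>m. s (M m * \<tau>) - 1 / (M m * \<tau>)\<^sup>2 + F m 0) sums L"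
    using summable_sums[OF swap(1)] unfolding row L_def by simp
  have L2: "(\<lambda>n. s (M n * (- 1 / \<tau>)) / \<tau>\<^sup>2 - 1 / (M n)\<^sup>2 - (C (Suc n) - C n)) sums L"
  proof -
    have "(\<lambda>n. \<Sum>m. a m n - b m n) sums L"
      using summable_sums[OF swap(2)] by (simp only: L_def swap(3))
    then show ?thesis by (simp only: col)
  qed
  have B: "(\<lambda>n. 1 / (M n)\<^sup>2) sums (of_real pi ^ 2 / 6)" unfolding M_def by (rule basel_complex)
  have B': "(\<lambda>n. 1 / (M n * \<tau>)\<^sup>2) sums (of_real pi ^ 2 / 6 / \<tau>\<^sup>2)"
    using sums_divide[OF B, of "\<tau>\<^sup>2"] by (simp add: power_mult_distrib)
  have S1: "(\<lambda>m. s (M m * \<tau>)) sums (L + of_real pi ^ 2 / 6 / \<tau>\<^sup>2 - C 0)"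
    using sums_diff[OF sums_add[OF L1 B'] F_col[of 0]] by simp
  have S2': "(\<lambda>n. s (M n * (- 1 / \<tau>)) / \<tau>\<^sup>2) sums (L + of_real pi ^ 2 / 6 + (- (of_real pi * \<i> / \<tau>) - C 0))"
    using sums_add[OF sums_add[OF L2 B] b_tot] by simp
  have S2: "(\<lambda>n. s (M n * (- 1 / \<tau>))) sums (\<tau>\<^sup>2 * (L + of_real pi ^ 2 / 6 + (- (of_real pi * \<i> / \<tau>) - C 0)))"
    using sums_mult[OF S2', of "\<tau>\<^sup>2"] \<tau>0 by simp
  have G: "eisenstein_G2 z = of_real pi ^ 2 / 3 + 2 * (\<Sum>m. s (M m * z))" for z
    by (simp add: eisenstein_G2_def s_def M_def)
  show "summable (\<lambda>m. of_real pi ^ 2 / sin (of_real pi * (of_nat (Suc m) * \<tau>)) ^ 2)"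
    using S1 by (simp add: sums_iff s_def M_def)
  have alg: "(P / 3 + 2 * (t * (L + P / 6 + (- v - c)))) / t = P / 3 + 2 * (L + P / 6 / t - c) - 2 * v"
    if "t \<noteq> 0" for P t v c :: complex
  proof -
    have "(P / 3 + 2 * (t * (L + P / 6 + (- v - c)))) / t = P / 3 / t + 2 * (L + P / 6 + (- v - c))"
      using that by (simp add: add_divide_distrib)
    then show ?thesis by simp
  qed
  have "\<tau>\<^sup>2 \<noteq> 0" using \<tau>0 by simp
  from alg[OF this, of "of_real pi ^ 2" "of_real pi * \<i> / \<tau>" "C 0"]
  show "eisenstein_G2 (- 1 / \<tau>) / \<tau>\<^sup>2 = eisenstein_G2 \<tau> - 2 * of_real pi * \<i> / \<tau>"
    unfolding G sums_unique[OF S1, symmetric] sums_unique[OF S2, symmetric] by (simp only: mult.assoc times_divide_eq_right)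
qed

section \<open>The logarithmic derivative of eta and the inversion formula\<close>

lemma dedekind_eta_eq: "dedekind_eta \<tau> = exp (2 * of_real pi * \<i> * \<tau> / 24) * euler_phi (exp (2 * of_real pi * \<i> * \<tau>))"
proof -
  have "exp (2 * of_real pi * \<i> * of_nat (Suc n) * \<tau>) = exp (2 * of_real pi * \<i> * \<tau>) ^ Suc n" for n
    by (subst exp_of_nat_mult[symmetric]) (simp add: mult_ac)
  then show ?thesis by (simp only: dedekind_eta_def euler_phi_def)
qed

lemma norm_exp_nome: "Im \<tau> > 0 \<Longrightarrow> norm (exp (2 * of_real pi * \<i> * \<tau>)) < 1"
  by simp

lemma dedekind_eta_nonzero: "Im \<tau> > 0 \<Longrightarrow> dedekind_eta \<tau> \<noteq> 0"
  unfolding dedekind_eta_eq using euler_phi_nonzero[OF norm_exp_nome] by simp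

text \<open>With u the square root exp (pi i z) of the nome, the left side is the inverse square of
  u - 1/u = 2i sin (pi z). This links the Lambert series to the terms of
  \<open>eisenstein_G2\<close>.\<close>

lemma nome_quotient_eq_sin:
  fixes z :: complex
  shows "exp (2 * of_real pi * \<i> * z) / (1 - exp (2 * of_real pi * \<i> * z))\<^sup>2 = - 1 / (4 * sin (of_real pi * z) ^ 2)"
proof -
  define u where "u = exp (\<i> * (of_real pi * z))"
  have u: "u \<noteq> 0" by (simp add: u_def)
  have e: "exp (2 * of_real pi * \<i> * z) = u * u"
    by (simp add: u_def exp_add[symmetric] algebra_simps)
  have s: "sin (of_real pi * z) = (u - 1 / u) / (2 * \<i>)"
    by (simp add: sin_exp_eq u_def exp_minus inverse_eq_divide)
  have "4 * sin (of_real pi * z) ^ 2 = - ((u * u - 1)\<^sup>2 / (u * u))"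
    unfolding s using u by (simp add: power2_eq_square field_simps)
  then show ?thesis unfolding e by (simp add: power2_commute[of 1])
qed

text \<open>The logarithmic derivative is 2 pi i (1/24 - S) with the Lambert series S. Rewriting S
  by sines turns the exponent 1/24 into the constant term pi^2/3 of
  \<open>eisenstein_G2\<close>.\<close>

lemma has_field_derivative_dedekind_eta:
  assumes \<tau>: "Im \<tau> > 0"
  shows "(dedekind_eta has_field_derivative
            dedekind_eta \<tau> * (\<i> / (4 * of_real pi) * eisenstein_G2 \<tau>)) (at \<tau>)"
proof -
  define e where "e = (\<lambda>\<tau>::complex. exp (2 * of_real pi * \<i> * \<tau>))"
  define S where "S = (\<Sum>m. e \<tau> ^ Suc m / (1 - e \<tau> ^ Suc m)\<^sup>2)"
  have q: "norm (e \<tau>) < 1" "e \<tau> \<noteq> 0" using norm_exp_nome[OF \<tau>] by (simp_all add: e_def)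
  have de: "(e has_field_derivative 2 * of_real pi * \<i> * e \<tau>) (at \<tau>)"
    unfolding e_def by (auto intro!: derivative_eq_intros)
  have "((\<lambda>\<tau>. euler_phi (e \<tau>)) has_field_derivative euler_phi (e \<tau>) * (- S / e \<tau>) * (2 * of_real pi * \<i> * e \<tau>)) (at \<tau>)"
    unfolding S_def by (rule DERIV_chain2[OF has_field_derivative_euler_phi[OF q] de])
  then have "((\<lambda>\<tau>. exp (2 * of_real pi * \<i> * \<tau> / 24) * euler_phi (e \<tau>)) has_field_derivative
      exp (2 * of_real pi * \<i> * \<tau> / 24) * euler_phi (e \<tau>) * (2 * of_real pi * \<i> * (1 / 24 - S))) (at \<tau>)"
    using q(2) by (auto intro!: derivative_eq_intros simp: algebra_simps)
  moreover have "2 * of_real pi * \<i> * (1 / 24 - S) = \<i> / (4 * of_real pi) * eisenstein_G2 \<tau>"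
  proof -
    define R where "R = (\<Sum>m. of_real pi ^ 2 / sin (of_real pi * (of_nat (Suc m) * \<tau>)) ^ 2)"
    have t: "e \<tau> ^ Suc m / (1 - e \<tau> ^ Suc m)\<^sup>2
        = (- 1 / (4 * of_real pi ^ 2)) * (of_real pi ^ 2 / sin (of_real pi * (of_nat (Suc m) * \<tau>)) ^ 2)" for m
    proof -
      have "e \<tau> ^ Suc m = exp (2 * of_real pi * \<i> * (of_nat (Suc m) * \<tau>))"
        unfolding e_def by (subst exp_of_nat_mult[symmetric]) (simp add: mult_ac)
      then show ?thesis using nome_quotient_eq_sin[of "of_nat (Suc m) * \<tau>"] by (simp del: of_nat_Suc)
    qed
    have S: "S = (- 1 / (4 * of_real pi ^ 2)) * R"
      unfolding S_def R_def t by (rule suminf_mult[OF eisenstein_G2_inversion(1)[OF \<tau>]])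
    show ?thesis unfolding eisenstein_G2_def R_def[symmetric] S
      by (simp add: field_simps power2_eq_square)
  qed
  moreover have "dedekind_eta = (\<lambda>\<tau>. exp (2 * of_real pi * \<i> * \<tau> / 24) * euler_phi (e \<tau>))"
    by (simp add: fun_eq_iff dedekind_eta_eq e_def)
  ultimately have "(dedekind_eta has_field_derivative exp (2 * of_real pi * \<i> * \<tau> / 24) * euler_phi (e \<tau>)
      * (\<i> / (4 * of_real pi) * eisenstein_G2 \<tau>)) (at \<tau>)" by (simp only:)
  then show ?thesis by (simp only: dedekind_eta_eq[of \<tau>] e_def)
qed

text \<open>The quotient of the two sides has derivative 0, because the anomaly -2 pi i/\<tau> times
  i/(4 pi) is 1/(2\<tau>), the logarithmic derivative of the square root. Its constant value is 1,
  as seen at the fixed point i, where the root is that of 1.\<close>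

theorem dedekind_eta_inversion:
  assumes \<tau>: "Im \<tau> > 0"
  shows "dedekind_eta (- 1 / \<tau>) = csqrt (- \<i> * \<tau>) * dedekind_eta \<tau>"
proof -
  define K where "K = (\<lambda>\<tau>. dedekind_eta (- 1 / \<tau>) / (csqrt (- \<i> * \<tau>) * dedekind_eta \<tau>))"
  let ?H = "{\<tau>. Im \<tau> > 0}"
  have "(K has_field_derivative 0) (at \<tau> within ?H)" if \<tau>: "\<tau> \<in> ?H" for \<tau>
  proof -
    have \<tau>0: "\<tau> \<noteq> 0" "Im \<tau> > 0" using \<tau> by auto
    have im: "Im (- 1 / \<tau>) > 0" using \<tau>0 Im_complex_div_lt_0[of 1 \<tau>] by simp
    define a where "a = \<i> / (4 * of_real pi) * eisenstein_G2 (- 1 / \<tau>) / \<tau>\<^sup>2"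
    define b where "b = \<i> / (4 * of_real pi) * eisenstein_G2 \<tau>"
    have inner: "((\<lambda>\<tau>. - 1 / \<tau>) has_field_derivative 1 / \<tau>\<^sup>2) (at \<tau>)"
      using \<tau>0 by (auto intro!: derivative_eq_intros simp: power2_eq_square)
    have d1: "((\<lambda>\<tau>. dedekind_eta (- 1 / \<tau>)) has_field_derivative dedekind_eta (- 1 / \<tau>) * a) (at \<tau>)"
      using DERIV_chain2[OF has_field_derivative_dedekind_eta[OF im] inner] by (simp add: a_def)
    have d2: "(dedekind_eta has_field_derivative dedekind_eta \<tau> * b) (at \<tau>)"
      using has_field_derivative_dedekind_eta[OF \<tau>0(2)] by (simp add: b_def)
    have "Re (- \<i> * \<tau>) > 0" using \<tau>0 by simp
    then have nr: "- \<i> * \<tau> \<notin> \<real>\<^sub>\<le>\<^sub>0" by (auto simp: complex_nonpos_Reals_iff)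
    have c0: "csqrt (- \<i> * \<tau>) \<noteq> 0" using \<tau>0 by simp
    have csq: "csqrt (- \<i> * \<tau>) * csqrt (- \<i> * \<tau>) = - \<i> * \<tau>"
      using power2_csqrt[of "- \<i> * \<tau>"] by (simp only: power2_eq_square)
    have "((\<lambda>\<tau>. csqrt (- \<i> * \<tau>)) has_field_derivative inverse (2 * csqrt (- \<i> * \<tau>)) * - \<i>) (at \<tau>)"
    proof (rule DERIV_chain2[where f = csqrt and g = "\<lambda>x. - \<i> * x"])
      show "(csqrt has_field_derivative inverse (2 * csqrt (- \<i> * \<tau>))) (at (- \<i> * \<tau>))"
        by (rule has_field_derivative_csqrt[OF nr])
      show "((\<lambda>x. - \<i> * x) has_field_derivative - \<i>) (at \<tau>)"
        by (auto intro!: derivative_eq_intros)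
    qed
    moreover have "inverse (2 * csqrt (- \<i> * \<tau>)) * - \<i> = csqrt (- \<i> * \<tau>) * (1 / (2 * \<tau>))"
    proof -
      have "inverse (2 * s) * - \<i> = s * (1 / (2 * \<tau>))" if "s * s = - \<i> * \<tau>" "s \<noteq> 0" for s
        using that \<tau>0 by (simp add: field_simps)
      from this[OF csq c0] show ?thesis .
    qed
    ultimately have d3: "((\<lambda>\<tau>. csqrt (- \<i> * \<tau>)) has_field_derivative csqrt (- \<i> * \<tau>) * (1 / (2 * \<tau>))) (at \<tau>)"
      by (simp only:)
    have e0: "dedekind_eta \<tau> \<noteq> 0" using \<tau>0 by (intro dedekind_eta_nonzero)
    have "(K has_field_derivative
       (dedekind_eta (- 1 / \<tau>) * a * (csqrt (- \<i> * \<tau>) * dedekind_eta \<tau>) -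
        dedekind_eta (- 1 / \<tau>) * (csqrt (- \<i> * \<tau>) * (1 / (2 * \<tau>)) * dedekind_eta \<tau> + dedekind_eta \<tau> * b * csqrt (- \<i> * \<tau>)))
        / ((csqrt (- \<i> * \<tau>) * dedekind_eta \<tau>) * (csqrt (- \<i> * \<tau>) * dedekind_eta \<tau>))) (at \<tau>)"
      unfolding K_def by (intro DERIV_divide DERIV_mult d1 d2 d3) (use c0 e0 in simp)
    moreover have "a = 1 / (2 * \<tau>) + b"
    proof -
      have "a = \<i> / (4 * of_real pi) * (eisenstein_G2 (- 1 / \<tau>) / \<tau>\<^sup>2)" by (simp add: a_def)
      also have "\<dots> = \<i> / (4 * of_real pi) * (eisenstein_G2 \<tau> - 2 * of_real pi * \<i> / \<tau>)"
        by (simp only: eisenstein_G2_inversion(2)[OF \<tau>0(2)])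
      also have "\<dots> = 1 / (2 * \<tau>) + b" using \<tau>0 by (simp add: b_def field_simps)
      finally show ?thesis .
    qed
    ultimately have "(K has_field_derivative 0) (at \<tau>)" by (simp add: algebra_simps)
    then show ?thesis by (rule has_field_derivative_at_within)
  qed
  then obtain c where c: "\<And>\<tau>. \<tau> \<in> ?H \<Longrightarrow> K \<tau> = c"
    using has_field_derivative_zero_constant[of ?H K] convex_halfspace_Im_gt[of 0] by blast
  have "K \<i> = 1" using dedekind_eta_nonzero[of \<i>] by (simp add: K_def)
  then have "K \<tau> = 1" using c[of \<i>] c[of \<tau>] \<tau> by simp
  then show ?thesis by (simp add: K_def divide_eq_1_iff)
qed

lemma dedekind_eta_plus_int: "dedekind_eta (\<tau> + of_int j) = exp (2 * of_real pi * \<i> * of_int j / 24) * dedekind_eta \<tau>"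
proof -
  have "exp (2 * of_real pi * \<i> * (\<tau> + of_int j)) = exp (2 * of_real pi * \<i> * \<tau>)"
    using exp_plus_2pin[of "2 * of_real pi * \<i> * \<tau>" j] by (simp add: algebra_simps)
  moreover have "exp (2 * of_real pi * \<i> * (\<tau> + of_int j) / 24)
      = exp (2 * of_real pi * \<i> * of_int j / 24) * exp (2 * of_real pi * \<i> * \<tau> / 24)"
    by (simp add: exp_add[symmetric] algebra_simps add_divide_distrib)
  ultimately show ?thesis by (simp add: dedekind_eta_eq)
qed

section \<open>The eta multiplier\<close>

definition root24 :: "int \<Rightarrow> complex" where
  "root24 k = exp (2 * of_real pi * \<i> * of_int k / 24)"

lemma root24_add: "root24 (j + k) = root24 j * root24 k"
  by (simp add: root24_def exp_add[symmetric] algebra_simps add_divide_distrib)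

lemma root24_0 [simp]: "root24 0 = 1"
  by (simp add: root24_def)

lemma root24_nonzero [simp]: "root24 k \<noteq> 0"
  by (simp add: root24_def)

lemma root24_eq_1_iff: "root24 k = 1 \<longleftrightarrow> 24 dvd k"
proof -
  have "root24 k = 1 \<longleftrightarrow> (\<exists>n :: int. 2 * of_real pi * \<i> * of_int k / 24 = of_int (2 * n) * of_real pi * \<i>)"
    unfolding root24_def exp_eq_1 by (auto simp: complex_eq_iff)
  also have "\<dots> \<longleftrightarrow> (\<exists>n :: int. (of_int k :: complex) = of_int (24 * n))"
    by (intro ex_cong1) (auto simp: field_simps)
  also have "\<dots> \<longleftrightarrow> 24 dvd k" by (simp only: of_int_eq_iff dvd_def)
  finally show ?thesis .
qed

lemma root24_cong: "[j = k] (mod 24) \<Longrightarrow> root24 j = root24 k"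
  using root24_add[of "j - k" k] root24_eq_1_iff[of "j - k"] by (simp add: cong_iff_dvd_diff)

lemma root24_power_int: "root24 k powi n = root24 (k * n)"
  by (simp add: root24_def exp_power_int mult_ac)

lemma root24_12_mult: "root24 (12 * k) = (if even k then 1 else -1)"
proof (cases "even k")
  case True
  then have "24 dvd 12 * k" by auto
  then show ?thesis using True root24_eq_1_iff by simp
next
  case False
  then obtain m where "k = 2 * m + 1" by (auto elim!: oddE)
  then have "[12 * k = 12] (mod 24)" by (simp add: cong_iff_dvd_diff)
  then have "root24 (12 * k) = root24 12" by (rule root24_cong)
  also have "\<dots> = -1" by (simp add: root24_def)
  finally show ?thesis using False by simp
qed

lemma dedekind_eta_plus_int': "dedekind_eta (\<tau> + of_int j) = root24 j * dedekind_eta \<tau>"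
  by (simp add: dedekind_eta_plus_int root24_def)

text \<open>The classical exponent of the eta multiplier for even c, in units of 1/24 of a full
  turn. Together with the symbol (c/d) it remains correct for every odd d.\<close>

definition eta_exponent :: "int \<Rightarrow> int \<Rightarrow> int \<Rightarrow> int \<Rightarrow> int" where
  "eta_exponent a b c d = (a + d) * c - b * d * (c\<^sup>2 - 1) + 3 * d - 3 - 3 * c * d"

lemma six_dvd_cube_minus: "6 dvd c * (c\<^sup>2 - 1)" for c :: int
proof -
  have e: "c * (c\<^sup>2 - 1) = (c - 1) * c * (c + 1)" by (simp add: power2_eq_square algebra_simps)
  have "2 dvd (c - 1) * c * (c + 1)" by simp
  moreover have "3 dvd (c - 1) * c * (c + 1)"
  proof -
    have "3 dvd c - 1 \<or> 3 dvd c \<or> 3 dvd c + 1" by presburger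
    then show ?thesis by auto
  qed
  ultimately have "2 * 3 dvd (c - 1) * c * (c + 1)" by (intro divides_mult) auto
  then show ?thesis by (simp add: e)
qed

lemma eight_dvd_one_minus_square:
  fixes d :: int
  assumes "odd d"
  shows "8 dvd 1 - d\<^sup>2"
proof -
  obtain k where k: "d = 2 * k + 1" using assms by (auto elim!: oddE)
  have "even (k * (k + 1))" by simp
  then obtain m where m: "k * (k + 1) = 2 * m" by (rule evenE)
  have "1 - d\<^sup>2 = - 4 * (k * (k + 1))" by (simp add: k power2_eq_square algebra_simps)
  then have "1 - d\<^sup>2 = 8 * (- m)" unfolding m by simp
  then show ?thesis by (rule dvdI)
qed

text \<open>The matrix is multiplied on the right by (1, 2; 0, 1). The summand 2 reflects eta
  (\<tau> + 2), and 6c(1 - c) is a multiple of 12, hence a sign: that of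
  \<open>kronecker_shift_right\<close>. The error is a multiple of 4 c (c^2 - 1), thus of
  24.\<close>

lemma eta_exponent_shift_right:
  assumes "a * d - b * c = 1"
  shows "[eta_exponent a (b + 2 * a) c (d + 2 * c) = eta_exponent a b c d + 2 + 6 * (c * (1 - c))] (mod 24)"
proof -
  have "(b + 2 * a) * (d + 2 * c) = b * d + 2 * (a * d - b * c) + 4 * c * (a + b)"
    by (simp add: algebra_simps)
  then have B: "(b + 2 * a) * (d + 2 * c) = b * d + 2 + 4 * c * (a + b)" using assms by simp
  have "eta_exponent a (b + 2 * a) c (d + 2 * c) - (eta_exponent a b c d + 2 + 6 * (c * (1 - c)))
      = - (4 * (a + b) * (c * (c\<^sup>2 - 1)))"
    unfolding eta_exponent_def B by (simp add: power2_eq_square algebra_simps)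
  moreover have "4 * 6 dvd 4 * (a + b) * (c * (c\<^sup>2 - 1))"
    using six_dvd_cube_minus[of c] by (intro mult_dvd_mono) auto
  ultimately show ?thesis unfolding cong_iff_dvd_diff by (simp only: dvd_minus_iff) simp
qed

text \<open>Multiplication on the right by (1, 0; 1, 1). The error factors as (1 - d^2)(2bc + bd +
  2). Odd d gives divisibility by 8. At 3 the first factor suffices unless 3 divides d, and then the
  determinant makes the second factor equal to d (2a + b).\<close>

lemma eta_exponent_shift_left:
  assumes "a * d - b * c = 1" "odd d"
  shows "[eta_exponent (a + b) b (c + d) d = eta_exponent a b c d - 1] (mod 24)"
proof -
  have ad: "a * d = 1 + b * c" using assms by simp
  have "eta_exponent (a + b) b (c + d) d - (eta_exponent a b c d - 1)
      = (a * d) + b * c + b * d - 2 * b * c * d\<^sup>2 - b * d * d\<^sup>2 - 2 * d\<^sup>2 + 1"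
    by (simp add: eta_exponent_def power2_eq_square algebra_simps)
  also have "\<dots> = (1 - d\<^sup>2) * (2 * b * c + b * d + 2)"
    unfolding ad by (simp add: algebra_simps)
  finally have e: "eta_exponent (a + b) b (c + d) d - (eta_exponent a b c d - 1)
      = (1 - d\<^sup>2) * (2 * b * c + b * d + 2)" .
  have "8 dvd (1 - d\<^sup>2) * (2 * b * c + b * d + 2)"
    using eight_dvd_one_minus_square[OF assms(2)] by (rule dvd_mult2)
  moreover have "3 dvd (1 - d\<^sup>2) * (2 * b * c + b * d + 2)"
  proof (cases "3 dvd d")
    case True
    have "2 * b * c + b * d + 2 = 2 * (1 + b * c) + b * d" by (simp add: algebra_simps)
    also have "\<dots> = d * (2 * a + b)" using ad by (simp add: algebra_simps)
    finally show ?thesis using True by simp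
  next
    case False
    then have "3 dvd 1 - d \<or> 3 dvd 1 + d" by presburger
    moreover have "1 - d\<^sup>2 = (1 - d) * (1 + d)" by (simp add: power2_eq_square algebra_simps)
    ultimately show ?thesis by auto
  qed
  moreover have "24 dvd X" if "8 dvd X" "3 dvd X" for X :: int using that by presburger
  ultimately show ?thesis unfolding cong_iff_dvd_diff e by blast
qed

section \<open>Branches of the square root and the lower triangular generator\<close>

lemma csqrt_upper: "Im z > 0 \<Longrightarrow> Re (csqrt z) > 0 \<and> Im (csqrt z) > 0"
proof -
  assume z: "Im z > 0"
  have "2 * Re (csqrt z) * Im (csqrt z) = Im z"
    using power2_csqrt[of z] by (metis Im_power2)
  moreover have "Re (csqrt z) \<ge> 0" by (rule Re_csqrt)
  moreover have "R > 0 \<and> I > 0" if "2 * R * I > 0" "R \<ge> 0" for R I :: real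
    using that by (auto simp: zero_less_mult_iff)
  ultimately show ?thesis using z by metis
qed

lemma csqrt_lower: "Im z < 0 \<Longrightarrow> Re (csqrt z) > 0 \<and> Im (csqrt z) < 0"
proof -
  assume z: "Im z < 0"
  have "2 * Re (csqrt z) * Im (csqrt z) = Im z"
    using power2_csqrt[of z] by (metis Im_power2)
  moreover have "Re (csqrt z) \<ge> 0" by (rule Re_csqrt)
  moreover have "R > 0 \<and> I < 0" if "2 * R * I < 0" "R \<ge> 0" for R I :: real
    using that by (auto simp: mult_less_0_iff)
  ultimately show ?thesis using z by metis
qed

lemma csqrt_mult_pm: "csqrt x * csqrt y = csqrt (x * y) \<or> csqrt x * csqrt y = - csqrt (x * y)"
proof -
  have "(csqrt x * csqrt y)\<^sup>2 = (csqrt (x * y))\<^sup>2" by (simp add: power_mult_distrib)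
  then show ?thesis by (simp only: power2_eq_iff)
qed

text \<open>The sign is that of the cocycle \<open>\<sigma>\<close> at the lower triangular generator, and it matches the sign
  change of the Kronecker symbol in \<open>kronecker_shift_left\<close>.\<close>
lemma csqrt_cocycle_lower:
  fixes c d :: int
  assumes \<tau>: "Im \<tau> > 0" and d: "d \<noteq> 0"
  shows "csqrt (of_int c * (\<tau> / (\<tau> + 1)) + of_int d) * csqrt (\<tau> + 1)
    = (if d < 0 \<and> (c < 0) \<noteq> (c + d < 0) then -1 else 1) * csqrt (of_int (c + d) * \<tau> + of_int d)"
proof -
  note csqrt.sel [simp del]
  define x where "x = of_int c * (\<tau> / (\<tau> + 1)) + of_int d"
  define y where "y = \<tau> + 1"
  have y0: "y \<noteq> 0" and Imy: "Im y > 0" using \<tau> by (auto simp: y_def complex_eq_iff)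
  have xy: "x * y = of_int (c + d) * \<tau> + of_int d"
    using y0 by (simp add: x_def y_def field_simps)
  have "Im (\<tau> / y) = Im \<tau> / ((Re y)\<^sup>2 + (Im y)\<^sup>2)"
    unfolding Im_divide by (simp add: y_def algebra_simps)
  moreover have "(Re y)\<^sup>2 + (Im y)\<^sup>2 > 0" using Imy by (simp add: sum_power2_gt_zero_iff)
  ultimately have Imp: "Im (\<tau> / y) > 0" using \<tau> by simp
  have Imx: "Im x = of_int c * Im (\<tau> / y)"
  proof -
    have "x = of_real (of_int c) * (\<tau> / y) + of_real (of_int d)" by (simp add: x_def y_def)
    then show ?thesis by (simp only: plus_complex.sel Im_of_real_mult Im_complex_of_real add_0_right)
  qed
  have Imxy: "Im (x * y) = of_int (c + d) * Im \<tau>" unfolding xy by simp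
  note Y = csqrt_upper[OF Imy]
  have "csqrt x * csqrt y = (if d < 0 \<and> (c < 0) \<noteq> (c + d < 0) then -1 else 1) * csqrt (x * y)"
  proof (cases "c < 0")
    case True
    then have "Im x < 0" using Imp by (simp add: Imx mult_less_0_iff)
    note cx = csqrt_lower[OF this]
    \<comment> \<open>The roots lie in opposite open right quadrants, so their product is the
      principal root. No sign is predicted for c < 0, since then d < 0 implies c + d < 0.\<close>
    have "Re (csqrt x * csqrt y) > 0"
    proof -
      have "Im (csqrt x) * Im (csqrt y) < 0" "Re (csqrt x) * Re (csqrt y) > 0"
        using cx Y by (auto simp: mult_neg_pos)
      then show ?thesis by simp
    qed
    then have "csqrt x * csqrt y \<noteq> - csqrt (x * y)"
      using Re_csqrt[of "x * y"] by (metis neg_0_less_iff_less not_less uminus_complex.sel(1))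
    then show ?thesis using True csqrt_mult_pm[of x y] by auto
  next
    case c: False
    have cx: "Re (csqrt x) > 0 \<and> Im (csqrt x) \<ge> 0 \<or> Re (csqrt x) = 0 \<and> Im (csqrt x) > 0"
    proof (cases "c = 0")
      case True
      then have "x = of_real (of_int d)" by (simp add: x_def)
      then show ?thesis using d by (cases "d > 0") (auto simp: csqrt_of_real')
    next
      case False
      then have "Im x > 0" using c Imp by (simp add: Imx)
      then show ?thesis using csqrt_upper[of x] by simp
    qed
    \<comment> \<open>For c >= 0 the product of the roots lies in the open upper half-plane, so it
      suffices to find in which half-plane the principal root of x y lies. This is decided by c + d,
      and for c + d = 0 by d < 0.\<close>
    then have Im1: "Im (csqrt x * csqrt y) > 0"
      using Y by (auto simp: add_pos_nonneg add_pos_pos)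
    consider "c + d > 0" | "c + d = 0" | "c + d < 0" by linarith
    then show ?thesis
    proof cases
      case 1
      then have "of_int (c + d) * Im \<tau> > 0" using \<tau> by (intro mult_pos_pos) auto
      then have "Im (csqrt (x * y)) > 0" using csqrt_upper[of "x * y"] Imxy by simp
      then have "csqrt x * csqrt y \<noteq> - csqrt (x * y)"
        using Im1 by (metis less_asym neg_0_less_iff_less uminus_complex.sel(2))
      then show ?thesis using 1 c csqrt_mult_pm[of x y] by auto
    next
      case 2
      then have "d < 0" using c d by auto
      then have "Im (csqrt (x * y)) > 0" unfolding xy 2 using csqrt_of_real'[of "of_int d"] by simp
      then have "csqrt x * csqrt y \<noteq> - csqrt (x * y)"
        using Im1 by (metis less_asym neg_0_less_iff_less uminus_complex.sel(2))
      then show ?thesis using 2 c csqrt_mult_pm[of x y] by auto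
    next
      case 3
      then have "of_int (c + d) * Im \<tau> < 0" using \<tau> by (intro mult_neg_pos) auto
      then have "Im (csqrt (x * y)) < 0" using csqrt_lower[of "x * y"] Imxy by simp
      then have "csqrt x * csqrt y \<noteq> csqrt (x * y)" using Im1 by (metis less_asym)
      moreover have "d < 0" using 3 c by auto
      ultimately show ?thesis using 3 c csqrt_mult_pm[of x y] by auto
    qed
  qed
  then show ?thesis unfolding xy unfolding x_def y_def .
qed

text \<open>Up to sign (1, 0; 1, 1) is inversion, then translation by -1, then inversion. Both
  square roots that arise have arguments in the open right half-plane, so they multiply without a
  sign.\<close>

lemma dedekind_eta_lower:
  assumes \<tau>: "Im \<tau> > 0"
  shows "dedekind_eta (\<tau> / (\<tau> + 1)) = root24 (-1) * csqrt (\<tau> + 1) * dedekind_eta \<tau>"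
proof -
  have \<tau>0: "\<tau> \<noteq> 0" "\<tau> + 1 \<noteq> 0" using \<tau> by (auto simp: complex_eq_iff)
  define w where "w = - 1 / \<tau> + of_int (-1)"
  have im: "Im (- 1 / \<tau>) > 0" using \<tau> Im_complex_div_lt_0[of 1 \<tau>] by simp
  then have Imw: "Im w > 0" by (simp add: w_def)
  have w: "w = - ((\<tau> + 1) / \<tau>)" using \<tau>0 by (simp add: w_def field_simps)
  have "- 1 / w = \<tau> / (\<tau> + 1)" using \<tau>0 by (simp add: w)
  then have "dedekind_eta (\<tau> / (\<tau> + 1)) = csqrt (- \<i> * w) * dedekind_eta w"
    using dedekind_eta_inversion[OF Imw] by simp
  also have "dedekind_eta w = root24 (-1) * dedekind_eta (- 1 / \<tau>)"
    unfolding w_def by (rule dedekind_eta_plus_int')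
  also have "dedekind_eta (- 1 / \<tau>) = csqrt (- \<i> * \<tau>) * dedekind_eta \<tau>"
    by (rule dedekind_eta_inversion[OF \<tau>])
  also have "csqrt (- \<i> * w) * (root24 (-1) * (csqrt (- \<i> * \<tau>) * dedekind_eta \<tau>))
     = root24 (-1) * (csqrt (- \<i> * w) * csqrt (- \<i> * \<tau>)) * dedekind_eta \<tau>" by simp
  also have "csqrt (- \<i> * w) * csqrt (- \<i> * \<tau>) = csqrt (\<tau> + 1)"
  proof -
    have e: "(- \<i> * w) * (- \<i> * \<tau>) = \<tau> + 1" using \<tau>0 by (simp add: w field_simps)
    have "Re (- \<i> * w) > 0" "Re (- \<i> * \<tau>) > 0" using Imw \<tau> by simp_all
    then have a: "\<bar>Arg (- \<i> * w)\<bar> < pi / 2" "\<bar>Arg (- \<i> * \<tau>)\<bar> < pi / 2"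
      by (simp_all only: Arg_Re_pos simp_thms)
    show ?thesis unfolding e[symmetric] using a by (subst csqrt_mult) auto
  qed
  finally show ?thesis .
qed

section \<open>The multiplier formula by descent on the lower row\<close>

definition eta_law :: "int \<Rightarrow> int \<Rightarrow> int \<Rightarrow> int \<Rightarrow> bool" where
  "eta_law a b c d \<longleftrightarrow> (\<forall>\<tau>. Im \<tau> > 0 \<longrightarrow>
     dedekind_eta ((of_int a * \<tau> + of_int b) / (of_int c * \<tau> + of_int d))
       = of_int (kronecker c d) * root24 (eta_exponent a b c d) * csqrt (of_int c * \<tau> + of_int d) * dedekind_eta \<tau>)"

text \<open>The law for the new matrix at \<tau> is the law for the old one at \<tau>/(\<tau> + 1).
  An equivalence is needed because the descent uses both c + d and c - d.\<close>

lemma eta_law_lower_iff: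
  assumes det: "a * d - b * c = 1" and d: "odd d"
  shows "eta_law (a + b) b (c + d) d \<longleftrightarrow> eta_law a b c d"
proof -
  let ?P = "\<lambda>a b c d \<tau>. dedekind_eta ((of_int a * \<tau> + of_int b) / (of_int c * \<tau> + of_int d))
       = of_int (kronecker c d) * root24 (eta_exponent a b c d) * csqrt (of_int c * \<tau> + of_int d) * dedekind_eta \<tau>"
  have d0: "d \<noteq> 0" using d by auto
  define s where "s = (if d < 0 \<and> (c < 0) \<noteq> (c + d < 0) then -1 else 1 :: int)"
  have k: "kronecker (c + d) d = kronecker c d * s"
    unfolding s_def by (rule kronecker_shift_left[OF d])
  have r: "root24 (eta_exponent (a + b) b (c + d) d) = root24 (eta_exponent a b c d) * root24 (-1)"
    using root24_cong[OF eta_exponent_shift_left[OF det d]] root24_add[of "eta_exponent a b c d" "-1"] by simp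
  have step: "?P (a + b) b (c + d) d \<tau> \<longleftrightarrow> ?P a b c d (\<tau> / (\<tau> + 1))" if \<tau>: "Im \<tau> > 0" for \<tau>
  proof -
    have \<tau>1: "\<tau> + 1 \<noteq> 0" using \<tau> by (auto simp: complex_eq_iff)
    have cs: "csqrt (of_int c * (\<tau> / (\<tau> + 1)) + of_int d) * csqrt (\<tau> + 1) = of_int s * csqrt (of_int (c + d) * \<tau> + of_int d)"
      using csqrt_cocycle_lower[OF \<tau> d0, of c] by (simp add: s_def)
    have "of_int a * (\<tau> / (\<tau> + 1)) + of_int b = (of_int (a + b) * \<tau> + of_int b) / (\<tau> + 1)"
      "of_int c * (\<tau> / (\<tau> + 1)) + of_int d = (of_int (c + d) * \<tau> + of_int d) / (\<tau> + 1)"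
      using \<tau>1 by (simp_all add: field_simps)
    then have arg: "(of_int a * (\<tau> / (\<tau> + 1)) + of_int b) / (of_int c * (\<tau> / (\<tau> + 1)) + of_int d)
        = (of_int (a + b) * \<tau> + of_int b) / (of_int (c + d) * \<tau> + of_int d)"
      using \<tau>1 by simp
    have "of_int (kronecker c d) * root24 (eta_exponent a b c d) * csqrt (of_int c * (\<tau> / (\<tau> + 1)) + of_int d) * dedekind_eta (\<tau> / (\<tau> + 1))
      = of_int (kronecker c d) * root24 (eta_exponent a b c d) * root24 (-1) *
          (csqrt (of_int c * (\<tau> / (\<tau> + 1)) + of_int d) * csqrt (\<tau> + 1)) * dedekind_eta \<tau>"
      unfolding dedekind_eta_lower[OF \<tau>] by (simp only: mult_ac)
    also have "\<dots> = of_int (kronecker (c + d) d) * root24 (eta_exponent (a + b) b (c + d) d) * csqrt (of_int (c + d) * \<tau> + of_int d) * dedekind_eta \<tau>"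
      unfolding cs k r by (simp only: of_int_mult mult_ac)
    finally show ?thesis unfolding arg by simp
  qed
  show ?thesis
  proof
    assume L: "eta_law (a + b) b (c + d) d"
    show "eta_law a b c d" unfolding eta_law_def
    proof (intro allI impI)
      fix \<tau> :: complex assume \<tau>: "Im \<tau> > 0"
      have \<tau>1: "1 - \<tau> \<noteq> 0" using \<tau> by (auto simp: complex_eq_iff)
      \<comment> \<open>The preimage of \<tau> under w -> w/(w + 1), again in the upper
        half-plane.\<close>
      define w where "w = \<tau> / (1 - \<tau>)"
      have "w + 1 = 1 / (1 - \<tau>)" using \<tau>1 by (simp add: w_def field_simps)
      then have w: "w / (w + 1) = \<tau>" using \<tau>1 by (simp add: w_def)
      have "Im w = Im \<tau> / ((Re (1 - \<tau>))\<^sup>2 + (Im (1 - \<tau>))\<^sup>2)"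
        unfolding w_def Im_divide by (simp add: algebra_simps)
      moreover have "(Re (1 - \<tau>))\<^sup>2 + (Im (1 - \<tau>))\<^sup>2 > 0" using \<tau> by (simp add: sum_power2_gt_zero_iff)
      ultimately have "Im w > 0" using \<tau> by simp
      then show "?P a b c d \<tau>" using L step[of w] unfolding w eta_law_def by blast
    qed
  next
    assume L: "eta_law a b c d"
    show "eta_law (a + b) b (c + d) d" unfolding eta_law_def
    proof (intro allI impI)
      fix \<tau> :: complex assume \<tau>: "Im \<tau> > 0"
      have "(Re (\<tau> + 1))\<^sup>2 + (Im (\<tau> + 1))\<^sup>2 > 0" using \<tau> by (simp add: sum_power2_gt_zero_iff)
      moreover have "Im (\<tau> / (\<tau> + 1)) = Im \<tau> / ((Re (\<tau> + 1))\<^sup>2 + (Im (\<tau> + 1))\<^sup>2)"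
        unfolding Im_divide by (simp add: algebra_simps)
      ultimately have "Im (\<tau> / (\<tau> + 1)) > 0" using \<tau> by simp
      then show "?P (a + b) b (c + d) d \<tau>" using L step[OF \<tau>] unfolding eta_law_def by blast
    qed
  qed
qed

lemma eta_law_translate_iff:
  assumes det: "a * d - b * c = 1" and d: "odd d"
  shows "eta_law a (b + 2 * a) c (d + 2 * c) \<longleftrightarrow> eta_law a b c d"
proof -
  let ?P = "\<lambda>a b c d \<tau>. dedekind_eta ((of_int a * \<tau> + of_int b) / (of_int c * \<tau> + of_int d))
       = of_int (kronecker c d) * root24 (eta_exponent a b c d) * csqrt (of_int c * \<tau> + of_int d) * dedekind_eta \<tau>"
  define s where "s = (if c mod 4 = 2 \<or> c mod 4 = 3 then -1 else 1 :: int)"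
  have k: "kronecker c (d + 2 * c) = kronecker c d * s"
    unfolding s_def by (rule kronecker_shift_right[OF d])
  \<comment> \<open>With c (1 - c) = 2m the exponent is 12m, and c mod 4 decides the parity of
    m.\<close>
  have s: "root24 (6 * (c * (1 - c))) = of_int s"
  proof -
    have "even (c * (1 - c))" by simp
    then obtain m where m: "c * (1 - c) = 2 * m" by (rule evenE)
    have "c mod 4 = 0 \<or> c mod 4 = 1 \<or> c mod 4 = 2 \<or> c mod 4 = 3" by presburger
    moreover have "(c * (1 - c)) mod 4 = ((c mod 4) * (1 - c mod 4)) mod 4"
      by (rule cong_mult[unfolded cong_def]) (simp_all add: mod_diff_right_eq)
    ultimately have "(2 * m) mod 4 = (if c mod 4 = 2 \<or> c mod 4 = 3 then 2 else 0)"
      unfolding m by auto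
    then have "even m \<longleftrightarrow> \<not> (c mod 4 = 2 \<or> c mod 4 = 3)" by presburger
    then show ?thesis using root24_12_mult[of m] by (simp add: m s_def)
  qed
  have r: "root24 (eta_exponent a (b + 2 * a) c (d + 2 * c)) = root24 (eta_exponent a b c d) * root24 2 * of_int s"
    unfolding root24_cong[OF eta_exponent_shift_right[OF det]] root24_add s ..
  have step: "?P a (b + 2 * a) c (d + 2 * c) \<tau> \<longleftrightarrow> ?P a b c d (\<tau> + 2)" for \<tau>
  proof -
    have arg: "of_int a * (\<tau> + 2) + of_int b = of_int a * \<tau> + of_int (b + 2 * a)"
      "of_int c * (\<tau> + 2) + of_int d = of_int c * \<tau> + of_int (d + 2 * c)"
      by (simp_all add: algebra_simps)
    have T: "dedekind_eta (\<tau> + 2) = root24 2 * dedekind_eta \<tau>"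
      using dedekind_eta_plus_int'[of \<tau> 2] by simp
    have s2: "of_int s * of_int s = (1 :: complex)" by (simp add: s_def)
    have "of_int (kronecker c (d + 2 * c)) * root24 (eta_exponent a (b + 2 * a) c (d + 2 * c)) * csqrt (of_int c * \<tau> + of_int (d + 2 * c)) * dedekind_eta \<tau>
      = (of_int s * of_int s) * (of_int (kronecker c d) * root24 (eta_exponent a b c d) * csqrt (of_int c * \<tau> + of_int (d + 2 * c)) * (root24 2 * dedekind_eta \<tau>))"
      unfolding k r by (simp only: of_int_mult mult_ac)
    then show ?thesis unfolding arg T s2 mult_1_left by (simp only:)
  qed
  show ?thesis
  proof
    assume L: "eta_law a (b + 2 * a) c (d + 2 * c)"
    show "eta_law a b c d" unfolding eta_law_def
    proof (intro allI impI)
      fix \<tau> :: complex assume "Im \<tau> > 0"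
      then have "Im (\<tau> - 2) > 0" by simp
      then show "?P a b c d \<tau>" using L step[of "\<tau> - 2"] unfolding eta_law_def by simp
    qed
  next
    assume L: "eta_law a b c d"
    show "eta_law a (b + 2 * a) c (d + 2 * c)" unfolding eta_law_def
    proof (intro allI impI)
      fix \<tau> :: complex assume "Im \<tau> > 0"
      then have "Im (\<tau> + 2) > 0" by simp
      then show "?P a (b + 2 * a) c (d + 2 * c) \<tau>" using L step[of \<tau>] unfolding eta_law_def by blast
    qed
  qed
qed

text \<open>For d = -1 the principal root of -1 is i, while 3d - 3 = -6 contributes
  \<open>root24 (-6) = - \<i>\<close>; these cancel, and (0/-1) = 1.\<close>

lemma eta_law_c_0:
  assumes "a * d = 1"
  shows "eta_law a b 0 d"
proof -
  have "d = 1 \<and> a = 1 \<or> d = -1 \<and> a = -1" using assms by (auto simp: zmult_eq_1_iff)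
  then show ?thesis
  proof
    assume *: "d = 1 \<and> a = 1"
    then show ?thesis unfolding eta_law_def by (simp add: dedekind_eta_plus_int' eta_exponent_def)
  next
    assume *: "d = -1 \<and> a = -1"
    have "root24 (- 6 - b) * \<i> = root24 (- b)"
    proof -
      have "root24 (-6) = - \<i>"
      proof -
        have "2 * of_real pi * \<i> * of_int (-6) / 24 = \<i> * of_real (- (pi / 2))" by simp
        then show ?thesis unfolding root24_def by (simp only: exp_eq_polar cis.simps) (simp add: complex_eq_iff)
      qed
      then show ?thesis using root24_add[of "-6" "-b"] by (simp add: mult.assoc mult.commute[of _ \<i>])
    qed
    moreover have "dedekind_eta (\<tau> - of_int b) = root24 (- b) * dedekind_eta \<tau>" for \<tau>
      using dedekind_eta_plus_int'[of \<tau> "-b"] by simp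
    moreover have "(- \<tau> + of_int b) / (- 1) = \<tau> - of_int b" for \<tau> :: complex by simp
    ultimately show ?thesis using * unfolding eta_law_def
      by (simp add: eta_exponent_def)
  qed
qed

theorem eta_law_odd:
  assumes "a * d - b * c = 1" "odd d"
  shows "eta_law a b c d"
  using assms
proof (induction "nat (\<bar>c\<bar> + \<bar>d\<bar>)" arbitrary: a b c d rule: less_induct)
  case less
  note det = less.prems(1) and odd = less.prems(2)
  have d0: "d \<noteq> 0" using odd by auto
  show ?case
  proof (cases "c = 0")
    case True
    then show ?thesis using det eta_law_c_0 by simp
  next
    case c0: False
    have ne: "\<bar>d\<bar> \<noteq> 2 * \<bar>c\<bar>" using odd by (metis even_abs_add_iff even_mult_iff even_numeral dvd_abs_iff)
    have det1: "(a - b) * d - b * (c - d) = 1" "(a + b) * d - b * (c + d) = 1"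
      "a * (d - 2 * c) - (b - 2 * a) * c = 1" "a * (d + 2 * c) - (b + 2 * a) * c = 1"
      using det by (simp_all add: algebra_simps)
    have odd1: "odd (d - 2 * c)" "odd (d + 2 * c)" using odd by simp_all
    \<comment> \<open>If |d| < 2|c|, adding or subtracting d shortens c; if |d| > 2|c|, adding or
      subtracting 2c shortens d.\<close>
    have "\<bar>c - d\<bar> < \<bar>c\<bar> \<or> \<bar>c + d\<bar> < \<bar>c\<bar> \<or> \<bar>d - 2 * c\<bar> < \<bar>d\<bar> \<or> \<bar>d + 2 * c\<bar> < \<bar>d\<bar>"
      using c0 d0 ne by arith
    then consider "\<bar>c - d\<bar> < \<bar>c\<bar>" | "\<bar>c + d\<bar> < \<bar>c\<bar>" | "\<bar>d - 2 * c\<bar> < \<bar>d\<bar>" | "\<bar>d + 2 * c\<bar> < \<bar>d\<bar>" by blast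
    then show ?thesis
    proof cases
      case 1
      have "eta_law (a - b) b (c - d) d" by (rule less.hyps) (use 1 det1 odd in auto)
      then show ?thesis using eta_law_lower_iff[OF det1(1) odd] by simp
    next
      case 2
      have "eta_law (a + b) b (c + d) d" by (rule less.hyps) (use 2 det1 odd in auto)
      then show ?thesis using eta_law_lower_iff[OF det odd] by simp
    next
      case 3
      have "eta_law a (b - 2 * a) c (d - 2 * c)" by (rule less.hyps) (use 3 det1 odd1 in auto)
      then show ?thesis using eta_law_translate_iff[OF det1(3) odd1(1)] by simp
    next
      case 4
      have "eta_law a (b + 2 * a) c (d + 2 * c)" by (rule less.hyps) (use 4 det1 odd1 in auto)
      then show ?thesis using eta_law_translate_iff[OF det odd] by simp
    qed
  qed
qed

section \<open>Characters of eta quotients\<close>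

text \<open>As eta has no zeros in the upper half-plane, its value at i pins down the constant in
  the definite description, so any valid law yields \<open>v_eta\<close>.\<close>

lemma v_eta_eqI:
  fixes a b c d :: int
  assumes det: "a * d - b * c = 1" and eps: "\<epsilon> \<in> {1, -1}"
    and law: "\<And>\<tau>. Im \<tau> > 0 \<Longrightarrow> dedekind_eta ((of_int a * \<tau> + of_int b) / (of_int c * \<tau> + of_int d))
       = v * csqrt (of_int c * \<tau> + of_int d) * dedekind_eta \<tau>"
  shows "v_eta (mat2 a b c d, \<epsilon>) = \<epsilon> * v"
proof -
  have D: "real_of_int a * of_int d - of_int b * of_int c = 1"
    using det by (metis of_int_1 of_int_diff of_int_mult)
  have slash: "slash 1 dedekind_eta (mat2 a b c d, \<epsilon>) \<tau> = (\<epsilon> * v) * dedekind_eta \<tau>" if \<tau>: "Im \<tau> > 0" for \<tau>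
  proof -
    have "autfac (mat2 a b c d) \<tau> \<noteq> 0" using \<tau> D by (intro autfac_nonzero) simp_all
    then have "csqrt (of_int c * \<tau> + of_int d) \<noteq> 0" by (simp add: autfac_def)
    moreover have "inverse \<epsilon> = \<epsilon>" using eps by auto
    ultimately show ?thesis using law[OF \<tau>] D
      by (simp add: slash_def moebius_def autfac_def power_int_minus)
  qed
  show ?thesis unfolding v_eta_def
  proof (rule the_equality)
    show "\<forall>\<tau>. Im \<tau> > 0 \<longrightarrow> slash 1 dedekind_eta (mat2 a b c d, \<epsilon>) \<tau> = (\<epsilon> * v) * dedekind_eta \<tau>"
      using slash by blast
    fix w assume "\<forall>\<tau>. Im \<tau> > 0 \<longrightarrow> slash 1 dedekind_eta (mat2 a b c d, \<epsilon>) \<tau> = w * dedekind_eta \<tau>"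
    then have "w * dedekind_eta \<i> = (\<epsilon> * v) * dedekind_eta \<i>" using slash[of \<i>] by simp
    then show "w = \<epsilon> * v" using dedekind_eta_nonzero[of \<i>] by simp
  qed
qed

text \<open>The parameter \<open>j\<close> moves the lower right entry to an odd number, so that the formula also covers even \<open>d\<close>.\<close>
lemma v_eta_eq:
  fixes a b c d j :: int
  assumes det: "a * d - b * c = 1" and eps: "\<epsilon> \<in> {1, -1}" and odd: "odd (d + j * c)"
  shows "v_eta (mat2 a b c d, \<epsilon>)
    = \<epsilon> * (of_int (kronecker c (d + j * c)) * root24 (eta_exponent a (b + j * a) c (d + j * c) - j))"
proof (rule v_eta_eqI[OF det eps])
  fix \<tau> :: complex assume \<tau>: "Im \<tau> > 0"
  have "a * (d + j * c) - (b + j * a) * c = 1" using det by (simp add: algebra_simps)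
  then have "eta_law a (b + j * a) c (d + j * c)" using odd by (rule eta_law_odd)
  moreover have "Im (\<tau> - of_int j) > 0" using \<tau> by simp
  ultimately have law: "dedekind_eta ((of_int a * (\<tau> - of_int j) + of_int (b + j * a)) / (of_int c * (\<tau> - of_int j) + of_int (d + j * c)))
       = of_int (kronecker c (d + j * c)) * root24 (eta_exponent a (b + j * a) c (d + j * c))
         * csqrt (of_int c * (\<tau> - of_int j) + of_int (d + j * c)) * dedekind_eta (\<tau> - of_int j)"
    unfolding eta_law_def by blast
  have arg: "of_int a * (\<tau> - of_int j) + of_int (b + j * a) = of_int a * \<tau> + of_int b"
    "of_int c * (\<tau> - of_int j) + of_int (d + j * c) = of_int c * \<tau> + of_int d"
    by (simp_all add: algebra_simps)
  have T: "dedekind_eta (\<tau> - of_int j) = root24 (- j) * dedekind_eta \<tau>"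
    using dedekind_eta_plus_int'[of \<tau> "- j"] by simp
  have R: "root24 (eta_exponent a (b + j * a) c (d + j * c) - j) = root24 (eta_exponent a (b + j * a) c (d + j * c)) * root24 (- j)"
    using root24_add[of "eta_exponent a (b + j * a) c (d + j * c)" "- j"] by simp
  show "dedekind_eta ((of_int a * \<tau> + of_int b) / (of_int c * \<tau> + of_int d))
       = of_int (kronecker c (d + j * c)) * root24 (eta_exponent a (b + j * a) c (d + j * c) - j)
         * csqrt (of_int c * \<tau> + of_int d) * dedekind_eta \<tau>"
    using law unfolding arg T R by (simp only: mult_ac)
qed

section \<open>Products over the divisors of N\<close>

lemma prod_root24: "(\<Prod>n\<in>S. root24 (f n)) = root24 (\<Sum>n\<in>S. f n)"
  by (induction S rule: infinite_finite_induct) (auto simp: root24_add)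

lemma prod_power_int_const: "x \<noteq> 0 \<Longrightarrow> (\<Prod>n\<in>S. x powi f n) = x powi (\<Sum>n\<in>S. f n)" for x :: complex
  by (induction S rule: infinite_finite_induct) (auto simp: power_int_add)

text \<open>In the matrix (a, nB; (N/n)C, d) the product of the off-diagonal entries is NBC = ad - 1
  for every n. Substituting this in the quadratic term makes the exponent a combination of N/n, n
  and 1 with coefficients independent of n.\<close>

lemma sum_eta_exponent:
  fixes r :: "nat \<Rightarrow> int" and a B C d :: int
  assumes N: "N > 0" and det: "a * d - int N * B * C = 1"
  shows "(\<Sum>n | n dvd N. eta_exponent a (int n * B) (int (N div n) * C) d * r n)
    = C * (\<Sum>n | n dvd N. int (N div n) * r n) * (a * (1 - d\<^sup>2) - d)
      + B * d * (\<Sum>n | n dvd N. int n * r n) + (3 * d - 3) * (\<Sum>n | n dvd N. r n)"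
proof -
  have "eta_exponent a (int n * B) (int (N div n) * C) d * r n
     = C * (int (N div n) * r n) * (a * (1 - d\<^sup>2) - d) + B * d * (int n * r n) + (3 * d - 3) * r n"
    if "n dvd N" for n
  proof -
    define m where "m = int (N div n)"
    have nm: "int n * m = int N" using that by (simp add: m_def flip: of_nat_mult)
    have "eta_exponent a (int n * B) (m * C) d
        = (a + d) * (m * C) - (int n * m) * B * C * d * (m * C) + B * d * int n + 3 * d - 3 - 3 * (m * C) * d"
      by (simp add: eta_exponent_def power2_eq_square algebra_simps)
    also have "\<dots> = (m * C) * (a + d - (int N * B * C) * d - 3 * d) + B * d * int n + (3 * d - 3)"
      unfolding nm by (simp add: algebra_simps)
    also have "int N * B * C = a * d - 1" using det by simp
    finally have e: "eta_exponent a (int n * B) (m * C) d = (m * C) * (a + d - (a * d - 1) * d - 3 * d) + B * d * int n + (3 * d - 3)" .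
    show ?thesis unfolding m_def[symmetric] e by (simp add: power2_eq_square algebra_simps)
  qed
  then have "(\<Sum>n | n dvd N. eta_exponent a (int n * B) (int (N div n) * C) d * r n)
    = (\<Sum>n | n dvd N. C * (int (N div n) * r n) * (a * (1 - d\<^sup>2) - d) + B * d * (int n * r n) + (3 * d - 3) * r n)"
    by (intro sum.cong) auto
  then show ?thesis
    by (simp only: sum.distrib sum_distrib_left[symmetric] sum_distrib_right[symmetric])
qed

lemma eta_quotient_char_eq:
  fixes r :: "nat \<Rightarrow> int" and a B C d j :: int
  assumes N: "N > 0" and det: "a * d - int N * B * C = 1" and eps: "\<epsilon> \<in> {1, -1}"
    and d': "d' = d + j * (int N * C)" and odd: "odd d'"
  shows "eta_quotient_char N r (mat2 a B (int N * C) d, \<epsilon>)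
    = \<epsilon> powi (\<Sum>n | n dvd N. r n)
      * (\<Prod>n | n dvd N. of_int (kronecker (int (N div n) * C) d') powi r n)
      * root24 (C * (\<Sum>n | n dvd N. int (N div n) * r n) * (a * (1 - d'\<^sup>2) - d')
          + ((B + j * a) * d' - j) * (\<Sum>n | n dvd N. int n * r n) + (3 * d' - 3) * (\<Sum>n | n dvd N. r n))"
proof -
  have eps0: "\<epsilon> \<noteq> 0" using eps by auto
  have det': "a * d' - int N * (B + j * a) * C = 1" using det by (simp add: d' algebra_simps)
  let ?E = "\<lambda>n. eta_exponent a (int n * (B + j * a)) (int (N div n) * C) d' - j * int n"
  have factor: "v_eta (mat2 a (B * real n) (int N * C / real n) d, \<epsilon>)
      = \<epsilon> * (of_int (kronecker (int (N div n) * C) d') * root24 (?E n))" if "n dvd N" for n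
  proof -
    define m where "m = int (N div n)"
    have n0: "n > 0" using that N by (metis dvd_0_left_iff gr0I less_irrefl)
    have nm: "int n * m = int N" using that by (simp add: m_def flip: of_nat_mult)
    have "real_of_int (int N * C) / real n = real_of_int (m * C)"
      using n0 by (simp add: nm[symmetric])
    moreover have "real_of_int B * real n = real_of_int (int n * B)" by simp
    moreover have sh: "d + (j * int n) * (m * C) = d'" unfolding d' by (simp add: nm[symmetric] mult_ac)
    moreover have "a * d - (int n * B) * (m * C) = 1" using det by (simp add: nm[symmetric] mult_ac)
    ultimately show ?thesis
      \<comment> \<open>The factor at n is shifted by its own amount j n, so that the lower right
        entry becomes the same odd d' for all n.\<close>
      using v_eta_eq[of a d "int n * B" "m * C" \<epsilon> "j * int n"] eps odd
      by (simp add: m_def[symmetric] algebra_simps)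
  qed
  have "eta_quotient_char N r (mat2 a B (int N * C) d, \<epsilon>)
    = (\<Prod>n | n dvd N. (\<epsilon> * (of_int (kronecker (int (N div n) * C) d') * root24 (?E n))) powi r n)"
    unfolding eta_quotient_char_def using factor by (auto intro!: prod.cong)
  also have "\<dots> = (\<Prod>n | n dvd N. \<epsilon> powi r n) * (\<Prod>n | n dvd N. of_int (kronecker (int (N div n) * C) d') powi r n)
      * (\<Prod>n | n dvd N. root24 (?E n * r n))"
    by (simp add: power_int_mult_distrib root24_power_int prod.distrib mult.assoc)
  also have "(\<Prod>n | n dvd N. \<epsilon> powi r n) = \<epsilon> powi (\<Sum>n | n dvd N. r n)"
    by (rule prod_power_int_const[OF eps0])
  also have "(\<Prod>n | n dvd N. root24 (?E n * r n)) = root24 (\<Sum>n | n dvd N. ?E n * r n)"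
    by (rule prod_root24)
  also have "(\<Sum>n | n dvd N. ?E n * r n) = C * (\<Sum>n | n dvd N. int (N div n) * r n) * (a * (1 - d'\<^sup>2) - d')
          + ((B + j * a) * d' - j) * (\<Sum>n | n dvd N. int n * r n) + (3 * d' - 3) * (\<Sum>n | n dvd N. r n)"
    using sum_eta_exponent[OF N det', of r]
    by (simp add: left_diff_distrib sum_subtractf sum_distrib_left mult.assoc)
  finally show ?thesis .
qed

lemma kronecker_prod_left:
  assumes "odd d" "finite S" "\<And>n. n \<in> S \<Longrightarrow> f n \<noteq> 0"
  shows "kronecker (\<Prod>n\<in>S. f n) d = (\<Prod>n\<in>S. kronecker (f n) d)"
  using assms(2,3) by (induction S) (auto simp: kronecker_mult_left'[OF assms(1)])

lemma power_int_sign: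
  assumes "x \<in> {1, -1 :: complex}"
  shows "x powi k = (if even k then 1 else x)"
  using assms by (auto simp: power_int_minus_one_minus power_int_minus_left)

text \<open>Because symbols are signs, (N/n) may be traded for N n: each factor splits into symbols
  of l, of n and of N\<gamma>. Equal sums of the exponents cancel the last; l keeps the sum of the
  r_n as its exponent, and n survives exactly where r_n - r'_n is odd. This is the origin of
  \<delta>.\<close>

lemma kronecker_eta_quotient_ratio:
  fixes r r' :: "nat \<Rightarrow> int" and l N :: nat and \<gamma> d :: int
  assumes l: "l > 0" and N: "N > 0" and odd: "odd d"
    and cop: "coprime (int l * (int N * \<gamma>)) d"
    and sum_eq: "(\<Sum>n | n dvd N. r n) = (\<Sum>n | n dvd N. r' n)"
  shows "(\<Prod>n | n dvd N. of_int (kronecker (int (N div n) * (int l * \<gamma>)) d) powi r n :: complex)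
    = of_int (kronecker (int l ^ nat \<bar>\<Sum>n | n dvd N. r n\<bar> * (\<Prod>n | n dvd N \<and> \<not> 2 dvd (r n - r' n). int n)) d)
      * (\<Prod>n | n dvd N. of_int (kronecker (int (N div n) * \<gamma>) d) powi r' n)"
proof -
  let ?R = "\<Sum>n | n dvd N. r n"
  let ?K = "\<lambda>m. of_int (kronecker m d) :: complex"
  have d0: "d \<noteq> 0" using odd by auto
  have fin: "finite {n. n dvd N}" using N by simp
  have pos: "n > 0" if "n dvd N" for n using that N by (metis dvd_0_left_iff gr0I less_irrefl)
  have sgn: "?K m \<in> {1, -1}" if "coprime m d" for m
    using kronecker_values[OF d0 that] by auto
  have copl: "coprime (int l) d" "coprime (int N * \<gamma>) d" using cop by simp_all
  have copN: "coprime (int n) d" if "n dvd N" for n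
  proof -
    have "coprime (int N) d" using copl(2) by simp
    then show ?thesis using that by (meson coprime_divisors dvd_refl int_dvd_int_iff)
  qed
  \<comment> \<open>The case \<gamma> = 0 lies outside multiplicativity in the upper entry. There d
    is 1 or -1, and symbols with nonnegative upper entry are 1.\<close>
  have g0: "d = 1 \<or> d = -1" if "\<gamma> = 0"
    using copl(2) that by (simp add: abs_if split: if_splits)
  have K0: "?K m = 1" if "\<gamma> = 0" "m \<ge> 0" for m
    using g0[OF that(1)] that(2) by auto
  have kl: "?K (int (N div n) * (int l * \<gamma>)) = ?K (int l) * ?K (int (N div n) * \<gamma>)" if "n dvd N" for n
  proof (cases "\<gamma> = 0")
    case False
    have "int (N div n) \<noteq> 0" using that N by (auto simp: dvd_div_eq_0_iff)
    then have "kronecker (int l * (int (N div n) * \<gamma>)) d = kronecker (int l) d * kronecker (int (N div n) * \<gamma>) d"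
      using l False odd by (intro kronecker_mult_left') auto
    then show ?thesis by (simp add: mult_ac)
  qed (simp add: K0)
  have kn: "?K (int (N div n) * \<gamma>) = ?K (int n) * ?K (int N * \<gamma>)" if "n dvd N" for n
  proof (cases "\<gamma> = 0")
    case False
    have e: "int N = int n * int (N div n)" using that by (simp flip: of_nat_mult)
    have "int (N div n) \<noteq> 0" using that N by (auto simp: dvd_div_eq_0_iff)
    then have "kronecker (int n * (int (N div n) * \<gamma>)) d = kronecker (int n) d * kronecker (int (N div n) * \<gamma>) d"
      using pos[OF that] False odd by (intro kronecker_mult_left') auto
    then have "?K (int N * \<gamma>) = ?K (int n) * ?K (int (N div n) * \<gamma>)" by (simp add: e mult_ac)
    then show ?thesis using sgn[OF copN[OF that]] by auto
  qed (simp add: K0)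
  have nz: "?K (int l) \<noteq> 0" "?K (int N * \<gamma>) \<noteq> 0" using sgn copl by fastforce+
  have L: "(\<Prod>n | n dvd N. ?K (int (N div n) * (int l * \<gamma>)) powi r n)
      = (?K (int l) * ?K (int N * \<gamma>)) powi ?R * (\<Prod>n | n dvd N. ?K (int n) powi r n)"
  proof -
    have "(\<Prod>n | n dvd N. ?K (int (N div n) * (int l * \<gamma>)) powi r n)
      = (\<Prod>n | n dvd N. ((?K (int l) * ?K (int N * \<gamma>)) powi r n) * (?K (int n) powi r n))"
      by (intro prod.cong) (auto simp: kl kn power_int_mult_distrib)
    then show ?thesis using nz by (simp add: prod.distrib prod_power_int_const)
  qed
  have R: "(\<Prod>n | n dvd N. ?K (int (N div n) * \<gamma>) powi r' n)
      = ?K (int N * \<gamma>) powi ?R * (\<Prod>n | n dvd N. ?K (int n) powi r' n)"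
  proof -
    have "(\<Prod>n | n dvd N. ?K (int (N div n) * \<gamma>) powi r' n)
      = (\<Prod>n | n dvd N. (?K (int N * \<gamma>) powi r' n) * (?K (int n) powi r' n))"
      by (intro prod.cong) (auto simp: kn power_int_mult_distrib)
    then show ?thesis using nz by (simp add: prod.distrib prod_power_int_const sum_eq)
  qed
  have P: "(\<Prod>n | n dvd N. ?K (int n) powi r n)
      = (\<Prod>n | n dvd N \<and> \<not> 2 dvd (r n - r' n). ?K (int n)) * (\<Prod>n | n dvd N. ?K (int n) powi r' n)"
  proof -
    have "?K (int n) powi r n = (if \<not> 2 dvd (r n - r' n) then ?K (int n) else 1) * ?K (int n) powi r' n" if "n dvd N" for n
      using sgn[OF copN[OF that]] by (auto simp: power_int_sign)
    then have "(\<Prod>n | n dvd N. ?K (int n) powi r n)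
       = (\<Prod>n | n dvd N. if \<not> 2 dvd (r n - r' n) then ?K (int n) else 1) * (\<Prod>n | n dvd N. ?K (int n) powi r' n)"
      by (simp add: prod.distrib[symmetric])
    also have "(\<Prod>n | n dvd N. if \<not> 2 dvd (r n - r' n) then ?K (int n) else 1)
       = (\<Prod>n | n dvd N \<and> \<not> 2 dvd (r n - r' n). ?K (int n))"
      using prod.inter_filter[OF fin, of "\<lambda>n. ?K (int n)" "\<lambda>n. \<not> 2 dvd (r n - r' n)"] by simp
    finally show ?thesis .
  qed
  have "?K (int l ^ nat \<bar>?R\<bar> * (\<Prod>n | n dvd N \<and> \<not> 2 dvd (r n - r' n). int n))
     = ?K (int l) ^ nat \<bar>?R\<bar> * (\<Prod>n | n dvd N \<and> \<not> 2 dvd (r n - r' n). ?K (int n))"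
  proof -
    let ?S = "{n. n dvd N \<and> \<not> 2 dvd (r n - r' n)}"
    have S: "finite ?S" "\<And>n. n \<in> ?S \<Longrightarrow> int n \<noteq> 0" using fin pos by auto
    have h1: "(\<Prod>n\<in>?S. int n) \<noteq> 0" unfolding prod_zero_iff[OF S(1)] using S(2) by blast
    have h2: "int l ^ nat \<bar>?R\<bar> \<noteq> 0" and h3: "int l \<noteq> 0" using l by simp_all
    have "kronecker (int l ^ nat \<bar>?R\<bar> * (\<Prod>n\<in>?S. int n)) d
        = kronecker (int l) d ^ nat \<bar>?R\<bar> * kronecker (\<Prod>n\<in>?S. int n) d"
      unfolding kronecker_mult_left'[OF odd h2 h1] kronecker_power_left[OF odd h3] ..
    also have "kronecker (\<Prod>n\<in>?S. int n) d = (\<Prod>n\<in>?S. kronecker (int n) d)"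
      by (rule kronecker_prod_left[OF odd S])
    finally have "kronecker (int l ^ nat \<bar>?R\<bar> * (\<Prod>n\<in>?S. int n)) d
        = kronecker (int l) d ^ nat \<bar>?R\<bar> * (\<Prod>n\<in>?S. kronecker (int n) d)" .
    then show ?thesis by (simp only: of_int_mult of_int_power of_int_prod)
  qed
  moreover have "?K (int l) ^ nat \<bar>?R\<bar> = ?K (int l) powi ?R"
  proof -
    \<comment> \<open>The absolute value of the weight in \<delta> does no harm, since a sign equals
      its inverse.\<close>
    have "x ^ nat \<bar>k\<bar> = x powi k" if "x \<in> {1, -1}" for x :: complex and k
      using that by (auto simp: power_int_sign minus_one_power_iff even_nat_iff)
    then show ?thesis using sgn[OF copl(1)] by blast
  qed
  ultimately show ?thesis
    unfolding L R P by (simp add: power_int_mult_distrib mult_ac)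
qed

lemma coprime_of_bezout:
  fixes m n u v :: int
  assumes "m * u + n * v = 1"
  shows "coprime m n"
proof (rule coprimeI)
  fix c assume "c dvd m" "c dvd n"
  then have "c dvd m * u + n * v" by (intro dvd_add dvd_mult2)
  then show "is_unit c" using assms by simp
qed

text \<open>The second matrix is the conjugate of the first by diag (1, l). Powers of \<epsilon> and
  the terms with 3d' - 3 agree on both sides by \<open>sum_eq\<close>. Non-vanishing is recorded so
  that a quotient can be formed.\<close>

lemma eta_quotient_char_ratio:
  fixes r r' :: "nat \<Rightarrow> int" and l N :: nat and a \<beta> \<gamma> d j :: int
  assumes l: "l > 0" and N: "N > 0" and det: "a * d - int l * \<beta> * (int N * \<gamma>) = 1" and eps: "\<epsilon> \<in> {1, -1}"
    and d': "d' = d + j * (int l * (int N * \<gamma>))" and odd: "odd d'"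
    and sum_eq: "(\<Sum>n | n dvd N. r n) = (\<Sum>n | n dvd N. r' n)"
  shows "eta_quotient_char N r (mat2 a \<beta> (int N * (int l * \<gamma>)) d, \<epsilon>)
      = of_int (kronecker (int l ^ nat \<bar>\<Sum>n | n dvd N. r n\<bar> * (\<Prod>n | n dvd N \<and> \<not> 2 dvd (r n - r' n). int n)) d')
        * root24 (\<gamma> * (int l * (\<Sum>n | n dvd N. int (N div n) * r n) - (\<Sum>n | n dvd N. int (N div n) * r' n)) * (a * (1 - d'\<^sup>2) - d')
          + ((\<beta> + j * a) * d' - j) * ((\<Sum>n | n dvd N. int n * r n) - int l * (\<Sum>n | n dvd N. int n * r' n)))
        * eta_quotient_char N r' (mat2 a (int l * \<beta>) (int N * \<gamma>) d, \<epsilon>)"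
    and "eta_quotient_char N r' (mat2 a (int l * \<beta>) (int N * \<gamma>) d, \<epsilon>) \<noteq> 0"
proof -
  let ?X = "\<Sum>n | n dvd N. int (N div n) * r n" and ?X' = "\<Sum>n | n dvd N. int (N div n) * r' n"
  let ?Y = "\<Sum>n | n dvd N. int n * r n" and ?Y' = "\<Sum>n | n dvd N. int n * r' n"
  let ?R = "\<Sum>n | n dvd N. r n"
  let ?D = "int l ^ nat \<bar>?R\<bar> * (\<Prod>n | n dvd N \<and> \<not> 2 dvd (r n - r' n). int n)"
  have eps0: "\<epsilon> \<noteq> 0" using eps by auto
  have d0: "d' \<noteq> 0" using odd by auto
  have detL: "a * d - int N * \<beta> * (int l * \<gamma>) = 1" and detR: "a * d - int N * (int l * \<beta>) * \<gamma> = 1"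
    using det by (simp_all add: mult_ac)
  \<comment> \<open>A translation by j before conjugation becomes one by j l afterwards, and both
    produce the same d'.\<close>
  have dL: "d' = d + j * (int N * (int l * \<gamma>))" and dR: "d' = d + (j * int l) * (int N * \<gamma>)"
    using d' by (simp_all add: mult_ac)
  have "(int l * (int N * \<gamma>)) * (- (\<beta> + j * a)) + d' * a = 1" using det by (simp add: d' algebra_simps)
  then have cop: "coprime (int l * (int N * \<gamma>)) d'" by (rule coprime_of_bezout)
  have L: "eta_quotient_char N r (mat2 a \<beta> (int N * (int l * \<gamma>)) d, \<epsilon>)
    = \<epsilon> powi ?R * (\<Prod>n | n dvd N. of_int (kronecker (int (N div n) * (int l * \<gamma>)) d') powi r n)
      * root24 ((int l * \<gamma>) * ?X * (a * (1 - d'\<^sup>2) - d') + ((\<beta> + j * a) * d' - j) * ?Y + (3 * d' - 3) * ?R)"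
    by (rule eta_quotient_char_eq[OF N detL eps dL odd])
  have R: "eta_quotient_char N r' (mat2 a (int l * \<beta>) (int N * \<gamma>) d, \<epsilon>)
    = \<epsilon> powi ?R * (\<Prod>n | n dvd N. of_int (kronecker (int (N div n) * \<gamma>) d') powi r' n)
      * root24 (\<gamma> * ?X' * (a * (1 - d'\<^sup>2) - d') + ((int l * \<beta> + (j * int l) * a) * d' - j * int l) * ?Y' + (3 * d' - 3) * ?R)"
    unfolding sum_eq by (rule eta_quotient_char_eq[OF N detR eps dR odd])
  have E: "(int l * \<gamma>) * ?X * (a * (1 - d'\<^sup>2) - d') + ((\<beta> + j * a) * d' - j) * ?Y + (3 * d' - 3) * ?R
    = (\<gamma> * (int l * ?X - ?X') * (a * (1 - d'\<^sup>2) - d') + ((\<beta> + j * a) * d' - j) * (?Y - int l * ?Y'))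
      + (\<gamma> * ?X' * (a * (1 - d'\<^sup>2) - d') + ((int l * \<beta> + (j * int l) * a) * d' - j * int l) * ?Y' + (3 * d' - 3) * ?R)"
    by (simp add: algebra_simps)
  show "eta_quotient_char N r (mat2 a \<beta> (int N * (int l * \<gamma>)) d, \<epsilon>)
      = of_int (kronecker ?D d')
        * root24 (\<gamma> * (int l * ?X - ?X') * (a * (1 - d'\<^sup>2) - d') + ((\<beta> + j * a) * d' - j) * (?Y - int l * ?Y'))
        * eta_quotient_char N r' (mat2 a (int l * \<beta>) (int N * \<gamma>) d, \<epsilon>)"
    unfolding L R kronecker_eta_quotient_ratio[OF l N odd cop sum_eq] E root24_add[of "_ + _" "_ + _ + _"]
    by (simp only: mult_ac)
  have "of_int (kronecker (int (N div n) * \<gamma>) d') \<noteq> (0 :: complex)" if "n dvd N" for n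
  proof -
    have "coprime (int N * \<gamma>) d'" using cop by simp
    moreover have "int (N div n) * \<gamma> dvd int N * \<gamma>" using that by (intro mult_dvd_mono) (auto simp: int_dvd_int_iff)
    ultimately have "coprime (int (N div n) * \<gamma>) d'" using coprime_divisors dvd_refl by blast
    then show ?thesis using kronecker_values[OF d0] by fastforce
  qed
  then have "(\<Prod>n | n dvd N. of_int (kronecker (int (N div n) * \<gamma>) d') powi r' n) \<noteq> (0 :: complex)"
    using N by (subst prod_zero_iff) (auto simp: power_int_eq_0_iff)
  then show "eta_quotient_char N r' (mat2 a (int l * \<beta>) (int N * \<gamma>) d, \<epsilon>) \<noteq> 0"
    unfolding R using eps0 by simp
qed

section \<open>Conjugation by a diagonal matrix in the metaplectic group\<close>

lemma csqrt_of_real_mult: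
  assumes "s > 0"
  shows "csqrt (of_real s * z) = of_real (sqrt s) * csqrt z"
proof (rule csqrt_unique)
  show "(of_real (sqrt s) * csqrt z)\<^sup>2 = of_real s * z"
    using assms by (simp add: power_mult_distrib flip: of_real_power)
  have "sqrt s > 0" using assms by simp
  then show "0 < Re (of_real (sqrt s) * csqrt z) \<or> Re (of_real (sqrt s) * csqrt z) = 0 \<and> 0 \<le> Im (of_real (sqrt s) * csqrt z)"
    using csqrt_principal[of z] assms by (auto simp del: csqrt.sel real_sqrt_gt_0_iff intro!: mult_nonneg_nonneg)
qed

text \<open>Its automorphy factor is the positive constant s, which passes through the principal
  root. With the mirrored statement below, conjugation leaves \<epsilon> untouched.\<close>

lemma sigma_diag_left:
  assumes "s > 0" "det A > 0"
  shows "sigma (mat2 1 0 0 s) A = 1"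
proof -
  have "autfac A \<i> \<noteq> 0" using assms by (intro autfac_nonzero) simp_all
  moreover have "autfac (mat2 1 0 0 s ** A) \<i> = of_real s * autfac A \<i>"
    by (simp add: autfac_def matrix_mult_nth_2 algebra_simps)
  moreover have "autfac (mat2 1 0 0 s) w = of_real s * 1" for w by (simp add: autfac_def)
  ultimately show ?thesis using assms(1) unfolding sigma_def sigma_at_autfac
    by (simp only: csqrt_of_real_mult) simp
qed

lemma sigma_diag_right:
  assumes "s > 0" "det A > 0"
  shows "sigma A (mat2 1 0 0 s) = 1"
proof -
  have m: "moebius (mat2 1 0 0 s) \<i> = \<i> / of_real s" by (simp add: moebius_def)
  have "autfac A (\<i> / of_real s) \<noteq> 0" using assms by (intro autfac_nonzero) simp_all
  moreover have "autfac (A ** mat2 1 0 0 s) \<i> = of_real s * autfac A (\<i> / of_real s)"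
    using assms(1) by (simp add: autfac_def matrix_mult_nth_2 field_simps)
  moreover have "autfac (mat2 1 0 0 s) w = of_real s * 1" for w by (simp add: autfac_def)
  ultimately show ?thesis using assms(1) unfolding sigma_def sigma_at_autfac m
    by (simp only: csqrt_of_real_mult) simp
qed

lemma Mp_conj_diag:
  fixes t :: real
  assumes t: "t > 0" and x: "(A, \<epsilon>) \<in> carrier Mp"
  shows "(mat2 1 0 0 t, 1) \<in> carrier Mp"
    "inv\<^bsub>Mp\<^esub> (mat2 1 0 0 t, 1) \<otimes>\<^bsub>Mp\<^esub> (A, \<epsilon>) \<otimes>\<^bsub>Mp\<^esub> (mat2 1 0 0 t, 1)
      = (mat2 (A$1$1) (t * A$1$2) (A$2$1 / t) (A$2$2), \<epsilon>)"
proof -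
  have detA: "det A > 0" using x by (simp add: Mp_def)
  show a: "(mat2 1 0 0 t, 1) \<in> carrier Mp" using t by (simp add: Mp_def)
  have b: "(mat2 1 0 0 (1 / t), 1) \<in> carrier Mp" using t by (simp add: Mp_def)
  have "mat2 1 0 0 (1 / t) ** mat2 1 0 0 t = mat 1"
    using t by (simp add: vec_eq_iff forall_2 matrix_mult_nth_2 mat_def)
  then have "(mat2 1 0 0 (1 / t), 1) \<otimes>\<^bsub>Mp\<^esub> (mat2 1 0 0 t, 1) = \<one>\<^bsub>Mp\<^esub>"
    using t by (simp add: Mp_def sigma_diag_left)
  then have inv: "inv\<^bsub>Mp\<^esub> (mat2 1 0 0 t, 1) = (mat2 1 0 0 (1 / t), 1)"
    using group.inv_equality[OF group_Mp] a b by blast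
  have "det (mat2 1 0 0 (1 / t) ** A) > 0" using t detA by (simp add: det_mul)
  moreover have "mat2 1 0 0 (1 / t) ** A ** mat2 1 0 0 t = mat2 (A$1$1) (t * A$1$2) (A$2$1 / t) (A$2$2)"
    using t by (simp add: vec_eq_iff forall_2 matrix_mult_nth_2)
  ultimately show "inv\<^bsub>Mp\<^esub> (mat2 1 0 0 t, 1) \<otimes>\<^bsub>Mp\<^esub> (A, \<epsilon>) \<otimes>\<^bsub>Mp\<^esub> (mat2 1 0 0 t, 1)
      = (mat2 (A$1$1) (t * A$1$2) (A$2$1 / t) (A$2$2), \<epsilon>)"
    unfolding inv using t detA by (simp add: Mp_def sigma_diag_left sigma_diag_right)
qed

section \<open>Compatibility in matrix coordinates\<close>

lemma mat2_eq_iff: "mat2 a b c d = mat2 a' b' c' d' \<longleftrightarrow> a = a' \<and> b = b' \<and> c = c' \<and> d = d'"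
  by (auto simp: vec_eq_iff forall_2)

lemma mp_preimage_Gamma0_iff:
  "(A, \<epsilon>) \<in> mp_preimage (Gamma0 N) \<longleftrightarrow> \<epsilon> \<in> {1, -1} \<and>
     (\<exists>a b c d :: int. A = mat2 a b c d \<and> a * d - b * c = 1 \<and> int N dvd c)"
proof -
  have "det (mat2 a b c d) > 0" if "a * d - b * c = 1" for a b c d :: int
  proof -
    have "real_of_int (a * d - b * c) = 1" using that by simp
    then show ?thesis by simp
  qed
  then show ?thesis by (auto simp: mp_preimage_def Mp_def Gamma0_def)
qed

text \<open>Conjugation sends (a, b; c, d) to (a, l b; c/l, d), and the result lies over
  \<open>Gamma0 N\<close> exactly when l N divides c. Writing c = N l \<gamma> parametrises the
  intersection by integers.\<close>

lemma compatible_diag_iff: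
  assumes l: "l > 0" and N: "N > 0"
  shows "compatible Mp (mp_preimage (Gamma0 N)) (mat2 1 0 0 (real l), 1) v1 v2 \<longleftrightarrow>
    (\<forall>(a::int) (\<beta>::int) (\<gamma>::int) (d::int) \<epsilon>. a * d - int l * \<beta> * (int N * \<gamma>) = 1 \<longrightarrow> \<epsilon> \<in> {1, -1} \<longrightarrow>
       v1 (mat2 a \<beta> (int N * (int l * \<gamma>)) d, \<epsilon>) = v2 (mat2 a (int l * \<beta>) (int N * \<gamma>) d, \<epsilon>))"
    (is "?C \<longleftrightarrow> ?R")
proof -
  let ?G = "mp_preimage (Gamma0 N)"
  let ?\<alpha> = "(mat2 1 0 0 (real l), 1) :: (real^2^2) \<times> complex"
  have lr: "real l > 0" using l by simp
  have sub: "?G \<subseteq> carrier Mp" by (auto simp: mp_preimage_def)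
  have conj: "inv\<^bsub>Mp\<^esub> ?\<alpha> \<otimes>\<^bsub>Mp\<^esub> (mat2 a b c d, \<epsilon>) \<otimes>\<^bsub>Mp\<^esub> ?\<alpha> = (mat2 a (real l * b) (c / real l) d, \<epsilon>)"
    if "(mat2 a b c d, \<epsilon>) \<in> ?G" for a b c d \<epsilon>
    using Mp_conj_diag(2)[OF lr, of "mat2 a b c d" \<epsilon>] that sub by auto
  have cv: "conj_char Mp ?\<alpha> v (inv\<^bsub>Mp\<^esub> ?\<alpha> \<otimes>\<^bsub>Mp\<^esub> g \<otimes>\<^bsub>Mp\<^esub> ?\<alpha>) = v g" if "g \<in> ?G" for g and v :: "_ \<Rightarrow> complex"
  proof (rule group.conj_char_conj[OF group_Mp])
    show "?\<alpha> \<in> carrier Mp" using l by (simp add: Mp_def)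
    show "g \<in> carrier Mp" using that sub by blast
  qed
  show ?thesis
  proof
    assume C: ?C
    show ?R
    proof (intro allI impI)
      fix a \<beta> \<gamma> d :: int and \<epsilon> :: complex
      assume det: "a * d - int l * \<beta> * (int N * \<gamma>) = 1" and eps: "\<epsilon> \<in> {1, -1}"
      let ?g = "(mat2 a \<beta> (int N * (int l * \<gamma>)) d, \<epsilon>)" and ?x = "(mat2 a (int l * \<beta>) (int N * \<gamma>) d, \<epsilon>)"
      have "a * d - \<beta> * (int N * (int l * \<gamma>)) = 1" using det by (simp add: mult_ac)
      then have g: "?g \<in> ?G" unfolding mp_preimage_Gamma0_iff using eps by (metis dvd_triv_left)
      have "a * d - (int l * \<beta>) * (int N * \<gamma>) = 1" using det by simp
      then have x: "?x \<in> ?G" unfolding mp_preimage_Gamma0_iff using eps by (metis dvd_triv_left)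
      have e: "inv\<^bsub>Mp\<^esub> ?\<alpha> \<otimes>\<^bsub>Mp\<^esub> ?g \<otimes>\<^bsub>Mp\<^esub> ?\<alpha> = ?x"
        unfolding conj[OF g] using l by (simp add: mat2_eq_iff)
      then have "?x \<in> conj_set Mp ?\<alpha> ?G" unfolding conj_set_def using g by (intro image_eqI[of _ _ ?g]) auto
      then have "conj_char Mp ?\<alpha> v1 ?x = v2 ?x" using C x unfolding compatible_def by blast
      then show "v1 ?g = v2 ?x" using cv[OF g, of v1] unfolding e by simp
    qed
  next
    assume R: ?R
    show ?C unfolding compatible_def
    proof
      fix x assume "x \<in> ?G \<inter> conj_set Mp ?\<alpha> ?G"
      then obtain g where x: "x \<in> ?G" and g: "g \<in> ?G" and e: "x = inv\<^bsub>Mp\<^esub> ?\<alpha> \<otimes>\<^bsub>Mp\<^esub> g \<otimes>\<^bsub>Mp\<^esub> ?\<alpha>"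
        by (auto simp: conj_set_def)
      obtain a b c d :: int and \<epsilon> where gg: "g = (mat2 a b c d, \<epsilon>)" "a * d - b * c = 1" "\<epsilon> \<in> {1, -1}"
        using g mp_preimage_Gamma0_iff by (metis surj_pair)
      obtain a' b' c' d' :: int and \<epsilon>' where xx: "x = (mat2 a' b' c' d', \<epsilon>')" "int N dvd c'"
        using x mp_preimage_Gamma0_iff by (metis surj_pair)
      have x_eq: "x = (mat2 a (real l * b) (real_of_int c / real l) d, \<epsilon>)"
        using conj[OF g[unfolded gg(1)]] e gg(1) by simp
      have "real_of_int c / real l = real_of_int c'" using x_eq xx(1) by (simp add: mat2_eq_iff)
      then have "real_of_int c = real_of_int (int l * c')" using l by (simp add: field_simps)
      then have c: "c = int l * c'" by (simp only: of_int_eq_iff)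
      obtain \<gamma> where \<gamma>: "c' = int N * \<gamma>" using xx(2) by auto
      have "a * d - int l * b * (int N * \<gamma>) = 1" using gg(2) by (simp add: c \<gamma> mult_ac)
      then have "v1 (mat2 a b (int N * (int l * \<gamma>)) d, \<epsilon>) = v2 (mat2 a (int l * b) (int N * \<gamma>) d, \<epsilon>)"
        using R gg(3) by blast
      moreover have "g = (mat2 a b (int N * (int l * \<gamma>)) d, \<epsilon>)"
        by (simp add: gg(1) c \<gamma> mat2_eq_iff mult_ac)
      moreover have "x = (mat2 a (int l * b) (int N * \<gamma>) d, \<epsilon>)"
        using l by (simp add: x_eq c \<gamma> mat2_eq_iff)
      moreover have "conj_char Mp ?\<alpha> v1 x = v1 g" unfolding e by (rule cv[OF g])
      ultimately show "conj_char Mp ?\<alpha> v1 x = v2 x" by simp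
    qed
  qed
qed

lemma compatible_eta_quotient_iff:
  fixes l N :: nat and r r' :: "nat \<Rightarrow> int" and chi chi' :: "int \<Rightarrow> complex"
  assumes l: "l > 0" and N: "N > 0"
    and sum_eq: "(\<Sum>n | n dvd N. r n) = (\<Sum>n | n dvd N. r' n)"
    and one: "chi 1 = 1" "chi' 1 = 1"
    and per: "\<And>a k. chi (a + int N * k) = chi a" "\<And>a k. chi' (a + int N * k) = chi' a"
    and nz: "\<And>d. coprime d (int N) \<Longrightarrow> chi' d \<noteq> 0"
    and \<delta>: "\<delta> = int l ^ nat \<bar>\<Sum>n | n dvd N. r n\<bar> * (\<Prod>n | n dvd N \<and> \<not> 2 dvd (r n - r' n). int n)"
  shows "compatible Mp (mp_preimage (Gamma0 N)) (mat2 1 0 0 (real l), 1)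
           (\<lambda>x. char_of_dirichlet chi x * eta_quotient_char N r x)
           (\<lambda>x. char_of_dirichlet chi' x * eta_quotient_char N r' x) \<longleftrightarrow>
    [int l * (\<Sum>n | n dvd N. int (N div n) * r n) = (\<Sum>n | n dvd N. int (N div n) * r' n)] (mod 24) \<and>
    [(\<Sum>n | n dvd N. int n * r n) = int l * (\<Sum>n | n dvd N. int n * r' n)] (mod 24) \<and>
    (\<forall>d. odd d \<longrightarrow> coprime (int (N * l)) d \<longrightarrow> chi d * inverse (chi' d) = of_int (kronecker \<delta> d))"
    (is "?C \<longleftrightarrow> [?X = ?X'] (mod 24) \<and> [?Y = ?Y'] (mod 24) \<and> ?Q")
proof -
  let ?val = "\<lambda>a \<beta> \<gamma> d j :: int. chi d * inverse (chi' d) * of_int (kronecker \<delta> d)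
    * root24 (\<gamma> * (?X - ?X') * (a * (1 - d\<^sup>2) - d) + ((\<beta> + j * a) * d - j) * (?Y - ?Y'))"
  have key: "char_of_dirichlet chi (mat2 a \<beta> (int N * (int l * \<gamma>)) d, \<epsilon>) * eta_quotient_char N r (mat2 a \<beta> (int N * (int l * \<gamma>)) d, \<epsilon>)
      = char_of_dirichlet chi' (mat2 a (int l * \<beta>) (int N * \<gamma>) d, \<epsilon>) * eta_quotient_char N r' (mat2 a (int l * \<beta>) (int N * \<gamma>) d, \<epsilon>)
    \<longleftrightarrow> ?val a \<beta> \<gamma> d' j = 1"
    if det: "a * d - int l * \<beta> * (int N * \<gamma>) = 1" and eps: "\<epsilon> \<in> {1, -1}"
      and d': "d' = d + j * (int l * (int N * \<gamma>))" and odd: "odd d'" for a \<beta> \<gamma> d d' j :: int and \<epsilon>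
  proof -
    note ratio = eta_quotient_char_ratio[OF l N det eps d' odd sum_eq, folded \<delta>]
    have "d' = d + int N * (j * int l * \<gamma>)" by (simp add: d' mult_ac)
    then have p: "chi d' = chi d" "chi' d' = chi' d" using per by simp_all
    have "d * a + int N * (- (int l * \<beta> * \<gamma>)) = 1" using det by (simp add: algebra_simps)
    then have "coprime d (int N)" by (rule coprime_of_bezout)
    then have n: "chi' d \<noteq> 0" by (rule nz)
    have "u * (k * z * e) = v * e \<longleftrightarrow> u * inverse v * k * z = 1" if "e \<noteq> 0" "v \<noteq> 0" for u v k z e :: complex
    proof -
      have "u * (k * z * e) = v * e \<longleftrightarrow> u * k * z = v" using that(1) by (simp add: mult_ac)
      also have "\<dots> \<longleftrightarrow> u * inverse v * k * z = 1" using that(2) by (simp add: field_simps)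
      finally show ?thesis .
    qed
    from this[OF ratio(2) n]
    show ?thesis unfolding ratio(1) p by (simp add: char_of_dirichlet_def)
  qed
  have coprime_\<delta>: "coprime \<delta> d" if "coprime (int (N * l)) d" for d
  proof -
    have N1: "coprime (int N) d" and l1: "coprime (int l) d" using that by simp_all
    have "coprime (\<Prod>n | n dvd N \<and> \<not> 2 dvd (r n - r' n). int n) d"
    proof (rule prod_coprime_left)
      fix n assume "n \<in> {n. n dvd N \<and> \<not> 2 dvd (r n - r' n)}"
      then have "int n dvd int N" by simp
      then show "coprime (int n) d" by (rule coprime_divisors[OF _ dvd_refl N1])
    qed
    then show ?thesis using l1 by (simp add: \<delta>)
  qed
  have cmp: "?C \<longleftrightarrow> (\<forall>(a::int) (\<beta>::int) (\<gamma>::int) (d::int) \<epsilon>. a * d - int l * \<beta> * (int N * \<gamma>) = 1 \<longrightarrow> \<epsilon> \<in> {1, -1} \<longrightarrow>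
      char_of_dirichlet chi (mat2 a \<beta> (int N * (int l * \<gamma>)) d, \<epsilon>) * eta_quotient_char N r (mat2 a \<beta> (int N * (int l * \<gamma>)) d, \<epsilon>)
      = char_of_dirichlet chi' (mat2 a (int l * \<beta>) (int N * \<gamma>) d, \<epsilon>) * eta_quotient_char N r' (mat2 a (int l * \<beta>) (int N * \<gamma>) d, \<epsilon>))"
    by (rule compatible_diag_iff[OF l N])
  show ?thesis
  proof
    assume C: ?C
    have val: "?val a \<beta> \<gamma> d 0 = 1" if "a * d - int l * \<beta> * (int N * \<gamma>) = 1" "odd d" for a \<beta> \<gamma> d
      using key[of a d \<beta> \<gamma> 1 d 0] that C[unfolded cmp] by simp
    \<comment> \<open>The upper unipotent matrix \<beta> = 1, \<gamma> = 0 leaves only the exponent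
      of (2); below, the lower one with \<beta> = 0, \<gamma> = 1 leaves that of (1). At d = 1
      symbol and characters are 1.\<close>
    have "root24 (?Y - ?Y') = 1" using val[of 1 1 1 0] one by simp
    then have Y: "24 dvd ?Y - ?Y'" by (simp only: root24_eq_1_iff)
    have "root24 (- (?X - ?X')) = 1" using val[of 1 1 0 1] one by simp
    then have X: "24 dvd ?X - ?X'" by (simp only: root24_eq_1_iff dvd_minus_iff)
    have ?Q
    proof (intro allI impI)
      fix d :: int assume d: "odd d" "coprime (int (N * l)) d"
      have d0: "d \<noteq> 0" using d by auto
      \<comment> \<open>A Bezout relation completes d to a matrix with \<gamma> = 1, so every odd d
        prime to N l is tested.\<close>
      obtain u v where uv: "int (N * l) * u + d * v = 1"
        using d(2) bezout_int[of "int (N * l)" d] by (metis coprime_imp_gcd_eq_1 mult.commute)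
      then have "v * d - int l * (- u) * (int N * 1) = 1" by (simp add: algebra_simps)
      then have "?val v (- u) 1 d 0 = 1" using d(1) by (rule val)
      moreover have "24 dvd 1 * (?X - ?X') * (v * (1 - d\<^sup>2) - d) + ((- u + 0 * v) * d - 0) * (?Y - ?Y')"
        using X Y by (intro dvd_add dvd_mult dvd_mult2) auto
      ultimately have e: "chi d * inverse (chi' d) * of_int (kronecker \<delta> d) = 1"
        by (simp only: root24_eq_1_iff[THEN iffD2] mult_1_right)
      have "kronecker \<delta> d \<in> {1, -1}"
      proof (rule kronecker_values[OF d0])
        show "coprime \<delta> d" using d(2) coprime_\<delta> by blast
      qed
      then show "chi d * inverse (chi' d) = of_int (kronecker \<delta> d)" using e
        by (auto simp: minus_equation_iff[of _ 1])
    qed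
    then show "[?X = ?X'] (mod 24) \<and> [?Y = ?Y'] (mod 24) \<and> ?Q"
      using X Y by (simp add: cong_iff_dvd_diff)
  next
    assume A: "[?X = ?X'] (mod 24) \<and> [?Y = ?Y'] (mod 24) \<and> ?Q"
    then have X: "24 dvd ?X - ?X'" and Y: "24 dvd ?Y - ?Y'" and Q: ?Q by (simp_all add: cong_iff_dvd_diff)
    show ?C unfolding cmp
    proof (intro allI impI)
      fix a \<beta> \<gamma> d :: int and \<epsilon> :: complex
      assume det: "a * d - int l * \<beta> * (int N * \<gamma>) = 1" and eps: "\<epsilon> \<in> {1, -1}"
      define j where "j = (if odd d then 0 else 1 :: int)"
      define d' where "d' = d + j * (int l * (int N * \<gamma>))"
      have odd: "odd d'"
      proof (cases "odd d")
        case False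
        have "odd (a * d - int l * \<beta> * (int N * \<gamma>))" unfolding det by simp
        \<comment> \<open>For even d the determinant condition makes the other product odd, so a
          single translation changes the parity of d.\<close>
        then have "odd (int l * (int N * \<gamma>))" using False by auto
        then show ?thesis using False by (simp add: d'_def j_def)
      qed (simp add: d'_def j_def)
      have "int (N * l) * (- (\<gamma> * (\<beta> + j * a))) + d' * a = 1" using det by (simp add: d'_def algebra_simps)
      then have cop: "coprime (int (N * l)) d'" by (rule coprime_of_bezout)
      have e: "chi d' * inverse (chi' d') = of_int (kronecker \<delta> d')" using Q odd cop by blast
      have d0: "d' \<noteq> 0" using odd by auto
      have "kronecker \<delta> d' \<in> {1, -1}"
      proof (rule kronecker_values[OF d0])
        show "coprime \<delta> d'" using cop coprime_\<delta> by blast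
      qed
      then have k: "of_int (kronecker \<delta> d') * of_int (kronecker \<delta> d') = (1 :: complex)" by auto
      have "24 dvd \<gamma> * (?X - ?X') * (a * (1 - d'\<^sup>2) - d') + ((\<beta> + j * a) * d' - j) * (?Y - ?Y')"
        using X Y by (intro dvd_add dvd_mult dvd_mult2) auto
      then have "?val a \<beta> \<gamma> d' j = 1" unfolding e k by (simp only: root24_eq_1_iff[THEN iffD2] mult_1_right)
      then show "char_of_dirichlet chi (mat2 a \<beta> (int N * (int l * \<gamma>)) d, \<epsilon>) * eta_quotient_char N r (mat2 a \<beta> (int N * (int l * \<gamma>)) d, \<epsilon>)
        = char_of_dirichlet chi' (mat2 a (int l * \<beta>) (int N * \<gamma>) d, \<epsilon>) * eta_quotient_char N r' (mat2 a (int l * \<beta>) (int N * \<gamma>) d, \<epsilon>)"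
        using key[OF det eps d'_def odd] by blast
    qed
  qed
qed

section \<open>Passage to the four conditions and to the square criterion\<close>

lemma dirichlet_char_periodic:
  assumes "dirichlet_char N \<psi>"
  shows "\<psi> (a + int N * k) = \<psi> a"
proof -
  have step: "\<psi> (a + int N) = \<psi> a" for a using assms by (simp add: dirichlet_char_def)
  show ?thesis
  proof (induction k rule: int_induct[where k = 0])
    case (step1 k)
    then show ?case using step[of "a + int N * k"] by (simp add: algebra_simps)
  next
    case (step2 k)
    then show ?case using step[of "a + int N * (k - 1)"] by (simp add: algebra_simps)
  qed simp
qed

theorem theorem3p13:
  fixes l N :: nat
    and r r' :: "nat \<Rightarrow> int"
    and chi chi' :: "int \<Rightarrow> complex"
    and k :: real
    and \<delta> :: int
  assumes l_pos: "l > 0"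
    and N_pos: "N > 0"
    and supp: "\<And>n. n > 0 \<Longrightarrow> r n \<noteq> 0 \<or> r' n \<noteq> 0 \<Longrightarrow> n dvd N"
    and sum_eq: "(\<Sum>n | n dvd N. r n) = (\<Sum>n | n dvd N. r' n)"
    and chi: "dirichlet_char N chi"
    and chi': "dirichlet_char N chi'"
    and k_eq: "k = 1 / 2 * of_int (\<Sum>n | n dvd N. r n)"
    and \<delta>_eq: "\<delta> = int l ^ nat \<lfloor>2 * \<bar>k\<bar>\<rfloor> * (\<Prod>n | n dvd N \<and> \<not> 2 dvd (r n - r' n). int n)"
  shows "(compatible Mp (mp_preimage (Gamma0 N)) (mat2 1 0 0 (real l), 1)
           (\<lambda>x. char_of_dirichlet chi x * eta_quotient_char N r x)
           (\<lambda>x. char_of_dirichlet chi' x * eta_quotient_char N r' x)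
         \<longleftrightarrow>
           [int l * (\<Sum>n | n dvd N. int (N div n) * r n) = (\<Sum>n | n dvd N. int (N div n) * r' n)] (mod 24) \<and>
           [(\<Sum>n | n dvd N. int n * r n) = int l * (\<Sum>n | n dvd N. int n * r' n)] (mod 24) \<and>
           (\<not> 2 dvd N * l \<longrightarrow> [\<delta> = 1] (mod 4)) \<and>
           (\<forall>d :: int. d \<noteq> 0 \<longrightarrow> gcd (int (N * l)) d = 1 \<longrightarrow>
              chi d * inverse (chi' d) = of_int (kronecker \<delta> d)))
         \<and>
         (compatible Mp (mp_preimage (Gamma0 N)) (mat2 1 0 0 (real l), 1)
           (eta_quotient_char N r) (eta_quotient_char N r')
         \<longleftrightarrow>
           [int l * (\<Sum>n | n dvd N. int (N div n) * r n) = (\<Sum>n | n dvd N. int (N div n) * r' n)] (mod 24) \<and>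
           [(\<Sum>n | n dvd N. int n * r n) = int l * (\<Sum>n | n dvd N. int n * r' n)] (mod 24) \<and>
           (\<exists>m :: int. \<delta> = m\<^sup>2))"
proof -
  let ?R = "\<Sum>n | n dvd N. r n"
  let ?S = "{n. n dvd N \<and> \<not> 2 dvd (r n - r' n)}"
  let ?X = "[int l * (\<Sum>n | n dvd N. int (N div n) * r n) = (\<Sum>n | n dvd N. int (N div n) * r' n)] (mod 24)"
  let ?Y = "[(\<Sum>n | n dvd N. int n * r n) = int l * (\<Sum>n | n dvd N. int n * r' n)] (mod 24)"
  let ?Q = "\<lambda>\<psi> :: int \<Rightarrow> complex. \<forall>d. odd d \<longrightarrow> coprime (int (N * l)) d \<longrightarrow> \<psi> d = of_int (kronecker \<delta> d)"
  have "2 * \<bar>k\<bar> = of_int \<bar>?R\<bar>" unfolding k_eq by simp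
  then have "\<lfloor>2 * \<bar>k\<bar>\<rfloor> = \<bar>?R\<bar>" by (simp only: floor_of_int)
  then have \<delta>: "\<delta> = int l ^ nat \<bar>?R\<bar> * (\<Prod>n | n dvd N \<and> \<not> 2 dvd (r n - r' n). int n)"
    using \<delta>_eq by simp
  have fin: "finite ?S" using N_pos by simp
  have pos: "n > 0" if "n dvd N" for n using that N_pos by (metis dvd_0_left_iff gr0I less_irrefl)
  have "(\<Prod>n\<in>?S. int n) > 0" using pos by (intro prod_pos) auto
  then have \<delta>0: "\<delta> > 0" using l_pos by (simp add: \<delta>)
  have M: "int (N * l) > 0" using l_pos N_pos by simp
  have \<delta>_odd: "odd \<delta>" if "odd (int (N * l))"
  proof -
    have oN: "odd N" and ol: "odd l" using that by simp_all
    have "odd n" if "n \<in> ?S" for n using that oN dvd_trans by blast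
    then have "odd (\<Prod>n\<in>?S. int n)" using fin by (simp add: prime_dvd_prod_iff)
    then show ?thesis using ol by (simp add: \<delta>)
  qed
  have \<delta>_cop: "coprime \<delta> d" if "coprime (int (N * l)) d" for d
  proof -
    have N1: "coprime (int N) d" and l1: "coprime (int l) d" using that by simp_all
    have "coprime (\<Prod>n\<in>?S. int n) d"
    proof (rule prod_coprime_left)
      fix n assume "n \<in> ?S"
      then have "int n dvd int N" by simp
      then show "coprime (int n) d" by (rule coprime_divisors[OF _ dvd_refl N1])
    qed
    then show ?thesis using l1 by (simp add: \<delta>)
  qed
  have nz: "chi' d \<noteq> 0" if "coprime d (int N)" for d
    using chi' that by (simp add: dirichlet_char_def)
  have one: "chi 1 = 1" "chi' 1 = 1" using chi chi' by (simp_all add: dirichlet_char_def)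
  note per = dirichlet_char_periodic[OF chi] dirichlet_char_periodic[OF chi']
  have 1: "compatible Mp (mp_preimage (Gamma0 N)) (mat2 1 0 0 (real l), 1)
           (\<lambda>x. char_of_dirichlet chi x * eta_quotient_char N r x)
           (\<lambda>x. char_of_dirichlet chi' x * eta_quotient_char N r' x)
     \<longleftrightarrow> ?X \<and> ?Y \<and> ?Q (\<lambda>d. chi d * inverse (chi' d))"
    by (rule compatible_eta_quotient_iff[OF l_pos N_pos sum_eq one per nz \<delta>])
  have 2: "?Q (\<lambda>d. chi d * inverse (chi' d)) \<longleftrightarrow>
      ((odd (int (N * l)) \<longrightarrow> [\<delta> = 1] (mod 4)) \<and>
       (\<forall>d. d \<noteq> 0 \<longrightarrow> coprime (int (N * l)) d \<longrightarrow> chi d * inverse (chi' d) = of_int (kronecker \<delta> d)))"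
    by (rule kronecker_character_odd_iff[where N = "int N"])
       (use \<delta>0 M \<delta>_odd per one in auto)
  \<comment> \<open>The constant function 1 plays the role of both characters.\<close>
  have 3: "compatible Mp (mp_preimage (Gamma0 N)) (mat2 1 0 0 (real l), 1)
           (\<lambda>x. char_of_dirichlet (\<lambda>_. 1) x * eta_quotient_char N r x)
           (\<lambda>x. char_of_dirichlet (\<lambda>_. 1) x * eta_quotient_char N r' x)
     \<longleftrightarrow> ?X \<and> ?Y \<and> ?Q (\<lambda>d. 1 * inverse 1)"
    by (rule compatible_eta_quotient_iff[OF l_pos N_pos sum_eq _ _ _ _ _ \<delta>]) simp_all
  \<comment> \<open>Squareness is read off directly from the condition at odd d, without passing
    through (3) and (4).\<close>
  have 4: "?Q (\<lambda>d. 1 * inverse 1) \<longleftrightarrow> (\<exists>m. \<delta> = m\<^sup>2)"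
  proof
    assume "?Q (\<lambda>d. 1 * inverse 1)"
    then have "kronecker \<delta> d = 1" if "odd d" "coprime (int (N * l)) d" for d
      using that by (metis inverse_1 mult_1 of_int_eq_1_iff)
    then show "\<exists>m. \<delta> = m\<^sup>2" by (rule square_if_kronecker_eq_1[OF \<delta>0 M])
  next
    assume "\<exists>m. \<delta> = m\<^sup>2"
    then obtain m where m: "\<delta> = m\<^sup>2" by blast
    show "?Q (\<lambda>d. 1 * inverse 1)"
    proof (intro allI impI)
      fix d :: int assume d: "odd d" "coprime (int (N * l)) d"
      have "m \<noteq> 0" "coprime m d" using m \<delta>0 \<delta>_cop[OF d(2)] by auto
      then show "1 * inverse 1 = (of_int (kronecker \<delta> d) :: complex)"
        using kronecker_square_left[OF d(1)] by (simp add: m)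
    qed
  qed
  have triv: "char_of_dirichlet (\<lambda>_. 1) x = 1" for x
    by (simp add: char_of_dirichlet_def split: prod.split)
  have 5: "odd (int (N * l)) \<longleftrightarrow> \<not> 2 dvd N * l" by simp
  have 6: "gcd (int (N * l)) d = 1 \<longleftrightarrow> coprime (int (N * l)) d" for d
    by (simp add: coprime_iff_gcd_eq_1)
  have "compatible Mp (mp_preimage (Gamma0 N)) (mat2 1 0 0 (real l), 1) (eta_quotient_char N r) (eta_quotient_char N r')
     \<longleftrightarrow> ?X \<and> ?Y \<and> (\<exists>m. \<delta> = m\<^sup>2)"
    using 3[unfolded 4] by (simp only: triv mult_1_left)
  with 1[unfolded 2 5] show ?thesis by (simp only: 6)
qed

end
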